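(* Let $\mathcal{Q}$ and $A\subset\mathcal{X}$ be as in the context (in particular, $\mathcal{Q}$ is a non-empty, compact, convex set of rate matrices with separately specified rows, all states in $A$ are absorbing, and $A$ is lower reachable from every state in $A^c$). For every $Q\in\mathcal{Q}$ let $h^Q$ be the minimal non-negative solution of $\mathbb{I}_A h^Q=\mathbb{I}_{A^c}+\mathbb{I}_{A^c}Qh^Q$, and let $\underline{h}:=\inf_{Q\in\mathcal{Q}}h^Q$ and $\overline{h}:=\sup_{Q\in\mathcal{Q}}h^Q$ (pointwise). Then, as functions on $\mathcal{X}$, $$\underline{h}=\underline{\mathbb{E}}^{\mathrm{HM}}_{\mathcal{Q}}[\tau_{\mathbb{R}_{\geq0}}\mid X_0]=\underline{\mathbb{E}}^{\mathrm{M}}_{\mathcal{Q}}[\tau_{\mathbb{R}_{\geq0}}\mid X_0]=\underline{\mathbb{E}}^{\mathrm{I}}_{\mathcal{Q}}[\tau_{\mathbb{R}_{\geq0}}\mid X_0],$$ and, moreover, $$\overline{h}=\overline{\mathbb{E}}^{\mathrm{HM}}_{\mathcal{Q}}[\tau_{\mathbb{R}_{\geq0}}\mid X_0]=\overline{\mathbb{E}}^{\mathrm{M}}_{\mathcal{Q}}[\tau_{\mathbb{R}_{\geq0}}\mid X_0]=\overline{\mathbb{E}}^{\mathrm{I}}_{\mathcal{Q}}[\tau_{\mathbb{R}_{\geq0}}\mid X_0].$$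
   Context: $\mathcal{X}$ is a finite set with at least two elements; $A\subset\mathcal{X}$ is a fixed non-empty proper subset and $A^c=\mathcal{X}\setminus A$. $\mathbb{R}^{\mathcal{X}}$ is the space of real functions on $\mathcal{X}$ with the supremum norm $\|\cdot\|$; inequalities, infima, suprema and products of functions are pointwise; $\mathbb{I}_B$ is the indicator of $B$, and $\mathbb{I}_x:=\mathbb{I}_{\{x\}}$. A (non-linear) operator $M$ with $M(\lambda f)=\lambda Mf$ for $\lambda\ge 0$ has norm $\|M\|=\sup\{\|Mf\|:\|f\|=1\}$. A rate matrix is a linear operator $Q$ on $\mathbb{R}^{\mathcal{X}}$, with entries $Q(x,y)=Q\mathbb{I}_y(x)$, such that $Q(x,y)\ge0$ for $x\ne y$ and $\sum_yQ(x,y)=0$ for all $x$. Standing assumptions. $\mathcal{Q}$ is a non-empty, compact, convex set of rate matrices with separately specified rows: for any family $(Q_x)_{x\in\mathcal{X}}$ in $\mathcal{Q}$, the matrix whose $x$-row is the $x$-row of $Q_x$, for each $x$, belongs to $\mathcal{Q}$. Let $\underline{Q}f:=\inf_{Q\in\mathcal{Q}}Qf$ and $\overline{Q}f:=\sup_{Q\in\mathcal{Q}}Qf$ (pointwise), and for $t\ge0$ let $e^{\underline{Q}t}:=\lim_{n\to\infty}(I+\frac{t}{n}\underline{Q})^n$ (limit in operator norm; it exists). Assume: (1) $Q(x,x)=0$ for all $Q\in\mathcal{Q}$ and $x\in A$; (2) $e^{\underline{Q}t}\mathbb{I}_A(x)>0$ for all $t>0$ and $x\in A^c$. Processes. $\Omega_{\mathbb{R}_{\ge0}}$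 is the set of cadlag functions $\omega:\mathbb{R}_{\ge0}\to\mathcal{X}$, with the $\sigma$-algebra generated by the coordinate maps $X_t(\omega)=\omega(t)$. A continuous-time stochastic process $P$ is a probability measure on this space, where conditional probability measures $P(\cdot\mid X_u=x_u)$ are taken to be given for every finite history $X_u=x_u$, i.e. $X_{t_0}=x_{t_0},\dots,X_{t_n}=x_{t_n}$ with $u=\{t_0<\dots<t_n\}$ (including those of probability zero; the empty history corresponds to $P$ itself), with $P(X_u=x_u\mid X_u=x_u)=1$ and with the chain rule $P(B\cap\{X_s=y\}\mid X_u=x_u)=P(B\mid X_u=x_u,X_s=y)\,P(X_s=y\mid X_u=x_u)$ for all $s>\max u$, $y\in\mathcal{X}$ and all events $B$ generated by $(X_r)_{r\ge s}$. $P$ is a Markov chain if $P(X_s=y\mid X_{t_0}=x_{t_0},\dots,X_{t_n}=x_{t_n})=P(X_s=y\mid X_{t_n}=x_{t_n})$ for all $t_0<\dots<t_n\le s$ and all states; it is a homogeneous Markov chain if in addition $P(X_s=y\mid X_t=x)=P(X_{s-t}=y\mid X_0=x)$ for all $t\le s$. A homogeneous Markov chain $P$ has a unique rate matrix ${}^PQ$ such that $P(X_t=y\mid X_0=x)=e^{{}^PQt}(x,y)$ for all $t\geq 0$. Consistency with $\mathcal{Q}$. For a process $P$, a (possibly empty) history $X_u=x_u$ and $\max u<t\le s$, let $T_{t,x_u}^s(x,y):=P(X_s=y\mid X_t=x,X_u=x_u)$. $P$ is consistent with $\mathcal{Q}$ if, for every history $X_u=x_u$ and every $t>\max u$ (every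 $t\ge0$ if $u=\emptyset$): the quotients $\frac1\Delta(T_{t,x_u}^{t+\Delta}-I)$ and, if $t>0$, $\frac1\Delta(T_{t-\Delta,x_u}^{t}-I)$ have bounded norm as $\Delta\to0^+$ (finite $\limsup$), and every limit of either quotient along a sequence $\Delta_i\to0^+$ belongs to $\mathcal{Q}$. Imprecise-Markov chains. $\mathcal{P}^{\mathrm{HM}}_{\mathcal{Q}}$ is the set of all homogeneous Markov chains $P$ with ${}^PQ\in\mathcal{Q}$; $\mathcal{P}^{\mathrm{M}}_{\mathcal{Q}}$ is the set of all Markov chains consistent with $\mathcal{Q}$; $\mathcal{P}^{\mathrm{I}}_{\mathcal{Q}}$ is the set of all processes consistent with $\mathcal{Q}$. Initial distributions are unconstrained. One has $\mathcal{P}^{\mathrm{HM}}_{\mathcal{Q}}\subseteq\mathcal{P}^{\mathrm{M}}_{\mathcal{Q}}\subseteq\mathcal{P}^{\mathrm{I}}_{\mathcal{Q}}$. Hitting times. $\tau_{\mathbb{R}_{\ge0}}(\omega):=\inf\{t\ge0:\omega(t)\in A\}\in[0,+\infty]$; $\mathbb{E}_P[\tau_{\mathbb{R}_{\ge0}}\mid X_0=x]:=\int\tau_{\mathbb{R}_{\ge0}}\,\mathrm{d}P(\cdot\mid X_0=x)$, and $\mathbb{E}_P[\tau_{\mathbb{R}_{\ge0}}\mid X_0]$ denotes the function $x\mapsto\mathbb{E}_P[\tau_{\mathbb{R}_{\ge0}}\mid X_0=x]$. For $*\in\{\mathrm{HM},\mathrm{M},\mathrm{I}\}$, $\underline{\mathbb{E}}^{*}_{\mathcal{Q}}[\cdot\mid\cdot]:=\inf_{P\in\mathcal{P}^*_{\mathcal{Q}}}\mathbb{E}_P[\cdot\mid\cdot]$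 and $\overline{\mathbb{E}}^{*}_{\mathcal{Q}}[\cdot\mid\cdot]:=\sup_{P\in\mathcal{P}^*_{\mathcal{Q}}}\mathbb{E}_P[\cdot\mid\cdot]$. "Minimal non-negative solution" means the pointwise smallest among the non-negative solutions. *)

theory Defs
  imports "HOL-Probability.Probability"
begin

section \<open>Operators and rate matrices\<close>

text \<open>The finite state space is the type \<^typ>\<open>'x\<close>; real functions on it are vectors
  \<^typ>\<open>real ^ 'x\<close>, on which \<open>\<le>\<close> and \<open>*\<close> are pointwise and \<^const>\<open>infnorm\<close> is the
  supremum norm. The entry \<open>Q(x,y)\<close> of a matrix is \<open>Q $ x $ y\<close>.\<close>

definition indv :: "'x::finite set \<Rightarrow> real ^ 'x" where
  "indv B = (\<chi> x. indicator B x)"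

definition nonneg_homogeneous :: "(real ^ 'x::finite \<Rightarrow> real ^ 'x) \<Rightarrow> bool" where
  "nonneg_homogeneous M \<longleftrightarrow> (\<forall>c f. 0 \<le> c \<longrightarrow> M (c *\<^sub>R f) = c *\<^sub>R M f)"

text \<open>The operator norm is extended-valued, so that it is also meaningful for unbounded operators.\<close>

definition opnorm :: "(real ^ 'x::finite \<Rightarrow> real ^ 'x) \<Rightarrow> ennreal" where
  "opnorm M = (SUP f\<in>{f. infnorm f = 1}. ennreal (infnorm (M f)))"

text \<open>The limit of \<open>(I + (t/n) M)^n\<close> in operator norm. Restricting to non-negatively
  homogeneous operators makes it unique, since the operator norm only looks at the unit
  sphere. For linear \<open>M\<close> this is the matrix exponential.\<close>

definition op_exp :: "(real ^ 'x::finite \<Rightarrow> real ^ 'x) \<Rightarrow> real \<Rightarrow> real ^ 'x \<Rightarrow> real ^ 'x" where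
  "op_exp M t = (THE L. nonneg_homogeneous L \<and>
     (\<lambda>n. opnorm (\<lambda>f. ((\<lambda>g. g + (t / real n) *\<^sub>R M g) ^^ n) f - L f)) \<longlonglongrightarrow> 0)"

definition rate_matrix :: "real ^ 'x ^ 'x::finite \<Rightarrow> bool" where
  "rate_matrix Q \<longleftrightarrow>
     (\<forall>x y. x \<noteq> y \<longrightarrow> 0 \<le> Q $ x $ y) \<and> (\<forall>x. (\<Sum>y\<in>UNIV. Q $ x $ y) = 0)"

definition separately_specified_rows :: "(real ^ 'x ^ 'x::finite) set \<Rightarrow> bool" where
  "separately_specified_rows \<Q> \<longleftrightarrow> (\<forall>R. (\<forall>x. R x \<in> \<Q>) \<longrightarrow> (\<chi> x. R x $ x) \<in> \<Q>)"

definition lower_rate :: "(real ^ 'x ^ 'x::finite) set \<Rightarrow> real ^ 'x \<Rightarrow> real ^ 'x" where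
  "lower_rate \<Q> f = (\<chi> x. INF Q\<in>\<Q>. (Q *v f) $ x)"

section \<open>Stochastic processes\<close>

text \<open>Cadlag functions from the non-negative reals to the (discrete) state space; a function on
  the non-negative reals is a function on \<^typ>\<open>real\<close> that is \<^const>\<open>undefined\<close> elsewhere.\<close>

definition paths :: "(real \<Rightarrow> 'x::finite) set" where
  "paths = {\<omega> \<in> extensional {0..}.
     (\<forall>t\<ge>0. limitin (discrete_topology UNIV) \<omega> (\<omega> t) (at_right t)) \<and>
     (\<forall>t>0. \<exists>y. limitin (discrete_topology UNIV) \<omega> y (at_left t))}"

definition at_state :: "real \<Rightarrow> 'x \<Rightarrow> (real \<Rightarrow> 'x::finite) set" where
  "at_state t x = {\<omega> \<in> paths. \<omega> t = x}"

text \<open>The \<open>\<sigma>\<close>-algebra generated by the coordinates \<open>X\<^sub>t\<close> with \<open>t \<in> T\<close> (the measure is irrelevant).\<close>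

definition coord_algebra :: "real set \<Rightarrow> (real \<Rightarrow> 'x::finite) measure" where
  "coord_algebra T = sigma paths {at_state t x | t x. t \<in> T}"

text \<open>A history \<open>X\<^sub>u = x\<^sub>u\<close> is a finite partial map with domain \<open>u\<close>. The conditional measures
  of a process given all histories are part of the process; its unconditional measure
  is the value at \<^const>\<open>Map.empty\<close>.\<close>

definition history :: "(real \<rightharpoonup> 'x::finite) \<Rightarrow> bool" where
  "history h \<longleftrightarrow> finite (dom h) \<and> dom h \<subseteq> {0..}"

definition history_event :: "(real \<rightharpoonup> 'x::finite) \<Rightarrow> (real \<Rightarrow> 'x) set" where
  "history_event h = {\<omega> \<in> paths. \<forall>t\<in>dom h. h t = Some (\<omega> t)}"

type_synonym 'x process = "(real \<rightharpoonup> 'x) \<Rightarrow> (real \<Rightarrow> 'x) measure"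

definition stochastic_process :: "'x::finite process \<Rightarrow> bool" where
  "stochastic_process P \<longleftrightarrow>
     (\<forall>h. history h \<longrightarrow>
        prob_space (P h) \<and> sets (P h) = sets (coord_algebra {0..}) \<and>
        measure (P h) (history_event h) = 1) \<and>
     (\<forall>h s y B. history h \<and> 0 \<le> s \<and> (\<forall>t\<in>dom h. t < s) \<and> B \<in> sets (coord_algebra {s..}) \<longrightarrow>
        measure (P h) (B \<inter> at_state s y) =
        measure (P (h(s \<mapsto> y))) B * measure (P h) (at_state s y))"

definition markov_chain :: "'x::finite process \<Rightarrow> bool" where
  "markov_chain P \<longleftrightarrow> stochastic_process P \<and>
     (\<forall>h t x s y. history h \<and> t \<in> dom h \<and> (\<forall>r\<in>dom h. r \<le> t) \<and> h t = Some x \<and> t \<le> s \<longrightarrow>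
        measure (P h) (at_state s y) = measure (P [t \<mapsto> x]) (at_state s y))"

definition homogeneous_markov_chain :: "'x::finite process \<Rightarrow> bool" where
  "homogeneous_markov_chain P \<longleftrightarrow> markov_chain P \<and>
     (\<forall>t s x y. 0 \<le> t \<and> t \<le> s \<longrightarrow>
        measure (P [t \<mapsto> x]) (at_state s y) = measure (P [0 \<mapsto> x]) (at_state (s - t) y))"

definition has_rate_matrix :: "'x::finite process \<Rightarrow> real ^ 'x ^ 'x \<Rightarrow> bool" where
  "has_rate_matrix P Q \<longleftrightarrow> rate_matrix Q \<and>
     (\<forall>t\<ge>0. \<forall>x y. measure (P [0 \<mapsto> x]) (at_state t y) = op_exp ((*v) Q) t (indv {y}) $ x)"

section \<open>Consistency and imprecise Markov chains\<close>

definition transition ::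
    "'x::finite process \<Rightarrow> (real \<rightharpoonup> 'x) \<Rightarrow> real \<Rightarrow> real \<Rightarrow> real ^ 'x ^ 'x" where
  "transition P h t s = (\<chi> x y. measure (P (h(t \<mapsto> x))) (at_state s y))"

definition outer_derivatives_in ::
    "(real \<Rightarrow> real ^ 'x ^ 'x::finite) \<Rightarrow> (real ^ 'x ^ 'x) set \<Rightarrow> bool" where
  "outer_derivatives_in D \<Q> \<longleftrightarrow>
     Limsup (at_right 0) (\<lambda>\<Delta>. opnorm ((*v) (D \<Delta>))) < \<infinity> \<and>
     (\<forall>\<Delta> Q. filterlim \<Delta> (at_right 0) sequentially \<and> (\<lambda>i. D (\<Delta> i)) \<longlonglongrightarrow> Q \<longrightarrow> Q \<in> \<Q>)"

text \<open>Below, \<open>t - \<Delta>\<close> is non-negative and exceeds all times in the history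
  for all sufficiently small \<open>\<Delta> > 0\<close>, which is all that matters in the limit.\<close>

definition consistent_with :: "'x::finite process \<Rightarrow> (real ^ 'x ^ 'x) set \<Rightarrow> bool" where
  "consistent_with P \<Q> \<longleftrightarrow>
     (\<forall>h t. history h \<and> 0 \<le> t \<and> (\<forall>r\<in>dom h. r < t) \<longrightarrow>
        outer_derivatives_in (\<lambda>\<Delta>. (1 / \<Delta>) *\<^sub>R (transition P h t (t + \<Delta>) - mat 1)) \<Q> \<and>
        (0 < t \<longrightarrow>
          outer_derivatives_in (\<lambda>\<Delta>. (1 / \<Delta>) *\<^sub>R (transition P h (t - \<Delta>) t - mat 1)) \<Q>))"

definition P_HM :: "(real ^ 'x ^ 'x::finite) set \<Rightarrow> 'x process set" where
  "P_HM \<Q> = {P. homogeneous_markov_chain P \<and> (\<exists>Q\<in>\<Q>. has_rate_matrix P Q)}"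

definition P_M :: "(real ^ 'x ^ 'x::finite) set \<Rightarrow> 'x process set" where
  "P_M \<Q> = {P. markov_chain P \<and> consistent_with P \<Q>}"

definition P_I :: "(real ^ 'x ^ 'x::finite) set \<Rightarrow> 'x process set" where
  "P_I \<Q> = {P. stochastic_process P \<and> consistent_with P \<Q>}"

section \<open>Hitting times\<close>

text \<open>The infimum of the empty set is \<open>\<infinity>\<close> here.\<close>

definition hitting_time :: "'x set \<Rightarrow> (real \<Rightarrow> 'x::finite) \<Rightarrow> ennreal" where
  "hitting_time A \<omega> = (INF t\<in>{t. 0 \<le> t \<and> \<omega> t \<in> A}. ennreal t)"

definition expected_hitting_time :: "'x set \<Rightarrow> 'x::finite process \<Rightarrow> 'x \<Rightarrow> ennreal" where
  "expected_hitting_time A P x = (\<integral>\<^sup>+ \<omega>. hitting_time A \<omega> \<partial>P [0 \<mapsto> x])"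

definition lower_expected_hitting_time :: "'x set \<Rightarrow> 'x::finite process set \<Rightarrow> 'x \<Rightarrow> ennreal" where
  "lower_expected_hitting_time A \<P> x = (INF P\<in>\<P>. expected_hitting_time A P x)"

definition upper_expected_hitting_time :: "'x set \<Rightarrow> 'x::finite process set \<Rightarrow> 'x \<Rightarrow> ennreal" where
  "upper_expected_hitting_time A \<P> x = (SUP P\<in>\<P>. expected_hitting_time A P x)"

definition hitting_solution :: "'x set \<Rightarrow> real ^ 'x ^ 'x::finite \<Rightarrow> real ^ 'x \<Rightarrow> bool" where
  "hitting_solution A Q h \<longleftrightarrow> 0 \<le> h \<and> indv A * h = indv (- A) + indv (- A) * (Q *v h)"

definition min_hitting_solution :: "'x set \<Rightarrow> real ^ 'x ^ 'x::finite \<Rightarrow> real ^ 'x" where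
  "min_hitting_solution A Q =
     (THE h. hitting_solution A Q h \<and> (\<forall>g. hitting_solution A Q g \<longrightarrow> h \<le> g))"

text \<open>The infimum and supremum are taken in \<open>[0, \<infinity>]\<close>, where the expectations live; in
  contrast to those in \<^typ>\<open>real\<close>, they are meaningful without a boundedness proof.\<close>

definition lower_h :: "'x set \<Rightarrow> (real ^ 'x ^ 'x::finite) set \<Rightarrow> 'x \<Rightarrow> ennreal" where
  "lower_h A \<Q> x = (INF Q\<in>\<Q>. ennreal (min_hitting_solution A Q $ x))"

definition upper_h :: "'x set \<Rightarrow> (real ^ 'x ^ 'x::finite) set \<Rightarrow> 'x \<Rightarrow> ennreal" where
  "upper_h A \<Q> x = (SUP Q\<in>\<Q>. ennreal (min_hitting_solution A Q $ x))"

end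

theory Submission
  imports Defs
begin

text \<open>By compactness and separately specified rows, some \<open>R \<in> \<Q>\<close> maximises \<open>h\<^sup>Q\<close> simultaneously in all
  states, and \<open>h = h\<^sup>R\<close> then satisfies \<open>1 + Q h \<le> 0\<close> off \<open>A\<close> for every \<open>Q \<in> \<Q>\<close>. For a process that is
  consistent with \<open>\<Q>\<close>, the upper right Dini derivative of \<open>t \<mapsto> E[h(X\<^sub>t)]\<close> is therefore at most
  \<open>- P(X\<^sub>t \<notin> A)\<close>; integrating over \<open>t\<close> yields \<open>E[\<tau>] \<le> h\<close>, because \<open>A\<close> is absorbing and hence
  \<open>P(\<tau> > t) = P(X\<^sub>t \<notin> A)\<close> for almost every \<open>t\<close>. The lower bound is symmetric, the boundary term \<open>E[h(X\<^sub>t)]\<close> vanishing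
  in the limit. Applied to \<open>{Q}\<close>, both bounds give \<open>E[\<tau>] = h\<^sup>Q\<close> for a homogeneous chain with rate
  matrix \<open>Q\<close>, so all that remains is the existence of such a chain on the space of cadlag paths,
  which is obtained by uniformization: \<open>Q = l (K - I)\<close> with \<open>K\<close> stochastic, and the chain moves
  according to \<open>K\<close> at the times of a Poisson process of rate \<open>l\<close>.\<close>

section \<open>Euler schemes for operator exponentials\<close>

text \<open>The obstacle is that a consistent process is constrained only infinitesimally: given
  each history, its difference quotients are bounded near zero and have their limit points in
  \<open>\<Q>\<close>, but they are not assumed to converge or to be bounded uniformly in time. So
  there is no differential equation to solve. A Dini estimate replaces it, and the continuity that
  this requires is extracted from the right and the left quotients. Lower reachability enters
  through each single matrix: no non-empty set of states outside \<open>A\<close> is closed under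
  \<open>Q\<close>. This gives a minimum principle, so the hitting equations form a nonsingular
  square system; Cramer's rule makes its solution continuous in \<open>Q\<close>, which is what
  compactness needs. Since \<open>op_exp\<close> is a definite description, convergence of the Euler
  scheme must be shown before the reachability hypothesis can be exploited, and again for
  identifying the exponential of a single matrix. A process includes a measure for every history,
  even one of probability zero. Hence the chain is built separately for each history and is not
  disintegrated from one law.\<close>

lemma infnorm_le_cartI:
  fixes v :: "real ^ 'x::finite"
  assumes "\<And>i. \<bar>v $ i\<bar> \<le> r"
  shows "infnorm v \<le> r"
  unfolding infnorm_cart by (rule cSup_least) (use assms in auto)

definition euler_step :: "(real ^ 'x::finite \<Rightarrow> real ^ 'x) \<Rightarrow> real \<Rightarrow> real ^ 'x \<Rightarrow> real ^ 'x" where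
  "euler_step M d g = g + d *\<^sub>R M g"

text \<open>An error made in one step is carried along by further applications of \<open>F\<close>,
  which do not enlarge it, so the \<open>n\<close> errors just add up. They are measured only along
  the orbit of \<open>G\<close>, where bounds are available.\<close>

lemma telescoping:
  fixes F G :: "real ^ 'x::finite \<Rightarrow> real ^ 'x"
  assumes F: "\<And>f g. infnorm (F f - F g) \<le> infnorm (f - g)"
    and "\<And>j. j < n \<Longrightarrow> infnorm (F ((G ^^ j) f) - G ((G ^^ j) f)) \<le> e"
  shows "infnorm ((F ^^ n) f - (G ^^ n) f) \<le> real n * e"
  using assms(2)
proof (induction n)
  case 0 then show ?case by (simp add: infnorm_0)
next
  case (Suc n)
  have "infnorm ((F ^^ Suc n) f - (G ^^ Suc n) f) \<le>
      infnorm (F ((F ^^ n) f) - F ((G ^^ n) f)) + infnorm (F ((G ^^ n) f) - G ((G ^^ n) f))"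
    using infnorm_triangle[of "F ((F ^^ n) f) - F ((G ^^ n) f)" "F ((G ^^ n) f) - G ((G ^^ n) f)"]
    by simp
  also have "\<dots> \<le> infnorm ((F ^^ n) f - (G ^^ n) f) + e"
    using F Suc.prems[of n] by (intro add_mono) auto
  also have "\<dots> \<le> real n * e + e" using Suc by simp
  finally show ?case by (simp add: algebra_simps)
qed

text \<open>The definite description in \<open>op_exp\<close> needs existence and uniqueness of the
  limit. Convergence in \<open>opnorm\<close> fixes a limit on the unit sphere only; homogeneity
  carries the equality to all other vectors. The threshold \<open>N\<close> leaves room for schemes
  that are controlled only for small steps.\<close>

lemma op_exp_eqI:
  fixes L :: "real ^ 'x::finite \<Rightarrow> real ^ 'x"
  assumes hom: "nonneg_homogeneous L"
    and bound: "\<And>n f. infnorm f = 1 \<Longrightarrow> n \<ge> N \<Longrightarrow> infnorm ((euler_step M (t / real n) ^^ n) f - L f) \<le> e n"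
    and e: "e \<longlonglongrightarrow> 0"
  shows "op_exp M t = L"
proof -
  let ?T = "\<lambda>n. ((\<lambda>g. g + (t / real n) *\<^sub>R M g) ^^ n)"
  have T: "?T n = euler_step M (t / real n) ^^ n" for n
    unfolding euler_step_def by simp
  have lim: "(\<lambda>n. opnorm (\<lambda>f. ?T n f - L f)) \<longlonglongrightarrow> 0"
  proof (rule tendsto_sandwich[where f = "\<lambda>_. 0"])
    show "\<forall>\<^sub>F n in sequentially. opnorm (\<lambda>f. ?T n f - L f) \<le> ennreal (e n)"
      using eventually_ge_at_top[of N]
    proof eventually_elim
      case (elim n)
      show ?case
        unfolding opnorm_def T
      proof (rule SUP_least)
        fix f :: "real ^ 'x" assume "f \<in> {f. infnorm f = 1}"
        then show "ennreal (infnorm ((euler_step M (t / real n) ^^ n) f - L f)) \<le> ennreal (e n)"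
          using bound elim by (simp add: ennreal_leI)
      qed
    qed
    show "(\<lambda>n. ennreal (e n)) \<longlonglongrightarrow> 0"
      using tendsto_ennrealI[OF e] by simp
  qed auto
  have "K = L" if K: "nonneg_homogeneous K" and Klim: "(\<lambda>n. opnorm (\<lambda>f. ?T n f - K f)) \<longlonglongrightarrow> 0" for K
  proof -
    have pt: "(\<lambda>n. infnorm (?T n f - J f)) \<longlonglongrightarrow> 0"
      if J: "(\<lambda>n. opnorm (\<lambda>f. ?T n f - J f)) \<longlonglongrightarrow> 0" and f: "infnorm f = 1" for J f
    proof -
      have "(\<lambda>n. ennreal (infnorm (?T n f - J f))) \<longlonglongrightarrow> 0"
      proof (rule tendsto_sandwich[OF _ _ _ J])
        show "\<forall>\<^sub>F n in sequentially. ennreal (infnorm (?T n f - J f)) \<le> opnorm (\<lambda>f. ?T n f - J f)"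
          using f by (intro always_eventually allI) (auto simp: opnorm_def intro!: SUP_upper)
      qed auto
      then have "(\<lambda>n. ennreal (infnorm (?T n f - J f))) \<longlonglongrightarrow> ennreal 0"
        by simp
      then have "(\<lambda>n. enn2real (ennreal (infnorm (?T n f - J f)))) \<longlonglongrightarrow> 0"
        by (rule tendsto_enn2real) (rule order_refl)
      then show ?thesis unfolding enn2real_ennreal[OF infnorm_pos_le] .
    qed
    have eq1: "K f = L f" if f: "infnorm f = 1" for f
    proof -
      have "(\<lambda>n. infnorm (?T n f - K f) + infnorm (?T n f - L f)) \<longlonglongrightarrow> 0 + 0"
        by (intro tendsto_add pt Klim lim f)
      moreover have "infnorm (K f - L f) \<le> infnorm (?T n f - K f) + infnorm (?T n f - L f)" for n
        using infnorm_triangle[of "K f - ?T n f" "?T n f - L f"] infnorm_sub[of "K f" "?T n f"] by simp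
      ultimately have "infnorm (K f - L f) \<le> 0"
        by (intro LIMSEQ_le_const) auto
      then show ?thesis using infnorm_pos_lt[of "K f - L f"] by force
    qed
    show "K = L"
    proof
      fix f
      show "K f = L f"
      proof (cases "f = 0")
        case True
        then show ?thesis using K hom unfolding nonneg_homogeneous_def
          by (metis order_refl scaleR_zero_left)
      next
        case False
        then have p: "infnorm f > 0" by (simp add: infnorm_pos_lt)
        let ?g = "(1 / infnorm f) *\<^sub>R f"
        have "infnorm ?g = 1" using p by (simp add: infnorm_mul)
        then have "K ?g = L ?g" by (rule eq1)
        then have "infnorm f *\<^sub>R K ?g = infnorm f *\<^sub>R L ?g" by simp
        then have "K (infnorm f *\<^sub>R ?g) = L (infnorm f *\<^sub>R ?g)"
          using K hom p unfolding nonneg_homogeneous_def by auto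
        then show ?thesis using p by simp
      qed
    qed
  qed
  then show ?thesis
    unfolding op_exp_def by (intro the_equality conjI hom lim) (elim conjE)
qed

lemma nonexpansive_funpow:
  fixes F :: "real ^ 'x::finite \<Rightarrow> real ^ 'x"
  assumes F: "\<And>f g. infnorm (F f - F g) \<le> infnorm (f - g)"
  shows "infnorm ((F ^^ n) f - (F ^^ n) g) \<le> infnorm (f - g)"
  by (induction n) (auto intro: order_trans[OF F])

text \<open>Convergence of the Euler scheme: a step of length \<open>k d\<close> and \<open>k\<close> steps of length \<open>d\<close> differ
  by \<open>O((k d)\<^sup>2)\<close>, so the \<open>n\<close>-step and the \<open>n m\<close>-step schemes on \<open>[0, t]\<close> differ by \<open>O(t\<^sup>2 / n)\<close>.\<close>

locale euler_scheme =
  fixes M :: "real ^ 'x::finite \<Rightarrow> real ^ 'x" and c d0 :: real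
  assumes hom: "nonneg_homogeneous M"
    and lip: "infnorm (M f - M g) \<le> c * infnorm (f - g)"
    and d0: "0 < d0"
    and nonexp: "0 \<le> d \<Longrightarrow> d \<le> d0 \<Longrightarrow> infnorm (euler_step M d f - euler_step M d g) \<le> infnorm (f - g)"
begin

lemma M_0 [simp]: "M 0 = 0"
  using hom unfolding nonneg_homogeneous_def by (metis order_refl scaleR_zero_left)

lemma step_0 [simp]: "euler_step M d 0 = 0"
  by (simp add: euler_step_def)

lemma step_pow_0 [simp]: "(euler_step M d ^^ n) 0 = 0"
  by (induction n) auto

lemma infnorm_step_pow:
  assumes "0 \<le> d" "d \<le> d0"
  shows "infnorm ((euler_step M d ^^ n) f) \<le> infnorm f"
  using nonexpansive_funpow[of "euler_step M d" n f 0, OF nonexp[OF assms]] by simp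

text \<open>By nonexpansiveness no increment along the orbit exceeds the first one, whose size is at
  most \<open>d * c * infnorm f\<close>.\<close>

lemma step_pow_dist:
  assumes "0 \<le> d" "d \<le> d0"
  shows "infnorm ((euler_step M d ^^ k) f - f) \<le> real k * d * c * infnorm f"
proof (induction k)
  case 0 then show ?case by (simp add: infnorm_0)
next
  case (Suc k)
  let ?s = "euler_step M d"
  have "infnorm ((?s ^^ Suc k) f - f) \<le> infnorm ((?s ^^ k) (?s f) - (?s ^^ k) f) + infnorm ((?s ^^ k) f - f)"
    using infnorm_triangle[of "(?s ^^ k) (?s f) - (?s ^^ k) f" "(?s ^^ k) f - f"]
    by (simp add: funpow_swap1)
  also have "infnorm ((?s ^^ k) (?s f) - (?s ^^ k) f) \<le> infnorm (?s f - f)"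
    by (rule nonexpansive_funpow) (rule nonexp[OF assms])
  also have "infnorm (?s f - f) = d * infnorm (M f)"
    using assms by (simp add: euler_step_def infnorm_mul)
  also have "\<dots> \<le> d * (c * infnorm f)"
    using lip[of f 0] assms by (intro mult_left_mono) auto
  finally show ?case using Suc by (simp add: algebra_simps)
qed

lemma c_infnorm_nonneg:
  fixes f :: "real ^ 'x"
  shows "0 \<le> c * infnorm f"
  using lip[of f 0] infnorm_pos_le[of "M f - M 0"] by simp

text \<open>The single long step evaluates \<open>M\<close> at \<open>f\<close> throughout, whereas
  the short step number \<open>j\<close> evaluates it at a point within
  \<open>j * d * c * infnorm f\<close> of \<open>f\<close>. By the Lipschitz bound the discrepancies
  add up to at most half of the stated bound.\<close>

lemma step_pow_first_order:
  assumes "0 \<le> d" "d \<le> d0"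
  shows "infnorm ((euler_step M d ^^ k) f - euler_step M (real k * d) f) \<le> (real k * d * c)\<^sup>2 * infnorm f"
proof (induction k)
  case 0 then show ?case by (simp add: infnorm_0 euler_step_def)
next
  case (Suc k)
  let ?s = "euler_step M d"
  let ?g = "(?s ^^ k) f"
  have c2: "0 \<le> c * (c * infnorm f)"
    using infnorm_pos_le[of f] by (simp add: mult.assoc[symmetric])
  have eq: "(?s ^^ Suc k) f - euler_step M (real (Suc k) * d) f =
      (?g - euler_step M (real k * d) f) + d *\<^sub>R (M ?g - M f)"
    by (simp add: euler_step_def algebra_simps)
  have "infnorm ((?s ^^ Suc k) f - euler_step M (real (Suc k) * d) f) \<le>
      infnorm (?g - euler_step M (real k * d) f) + d * infnorm (M ?g - M f)"
    unfolding eq using infnorm_triangle[of "?g - euler_step M (real k * d) f" "d *\<^sub>R (M ?g - M f)"] assms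
    by (simp add: infnorm_mul)
  also have "\<dots> \<le> (real k * d * c)\<^sup>2 * infnorm f + d * (c * infnorm (?g - f))"
    using Suc lip[of ?g f] assms by (intro add_mono mult_left_mono) auto
  also have "d * (c * infnorm (?g - f)) \<le> d * (c * (real k * d * c * infnorm f))"
  proof (cases "0 \<le> c")
    case True
    then show ?thesis using step_pow_dist[OF assms, of k f] assms by (intro mult_left_mono) auto
  next
    \<comment> \<open>No sign of \<open>c\<close> is assumed. If it is negative, the Lipschitz bound
      forces every norm to be zero, and both sides vanish.\<close>
    case False
    then have "infnorm v = 0" for v :: "real ^ 'x"
      using c_infnorm_nonneg[of v] infnorm_pos_le[of v] by (smt (verit) mult_neg_pos)
    then have "infnorm f = 0" "infnorm (?g - f) = 0" by auto
    then show ?thesis by simp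
  qed
  also have "(real k * d * c)\<^sup>2 * infnorm f + d * (c * (real k * d * c * infnorm f)) \<le> (real (Suc k) * d * c)\<^sup>2 * infnorm f"
  proof -
    have "(real (Suc k) * d * c)\<^sup>2 * infnorm f = (real k * d * c)\<^sup>2 * infnorm f + 2 * (d * (c * (real k * d * c * infnorm f)))
        + d\<^sup>2 * (c * (c * infnorm f))"
      by (simp add: power2_eq_square algebra_simps)
    moreover have "0 \<le> (d * c)\<^sup>2 * (real k * infnorm f)"
      by (simp add: infnorm_pos_le)
    then have "0 \<le> d * (c * (real k * d * c * infnorm f))"
      by (simp add: power2_eq_square mult_ac)
    moreover have "0 \<le> d\<^sup>2 * (c * (c * infnorm f))"
      using c2 by simp
    ultimately show ?thesis by linarith
  qed
  finally show ?case by simp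
qed

lemma refinement:
  assumes t: "0 \<le> t" and n: "0 < n" "t / real n \<le> d0" and m: "0 < m"
  shows "infnorm ((euler_step M (t / real n) ^^ n) f - (euler_step M (t / real (n * m)) ^^ (n * m)) f)
     \<le> (t * c)\<^sup>2 / real n * infnorm f"
proof -
  let ?d = "t / real (n * m)"
  have md: "real m * ?d = t / real n" using m by simp
  have d: "0 \<le> ?d" using t by simp
  have "?d \<le> real m * ?d" using m d mult_right_mono[of 1 "real m" ?d] by simp
  then have d': "?d \<le> d0" using n unfolding md by linarith
  have pow: "euler_step M ?d ^^ (n * m) = (euler_step M ?d ^^ m) ^^ n"
    by (simp add: funpow_mult mult.commute)
  have tn: "0 \<le> t / real n" using t by simp
  have "infnorm ((euler_step M (t / real n) ^^ n) f - ((euler_step M ?d ^^ m) ^^ n) f) \<le>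
      real n * ((t / real n * c)\<^sup>2 * infnorm f)"
  proof (rule telescoping)
    show "infnorm (euler_step M (t / real n) g - euler_step M (t / real n) h) \<le> infnorm (g - h)" for g h
      by (rule nonexp[OF tn n(2)])
  next
    fix j
    let ?g = "((euler_step M ?d ^^ m) ^^ j) f"
    have "infnorm (euler_step M (t / real n) ?g - (euler_step M ?d ^^ m) ?g) \<le> (t / real n * c)\<^sup>2 * infnorm ?g"
      using step_pow_first_order[OF d d', of m ?g] unfolding md by (simp add: infnorm_sub)
    also have "\<dots> \<le> (t / real n * c)\<^sup>2 * infnorm f"
      using infnorm_step_pow[OF d d', of "m * j" f] by (intro mult_left_mono) (auto simp: funpow_mult mult.commute)
    finally show "infnorm (euler_step M (t / real n) ?g - (euler_step M ?d ^^ m) ?g) \<le> (t / real n * c)\<^sup>2 * infnorm f" .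
  qed
  also have "\<dots> = (t * c)\<^sup>2 / real n * infnorm f"
    using n by (simp add: power2_eq_square field_simps)
  finally show ?thesis unfolding pow .
qed

lemma op_exp_tendsto:
  assumes t: "0 \<le> t"
  shows "(\<lambda>n. (euler_step M (t / real n) ^^ n) f) \<longlonglongrightarrow> op_exp M t f"
proof -
  define T where "T n f = (euler_step M (t / real n) ^^ n) f" for n f
  obtain n0 :: nat where n0: "t / d0 < real n0" using reals_Archimedean2 by blast
  then have n0_pos: "0 < n0" using t d0 by (cases n0) (auto simp: divide_less_0_iff not_less)
  have small: "t / real n \<le> d0" if "n0 \<le> n" for n
  proof -
    have "t / d0 \<le> real n" using n0 that by linarith
    then show ?thesis using d0 n0_pos that by (simp add: field_simps)
  qed
  define C where "C = (t * c)\<^sup>2"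
  \<comment> \<open>The schemes with \<open>n\<close> and with \<open>m\<close> steps are both
    compared with their common refinement into \<open>n * m\<close> steps.\<close>
  have cmp: "infnorm (T n f - T m f) \<le> C / real n * infnorm f + C / real m * infnorm f"
    if "n0 \<le> n" "n0 \<le> m" for n m f
  proof -
    have "infnorm (T n f - T (n * m) f) \<le> C / real n * infnorm f"
      unfolding T_def C_def using that n0_pos small t by (intro refinement) auto
    moreover have "infnorm (T m f - T (m * n) f) \<le> C / real m * infnorm f"
      unfolding T_def C_def using that n0_pos small t by (intro refinement) auto
    ultimately show ?thesis
      using infnorm_triangle[of "T n f - T (n * m) f" "T (n * m) f - T m f"]
      by (simp add: infnorm_sub mult.commute)
  qed
  have conv: "convergent (\<lambda>n. T n f)" for f
  proof -
    have "Cauchy (\<lambda>n. T n f)"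
    proof (rule metric_CauchyI)
      fix e :: real assume e: "0 < e"
      \<comment> \<open>The metric on vectors is Euclidean while all bounds are in the supremum
        norm, whence the square root of the dimension; the factor 2 stems from the two terms of
        \<open>cmp\<close>.\<close>
      define K where "K = sqrt (real CARD('x)) * (2 * C * infnorm f)"
      have lim: "(\<lambda>n. K / real n) \<longlonglongrightarrow> 0" by (rule lim_const_over_n)
      obtain N where N: "\<And>n. n \<ge> N \<Longrightarrow> \<bar>K / real n\<bar> < e"
        using LIMSEQ_D[OF lim e] by auto
      define N' where "N' = max N n0"
      show "\<exists>N. \<forall>m\<ge>N. \<forall>n\<ge>N. dist (T m f) (T n f) < e"
      proof (intro exI allI impI)
        fix m n assume mn: "N' \<le> m" "N' \<le> n"
        have "dist (T m f) (T n f) \<le> sqrt (real CARD('x)) * infnorm (T m f - T n f)"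
          using norm_le_infnorm[of "T m f - T n f"] by (simp add: dist_norm)
        also have "\<dots> \<le> sqrt (real CARD('x)) * (C / real m * infnorm f + C / real n * infnorm f)"
          using cmp[of m n f] mn by (intro mult_left_mono) (auto simp: N'_def)
        also have "\<dots> \<le> sqrt (real CARD('x)) * (C / real N' * infnorm f + C / real N' * infnorm f)"
          using mn n0_pos unfolding N'_def
          by (intro mult_left_mono add_mono mult_right_mono divide_left_mono) (auto simp: C_def infnorm_pos_le)
        also have "\<dots> = K / real N'" by (simp add: K_def algebra_simps add_divide_distrib)
        also have "\<dots> < e" using N[of N'] abs_ge_self[of "K / real N'"] by (simp add: N'_def del: abs_divide)
        finally show "dist (T m f) (T n f) < e" .
      qed
    qed
    then show ?thesis by (rule Cauchy_convergent)
  qed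
  define L where "L f = lim (\<lambda>n. T n f)" for f
  have L: "(\<lambda>n. T n f) \<longlonglongrightarrow> L f" for f
    using conv[of f] by (simp add: L_def convergent_LIMSEQ_iff)
  have "op_exp M t = L"
  proof (rule op_exp_eqI[where N = n0])
    show "nonneg_homogeneous L"
      unfolding nonneg_homogeneous_def
    proof (intro allI impI)
      fix a :: real and f :: "real ^ 'x" assume a: "0 \<le> a"
      have step: "euler_step M d (a *\<^sub>R f) = a *\<^sub>R euler_step M d f" for d f
        using hom a by (simp add: euler_step_def nonneg_homogeneous_def algebra_simps)
      have "(euler_step M d ^^ n) (a *\<^sub>R f) = a *\<^sub>R (euler_step M d ^^ n) f" for d n
        by (induction n) (auto simp: step)
      then have "T n (a *\<^sub>R f) = a *\<^sub>R T n f" for n by (simp add: T_def)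
      then have "(\<lambda>n. T n (a *\<^sub>R f)) \<longlonglongrightarrow> a *\<^sub>R L f"
        using L[of f] by (simp add: tendsto_scaleR)
      then show "L (a *\<^sub>R f) = a *\<^sub>R L f" using L LIMSEQ_unique by blast
    qed
    fix n and f :: "real ^ 'x" assume f: "infnorm f = 1" and n: "n0 \<le> n"
    \<comment> \<open>Letting \<open>m\<close> tend to infinity in \<open>cmp\<close> gives a rate
      that is uniform on the unit sphere, as convergence in \<open>opnorm\<close> requires.\<close>
    have "(\<lambda>m. infnorm (T n f - T m f)) \<longlonglongrightarrow> infnorm (T n f - L f)"
      by (intro tendsto_intros L)
    moreover have "(\<lambda>m. C / real n * infnorm f + C / real m * infnorm f) \<longlonglongrightarrow> C / real n * infnorm f + 0 * infnorm f"
      by (intro tendsto_intros lim_const_over_n)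
    moreover have "\<exists>N. \<forall>m\<ge>N. infnorm (T n f - T m f) \<le> C / real n * infnorm f + C / real m * infnorm f"
      using cmp[OF n] by blast
    ultimately have "infnorm (T n f - L f) \<le> C / real n * infnorm f + 0 * infnorm f"
      by (rule LIMSEQ_le)
    then show "infnorm ((euler_step M (t / real n) ^^ n) f - L f) \<le> C / real n"
      using f by (simp add: T_def)
  qed (rule lim_const_over_n)
  then show ?thesis using L[of f] by (simp add: T_def)
qed

end

section \<open>Rate matrices and the lower rate operator\<close>

lemma rate_matrix_bounded:
  fixes \<Q> :: "(real ^ 'x ^ 'x::finite) set"
  assumes "compact \<Q>"
  obtains b where "0 < b" "\<And>Q x y. Q \<in> \<Q> \<Longrightarrow> \<bar>Q $ x $ y\<bar> \<le> b"
proof -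
  obtain b where b: "0 < b" "\<And>Q. Q \<in> \<Q> \<Longrightarrow> norm Q \<le> b"
    using compact_imp_bounded[OF assms] bounded_pos by blast
  have "\<bar>Q $ x $ y\<bar> \<le> norm Q" for Q :: "real ^ 'x ^ 'x" and x y
    using component_le_norm_cart[of "Q $ x" y] Finite_Cartesian_Product.norm_nth_le[of Q x] by linarith
  then show ?thesis using b that by (meson order_trans)
qed

lemma mult_vec_nth: "((Q :: real ^ 'x ^ 'x::finite) *v f) $ x = (\<Sum>y\<in>UNIV. Q $ x $ y * f $ y)"
  by (simp add: matrix_vector_mult_def)

text \<open>With a zero on the diagonal the whole row is non-negative and still sums to zero, so it
  vanishes. An absorbing state therefore contributes nothing to \<open>Q *v f\<close>.\<close>

lemma rate_matrix_row_absorbing: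
  assumes Q: "rate_matrix Q" and "Q $ x $ x = 0"
  shows "Q $ x $ y = 0"
proof -
  have "0 \<le> Q $ x $ y" for y
    using assms unfolding rate_matrix_def by (cases "y = x") auto
  moreover have "(\<Sum>y\<in>UNIV. Q $ x $ y) = 0" using Q by (simp add: rate_matrix_def)
  ultimately show ?thesis using sum_nonneg_eq_0_iff[of UNIV "\<lambda>y. Q $ x $ y"] by simp
qed

text \<open>For small steps, \<open>I + d Q\<close> is a stochastic matrix.\<close>

lemma rate_matrix_step_le:
  fixes Q :: "real ^ 'x ^ 'x::finite"
  assumes Q: "rate_matrix Q" and b: "\<bar>Q $ x $ x\<bar> \<le> b" and d: "0 \<le> d" "d * b \<le> 1"
  shows "f $ x + d * (Q *v f) $ x \<le> g $ x + d * (Q *v g) $ x + infnorm (f - g)"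
proof -
  define v where "v = f - g"
  have v: "v $ y \<le> infnorm v" for y
    using component_le_infnorm_cart[of v y] by linarith
  have "(\<Sum>y\<in>UNIV - {x}. Q $ x $ y * v $ y) \<le> (\<Sum>y\<in>UNIV - {x}. Q $ x $ y * infnorm v)"
    using Q v by (intro sum_mono mult_left_mono) (auto simp: rate_matrix_def)
  also have "\<dots> = - Q $ x $ x * infnorm v"
  proof -
    have "(\<Sum>y\<in>UNIV. Q $ x $ y) = 0" using Q by (simp add: rate_matrix_def)
    then have "(\<Sum>y\<in>UNIV - {x}. Q $ x $ y) = - Q $ x $ x"
      by (subst (asm) sum.remove[of _ x]) auto
    then show ?thesis by (simp add: sum_distrib_right[symmetric])
  qed
  finally have 1: "(Q *v v) $ x \<le> Q $ x $ x * (v $ x - infnorm v)"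
    unfolding mult_vec_nth by (subst sum.remove[of _ x]) (auto simp: algebra_simps)
  have "v $ x + d * (Q *v v) $ x \<le> v $ x + d * (Q $ x $ x * (v $ x - infnorm v))"
    using 1 d by (intro add_left_mono mult_left_mono) auto
  also have "\<dots> = (1 + d * Q $ x $ x) * (v $ x - infnorm v) + infnorm v"
    by (simp add: algebra_simps)
  also have "\<dots> \<le> infnorm v"
  proof -
    have "d * - Q $ x $ x \<le> d * b" using b d by (intro mult_left_mono) auto
    then have "0 \<le> 1 + d * Q $ x $ x" using d by simp
    then have "(1 + d * Q $ x $ x) * (v $ x - infnorm v) \<le> 0"
      using v[of x] by (intro mult_nonneg_nonpos) auto
    then show ?thesis by simp
  qed
  finally show ?thesis
    unfolding v_def by (simp add: matrix_vector_mult_diff_distrib algebra_simps)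
qed

lemma bdd_below_rates:
  fixes \<Q> :: "(real ^ 'x ^ 'x::finite) set"
  assumes "compact \<Q>"
  shows "bdd_below ((\<lambda>Q. (Q *v f) $ x) ` \<Q>)"
proof -
  have "continuous_on \<Q> (\<lambda>Q. (Q *v f) $ x)"
    unfolding mult_vec_nth by (intro continuous_intros)
  then show ?thesis
    by (intro bounded_imp_bdd_below compact_imp_bounded compact_continuous_image assms)
qed

lemma lower_rate_le:
  assumes "compact \<Q>" "Q \<in> \<Q>"
  shows "lower_rate \<Q> f $ x \<le> (Q *v f) $ x"
  unfolding lower_rate_def using cINF_lower[OF bdd_below_rates[OF assms(1)] assms(2)] by simp

lemma lower_rate_greatest:
  assumes "\<Q> \<noteq> {}" "\<And>Q. Q \<in> \<Q> \<Longrightarrow> m \<le> (Q *v f) $ x"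
  shows "m \<le> lower_rate \<Q> f $ x"
  unfolding lower_rate_def using assms by (simp add: cINF_greatest)

text \<open>Through singletons, results on lower rate operators also cover a single matrix and its
  exponential.\<close>

lemma lower_rate_singleton: "lower_rate {Q} = (*v) Q"
  by (simp add: lower_rate_def fun_eq_iff vec_eq_iff)

text \<open>The estimate for a single matrix survives the infimum: on the left
  \<open>lower_rate\<close> lies below the value of every \<open>Q\<close>, so the bound holds for
  each \<open>Q\<close> on the right and hence for their infimum. Dividing by \<open>d\<close>
  brings it into the shape of \<open>lower_rate_greatest\<close>, which is why \<open>d = 0\<close>
  is split off.\<close>

lemma euler_step_lower_rate_le:
  fixes \<Q> :: "(real ^ 'x ^ 'x::finite) set"
  assumes "compact \<Q>" "\<Q> \<noteq> {}" "\<And>Q. Q \<in> \<Q> \<Longrightarrow> rate_matrix Q"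
    and b: "0 < b" "\<And>Q x y. Q \<in> \<Q> \<Longrightarrow> \<bar>Q $ x $ y\<bar> \<le> b" and d: "0 \<le> d" "d \<le> 1 / b"
  shows "euler_step (lower_rate \<Q>) d f $ x \<le> euler_step (lower_rate \<Q>) d g $ x + infnorm (f - g)"
proof (cases "d = 0")
  case True
  then show ?thesis using component_le_infnorm_cart[of "f - g" x] by (simp add: euler_step_def)
next
  case False
  then have d0: "0 < d" using d by simp
  have db: "d * b \<le> 1" using d b by (simp add: field_simps)
  have "(f $ x + d * lower_rate \<Q> f $ x - g $ x - infnorm (f - g)) / d \<le> lower_rate \<Q> g $ x"
  proof (rule lower_rate_greatest[OF assms(2)])
    fix Q assume Q: "Q \<in> \<Q>"
    have "d * lower_rate \<Q> f $ x \<le> d * (Q *v f) $ x"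
      using lower_rate_le[OF assms(1) Q] d by (intro mult_left_mono) auto
    then have "f $ x + d * lower_rate \<Q> f $ x \<le> g $ x + d * (Q *v g) $ x + infnorm (f - g)"
      using rate_matrix_step_le[OF assms(3)[OF Q] b(2)[OF Q] d(1) db, where x = x and f = f and g = g] by simp
    then show "(f $ x + d * lower_rate \<Q> f $ x - g $ x - infnorm (f - g)) / d \<le> (Q *v g) $ x"
      using d0 by (simp add: field_simps)
  qed
  then show ?thesis using d0 by (simp add: euler_step_def field_simps)
qed

text \<open>A row has \<open>CARD('x)\<close> entries of size at most \<open>b\<close>, which gives
  the Lipschitz constant. A step of at most \<open>1 / b\<close> keeps
  \<open>1 + d * Q $ x $ x\<close> non-negative, and this makes the step nonexpansive.\<close>

lemma euler_scheme_lower_rate: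
  fixes \<Q> :: "(real ^ 'x ^ 'x::finite) set"
  assumes "compact \<Q>" "\<Q> \<noteq> {}" "\<And>Q. Q \<in> \<Q> \<Longrightarrow> rate_matrix Q"
    and b: "0 < b" "\<And>Q x y. Q \<in> \<Q> \<Longrightarrow> \<bar>Q $ x $ y\<bar> \<le> b"
  shows "euler_scheme (lower_rate \<Q>) (real CARD('x) * b) (1 / b)"
proof
  have scale: "c * lower_rate \<Q> f $ x \<le> lower_rate \<Q> (c *\<^sub>R f) $ x" if "0 \<le> c" for c f x
  proof (rule lower_rate_greatest[OF assms(2)])
    fix Q assume "Q \<in> \<Q>"
    then show "c * lower_rate \<Q> f $ x \<le> (Q *v (c *\<^sub>R f)) $ x"
      using that lower_rate_le[OF assms(1)] by (simp add: matrix_vector_mult_scaleR mult_left_mono)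
  qed
  show "nonneg_homogeneous (lower_rate \<Q>)"
    unfolding nonneg_homogeneous_def
  proof (intro allI impI)
    fix c :: real and f :: "real ^ 'x" assume c: "0 \<le> c"
    show "lower_rate \<Q> (c *\<^sub>R f) = c *\<^sub>R lower_rate \<Q> f"
    proof (cases "c = 0")
      case True
      then show ?thesis using assms(2) by (simp add: lower_rate_def vec_eq_iff)
    next
      case False
      have "lower_rate \<Q> (c *\<^sub>R f) $ x \<le> c * lower_rate \<Q> f $ x" for x
        using scale[of "1 / c" "c *\<^sub>R f" x] c False by (simp add: field_simps)
      then show ?thesis using scale[OF c, of f] by (simp add: vec_eq_iff order.antisym)
    qed
  qed
next
  fix f g :: "real ^ 'x"
  have one: "lower_rate \<Q> f $ x - real CARD('x) * b * infnorm (f - g) \<le> lower_rate \<Q> g $ x" for f g x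
  proof (rule lower_rate_greatest[OF assms(2)])
    fix Q assume Q: "Q \<in> \<Q>"
    have "(Q *v (f - g)) $ x \<le> (\<Sum>y\<in>(UNIV :: 'x set). b * infnorm (f - g))"
      unfolding mult_vec_nth[of Q]
    proof (intro sum_mono)
      fix y
      have "Q $ x $ y * (f - g) $ y \<le> \<bar>Q $ x $ y\<bar> * \<bar>(f - g) $ y\<bar>" by (simp add: abs_mult[symmetric])
      also have "\<dots> \<le> b * infnorm (f - g)"
        using b Q component_le_infnorm_cart[of "f - g" y] by (intro mult_mono) auto
      finally show "Q $ x $ y * (f - g) $ y \<le> b * infnorm (f - g)" .
    qed
    then show "lower_rate \<Q> f $ x - real CARD('x) * b * infnorm (f - g) \<le> (Q *v g) $ x"
      using lower_rate_le[OF assms(1) Q, of f x] by (simp add: matrix_vector_mult_diff_distrib)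
  qed
  show "infnorm (lower_rate \<Q> f - lower_rate \<Q> g) \<le> real CARD('x) * b * infnorm (f - g)"
  proof (rule infnorm_le_cartI)
    show "\<bar>(lower_rate \<Q> f - lower_rate \<Q> g) $ x\<bar> \<le> real CARD('x) * b * infnorm (f - g)" for x
      using one[of f x g] one[of g x f] by (simp add: infnorm_sub abs_le_iff)
  qed
next
  show "0 < 1 / b" using b by simp
next
  fix d and f g :: "real ^ 'x" assume d: "0 \<le> d" "d \<le> 1 / b"
  show "infnorm (euler_step (lower_rate \<Q>) d f - euler_step (lower_rate \<Q>) d g) \<le> infnorm (f - g)"
  proof (rule infnorm_le_cartI)
    show "\<bar>(euler_step (lower_rate \<Q>) d f - euler_step (lower_rate \<Q>) d g) $ x\<bar> \<le> infnorm (f - g)" for x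
      using euler_step_lower_rate_le[OF assms d, of f x g] euler_step_lower_rate_le[OF assms d, of g x f]
      by (simp add: infnorm_sub abs_le_iff)
  qed
qed

lemma op_exp_lower_rate_tendsto:
  fixes \<Q> :: "(real ^ 'x ^ 'x::finite) set"
  assumes "compact \<Q>" "\<Q> \<noteq> {}" "\<And>Q. Q \<in> \<Q> \<Longrightarrow> rate_matrix Q" "0 \<le> t"
  shows "(\<lambda>n. (euler_step (lower_rate \<Q>) (t / real n) ^^ n) f) \<longlonglongrightarrow> op_exp (lower_rate \<Q>) t f"
proof -
  obtain b where "0 < b" "\<And>Q x y. Q \<in> \<Q> \<Longrightarrow> \<bar>Q $ x $ y\<bar> \<le> b"
    using rate_matrix_bounded[OF assms(1)] by metis
  then interpret euler_scheme "lower_rate \<Q>" "real CARD('x) * b" "1 / b"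
    by (intro euler_scheme_lower_rate assms)
  show ?thesis by (rule op_exp_tendsto) fact
qed

section \<open>Reachability and minimal hitting times\<close>

text \<open>Put negatively, no non-empty set of states outside \<open>A\<close> is closed under
  \<open>Q\<close>. For a rate matrix on a finite space this amounts to a path of positive rates
  from every state into \<open>A\<close>; the form chosen here can be applied directly to a set of
  minimisers.\<close>

definition reaches :: "'x set \<Rightarrow> real ^ 'x ^ 'x::finite \<Rightarrow> bool" where
  "reaches A Q \<longleftrightarrow> (\<forall>C. C \<noteq> {} \<longrightarrow> C \<subseteq> - A \<longrightarrow> (\<exists>z\<in>C. \<exists>y\<in>- C. Q $ z $ y \<noteq> 0))"

text \<open>If a set \<open>C\<close> outside \<open>A\<close> were closed under \<open>Q\<close>,
  the Euler iterates of \<open>indv A\<close> would stay non-positive on \<open>C\<close>: they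
  start at zero there, \<open>lower_rate\<close> lies below \<open>Q\<close>, and a row of
  \<open>Q\<close> in \<open>C\<close> sees only values on \<open>C\<close>. The limit at time 1
  then contradicts positivity.\<close>

lemma reaches_if_lower_reachable:
  fixes \<Q> :: "(real ^ 'x ^ 'x::finite) set"
  assumes "compact \<Q>" "\<Q> \<noteq> {}" and rate: "\<And>Q. Q \<in> \<Q> \<Longrightarrow> rate_matrix Q"
    and pos: "\<And>x. x \<in> - A \<Longrightarrow> op_exp (lower_rate \<Q>) 1 (indv A) $ x > 0" and Q: "Q \<in> \<Q>"
  shows "reaches A Q"
proof (rule ccontr)
  assume "\<not> reaches A Q"
  then obtain C where C: "C \<noteq> {}" "C \<subseteq> - A" and closed: "\<And>z y. z \<in> C \<Longrightarrow> y \<notin> C \<Longrightarrow> Q $ z $ y = 0"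
    unfolding reaches_def by auto
  then obtain x where x: "x \<in> C" by auto
  obtain b where b: "0 < b" "\<And>Q x y. Q \<in> \<Q> \<Longrightarrow> \<bar>Q $ x $ y\<bar> \<le> b"
    using rate_matrix_bounded[OF assms(1)] by metis
  have step: "euler_step (lower_rate \<Q>) d g $ z \<le> 0"
    if g: "\<And>z. z \<in> C \<Longrightarrow> g $ z \<le> 0" and d: "0 \<le> d" "d * b \<le> 1" and z: "z \<in> C" for d g z
  proof -
    have "euler_step (lower_rate \<Q>) d g $ z \<le> g $ z + d * (Q *v g) $ z"
      using lower_rate_le[OF assms(1) Q, of g z] d by (auto simp: euler_step_def intro!: mult_left_mono)
    also have "(Q *v g) $ z \<le> Q $ z $ z * g $ z"
    proof -
      have "(\<Sum>y\<in>UNIV - {z}. Q $ z $ y * g $ y) \<le> 0"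
      proof (rule sum_nonpos)
        fix y assume "y \<in> UNIV - {z}"
        then show "Q $ z $ y * g $ y \<le> 0"
          using g[of y] closed[OF z, of y] rate[OF Q]
          by (cases "y \<in> C") (auto simp: rate_matrix_def intro!: mult_nonneg_nonpos)
      qed
      then show ?thesis
        unfolding mult_vec_nth by (subst sum.remove[of _ z]) auto
    qed
    also have "g $ z + d * (Q $ z $ z * g $ z) = (1 + d * Q $ z $ z) * g $ z"
      by (simp add: algebra_simps)
    also have "\<dots> \<le> 0"
    proof (rule mult_nonneg_nonpos)
      have "d * - Q $ z $ z \<le> d * b" using b(2)[OF Q, of z z] d by (intro mult_left_mono) auto
      then show "0 \<le> 1 + d * Q $ z $ z" using d by simp
    qed (rule g[OF z])
    finally show ?thesis using d by (simp add: mult_left_mono)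
  qed
  obtain N :: nat where N: "b < real N" using reals_Archimedean2 by blast
  have "(euler_step (lower_rate \<Q>) (1 / real n) ^^ k) (indv A) $ z \<le> 0" if n: "N \<le> n" and z: "z \<in> C" for n k z
    using z
  proof (induction k arbitrary: z)
    case 0
    then show ?case using C by (auto simp: indv_def)
  next
    case (Suc k)
    have "b \<le> real n" using N n by linarith
    then have "1 / real n * b \<le> 1" using b by (simp add: field_simps)
    then show ?case using Suc by (simp add: step)
  qed
  then have "\<exists>N. \<forall>n\<ge>N. (euler_step (lower_rate \<Q>) (1 / real n) ^^ n) (indv A) $ x \<le> 0"
    using x by blast
  moreover have "(\<lambda>n. (euler_step (lower_rate \<Q>) (1 / real n) ^^ n) (indv A) $ x)
      \<longlonglongrightarrow> op_exp (lower_rate \<Q>) 1 (indv A) $ x"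
    by (intro tendsto_vec_nth op_exp_lower_rate_tendsto assms) auto
  ultimately have "op_exp (lower_rate \<Q>) 1 (indv A) $ x \<le> 0"
    by (intro LIMSEQ_le_const2)
  then show False using pos[of x] x C by auto
qed

text \<open>Where a negative minimum is attained, the condition on \<open>Q *v d\<close> makes a sum
  of non-negative terms non-positive, so every state with a positive rate from there is a minimiser
  too. The minimisers would form a closed set outside \<open>A\<close>.\<close>

lemma minimum_principle:
  fixes Q :: "real ^ 'x ^ 'x::finite"
  assumes Q: "rate_matrix Q" and reach: "reaches A Q"
    and dA: "\<And>x. x \<in> A \<Longrightarrow> 0 \<le> d $ x" and dQ: "\<And>x. x \<notin> A \<Longrightarrow> (Q *v d) $ x \<le> 0"
  shows "0 \<le> d $ x"
proof (rule ccontr)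
  assume "\<not> 0 \<le> d $ x"
  define m where "m = Min (range (\<lambda>x. d $ x))"
  have m: "m \<le> d $ y" for y unfolding m_def by simp
  with \<open>\<not> 0 \<le> d $ x\<close> have m0: "m < 0" by (meson not_le order_le_less_trans)
  define C where "C = {z. d $ z = m}"
  have "m \<in> range (\<lambda>x. d $ x)" unfolding m_def by (intro Min_in) auto
  then have "C \<noteq> {}" by (auto simp: C_def)
  moreover have CA: "C \<subseteq> - A" using dA m0 by (force simp: C_def)
  ultimately obtain z y where z: "z \<in> C" and y: "y \<notin> C" and zy: "Q $ z $ y \<noteq> 0"
    using reach unfolding reaches_def by blast
  have nn: "0 \<le> Q $ z $ w * (d $ w - m)" for w
  proof (cases "w = z")
    case True then show ?thesis using z by (simp add: C_def)
  next
    case False then show ?thesis using Q m[of w] by (auto simp: rate_matrix_def)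
  qed
  have "(\<Sum>w\<in>UNIV. Q $ z $ w * (d $ w - m)) = (Q *v d) $ z - (\<Sum>w\<in>UNIV. Q $ z $ w) * m"
    by (simp add: mult_vec_nth sum_distrib_right sum_subtractf right_diff_distrib)
  also have "\<dots> \<le> 0" using Q dQ[of z] z CA by (auto simp: rate_matrix_def)
  finally have "(\<Sum>w\<in>UNIV. Q $ z $ w * (d $ w - m)) = 0"
    using nn by (simp add: order.antisym sum_nonneg)
  then have "Q $ z $ y * (d $ y - m) = 0"
    using sum_nonneg_eq_0_iff[of UNIV "\<lambda>w. Q $ z $ w * (d $ w - m)"] nn by simp
  then show False using zy y by (simp add: C_def)
qed

text \<open>Identity rows on \<open>A\<close> encode the boundary condition \<open>h = 0\<close>, so
  that the hitting equations become a square system with right-hand side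
  \<open>- indv (- A)\<close>.\<close>

definition hitting_matrix :: "'x set \<Rightarrow> real ^ 'x ^ 'x::finite \<Rightarrow> real ^ 'x ^ 'x" where
  "hitting_matrix A Q = (\<chi> x y. if x \<in> A then (if x = y then 1 else 0) else Q $ x $ y)"

lemma hitting_matrix_mult:
  "(hitting_matrix A Q *v h) $ x = (if x \<in> A then h $ x else (Q *v h) $ x)"
proof (cases "x \<in> A")
  case True
  then have "(hitting_matrix A Q *v h) $ x = (\<Sum>y\<in>UNIV. if x = y then h $ y else 0)"
    unfolding mult_vec_nth by (intro sum.cong) (auto simp: hitting_matrix_def)
  then show ?thesis using True by simp
next
  case False
  then show ?thesis by (simp add: mult_vec_nth hitting_matrix_def)
qed

lemma hitting_solution_iff:
  "hitting_solution A Q h \<longleftrightarrow> (\<forall>x. 0 \<le> h $ x) \<and> hitting_matrix A Q *v h = - indv (- A)"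
proof -
  have "(indv A * h) $ x = (indv (- A) + indv (- A) * (Q *v h)) $ x \<longleftrightarrow>
      (hitting_matrix A Q *v h) $ x = (- indv (- A)) $ x" for x
  proof (cases "x \<in> A")
    case False
    then have "(hitting_matrix A Q *v h) $ x = (Q *v h) $ x" by (simp add: hitting_matrix_mult)
    with False show ?thesis by (simp add: indv_def) linarith
  qed (simp add: indv_def hitting_matrix_mult)
  then show ?thesis unfolding hitting_solution_def less_eq_vec_def vec_eq_iff by simp
qed

text \<open>A kernel element and its negative both satisfy the conditions of the minimum principle,
  with equality; hence the kernel is trivial.\<close>

lemma det_hitting_matrix:
  assumes "rate_matrix Q" "reaches A Q"
  shows "det (hitting_matrix A Q) \<noteq> 0"
proof -
  have "h = 0" if h: "hitting_matrix A Q *v h = 0" for h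
  proof -
    have "0 \<le> (s *\<^sub>R h) $ x" if "s = 1 \<or> s = - 1" for s :: real and x
    proof (rule minimum_principle[OF assms])
      have "hitting_matrix A Q *v (s *\<^sub>R h) = 0" using h by (simp add: matrix_vector_mult_scaleR)
      then have "(if x \<in> A then (s *\<^sub>R h) $ x else (Q *v (s *\<^sub>R h)) $ x) = 0" for x
        unfolding hitting_matrix_mult[symmetric] by simp
      then show "x \<in> A \<Longrightarrow> 0 \<le> (s *\<^sub>R h) $ x" "x \<notin> A \<Longrightarrow> (Q *v (s *\<^sub>R h)) $ x \<le> 0" for x
        by (metis order_refl, metis order_refl)
    qed
    from this[of 1] this[of "- 1"] show ?thesis by (simp add: vec_eq_iff order.antisym)
  qed
  then show ?thesis
    using invertible_left_inverse[of "hitting_matrix A Q"] matrix_left_invertible_ker[of "hitting_matrix A Q"]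
    by (simp add: invertible_det_nz)
qed

text \<open>Nonsingularity leaves a single solution, so it is the minimal non-negative one as soon
  as it is non-negative, which is the minimum principle again. Cramer's formula is recorded for the
  sake of continuity in \<open>Q\<close>.\<close>

lemma min_hitting_solution_unique:
  assumes Q: "rate_matrix Q" "reaches A Q"
  shows "hitting_matrix A Q *v g = - indv (- A) \<longleftrightarrow> g = min_hitting_solution A Q"
    and "0 \<le> min_hitting_solution A Q $ x"
    and "min_hitting_solution A Q $ k =
      det (\<chi> i j. if j = k then (- indv (- A)) $ i else hitting_matrix A Q $ i $ j) / det (hitting_matrix A Q)"
proof -
  define h where "h = (\<chi> k. det (\<chi> i j. if j = k then (- indv (- A)) $ i else hitting_matrix A Q $ i $ j) / det (hitting_matrix A Q))"
  have uniq: "hitting_matrix A Q *v g = - indv (- A) \<longleftrightarrow> g = h" for g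
    unfolding h_def by (rule cramer[OF det_hitting_matrix[OF assms]])
  then have h: "hitting_matrix A Q *v h = - indv (- A)" by simp
  then have hx: "(if x \<in> A then h $ x else (Q *v h) $ x) = - indicator (- A) x" for x
    unfolding hitting_matrix_mult[symmetric] by (simp add: indv_def)
  have "0 \<le> h $ x" for x
  proof (rule minimum_principle[OF Q])
    show "x \<in> A \<Longrightarrow> 0 \<le> h $ x" "x \<notin> A \<Longrightarrow> (Q *v h) $ x \<le> 0" for x
      using hx[of x] by (auto split: if_splits)
  qed
  then have sol: "hitting_solution A Q h" using h by (simp add: hitting_solution_iff)
  have eq: "min_hitting_solution A Q = h"
    unfolding min_hitting_solution_def
  proof (intro the_equality conjI allI impI)
    show "h \<le> g" if "hitting_solution A Q g" for g
      using uniq[of g] that by (simp add: hitting_solution_iff)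
    show "g = h" if "hitting_solution A Q g \<and> (\<forall>k. hitting_solution A Q k \<longrightarrow> g \<le> k)" for g
      using uniq[of g] that by (simp add: hitting_solution_iff)
  qed (rule sol)
  show "hitting_matrix A Q *v g = - indv (- A) \<longleftrightarrow> g = min_hitting_solution A Q"
    and "0 \<le> min_hitting_solution A Q $ x"
    and "min_hitting_solution A Q $ k =
      det (\<chi> i j. if j = k then (- indv (- A)) $ i else hitting_matrix A Q $ i $ j) / det (hitting_matrix A Q)"
    unfolding eq using sol uniq[of g] by (auto simp: hitting_solution_iff h_def)
qed

lemma min_hitting_solution_eqs:
  assumes Q: "rate_matrix Q" "reaches A Q"
  shows "x \<in> A \<Longrightarrow> min_hitting_solution A Q $ x = 0"
    and "x \<notin> A \<Longrightarrow> (Q *v min_hitting_solution A Q) $ x = - 1"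
proof -
  have "hitting_matrix A Q *v min_hitting_solution A Q = - indv (- A)"
    using min_hitting_solution_unique(1)[OF assms] by simp
  then have "(if x \<in> A then min_hitting_solution A Q $ x else (Q *v min_hitting_solution A Q) $ x) = - indicator (- A) x" for x
    unfolding hitting_matrix_mult[symmetric] by (simp add: indv_def)
  from this[of x] show "x \<in> A \<Longrightarrow> min_hitting_solution A Q $ x = 0"
    and "x \<notin> A \<Longrightarrow> (Q *v min_hitting_solution A Q) $ x = - 1" by simp_all
qed

lemma continuous_on_det:
  fixes M :: "'a::topological_space \<Rightarrow> real ^ 'n ^ 'n::finite"
  assumes "\<And>i j. continuous_on S (\<lambda>x. M x $ i $ j)"
  shows "continuous_on S (\<lambda>x. det (M x))"
  unfolding det_def by (intro continuous_intros assms)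

text \<open>Numerator and denominator in Cramer's rule are polynomials in the entries of
  \<open>Q\<close>, and the denominator does not vanish on \<open>\<Q>\<close>.\<close>

lemma continuous_on_min_hitting_solution:
  assumes Q: "\<And>Q. Q \<in> \<Q> \<Longrightarrow> rate_matrix Q" "\<And>Q. Q \<in> \<Q> \<Longrightarrow> reaches A Q"
  shows "continuous_on \<Q> (\<lambda>Q. min_hitting_solution A Q $ k)"
proof -
  have entry: "continuous_on \<Q> (\<lambda>Q. hitting_matrix A Q $ i $ j)" for i j
    by (cases "i \<in> A") (auto simp: hitting_matrix_def intro!: continuous_intros)
  have "continuous_on \<Q> (\<lambda>Q. det (\<chi> i j. if j = k then (- indv (- A)) $ i else hitting_matrix A Q $ i $ j)
      / det (hitting_matrix A Q))"
  proof (intro continuous_on_divide continuous_on_det ballI)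
    show "continuous_on \<Q> (\<lambda>Q. (\<chi> i j. if j = k then (- indv (- A)) $ i else hitting_matrix A Q $ i $ j) $ i $ j)" for i j
      by (cases "j = k") (auto intro!: entry continuous_intros)
  qed (use det_hitting_matrix Q entry in auto)
  then show ?thesis
    by (rule continuous_on_eq) (simp add: min_hitting_solution_unique(3) Q)
qed

text \<open>\<open>P\<close> optimises the sum over all states of the hitting times: if one of its rows could be
  improved, replacing that row would improve the sum. The sign \<open>s\<close> treats the supremum and the
  infimum at once.\<close>

lemma optimal_rate_matrix:
  fixes \<Q> :: "(real ^ 'x ^ 'x::finite) set" and s :: real
  assumes cpt: "compact \<Q>" and ne: "\<Q> \<noteq> {}" and sep: "separately_specified_rows \<Q>"
    and Q: "\<And>Q. Q \<in> \<Q> \<Longrightarrow> rate_matrix Q" "\<And>Q. Q \<in> \<Q> \<Longrightarrow> reaches A Q"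
    and s: "s = 1 \<or> s = - 1"
  obtains P where "P \<in> \<Q>"
    and "\<forall>Q\<in>\<Q>. \<forall>x. x \<notin> A \<longrightarrow> s * (Q *v min_hitting_solution A P) $ x \<le> - s"
proof -
  let ?h = "min_hitting_solution A"
  have "continuous_on \<Q> (\<lambda>Q. \<Sum>x\<in>UNIV. s * ?h Q $ x)"
    by (intro continuous_intros continuous_on_min_hitting_solution Q)
  then obtain P where P: "P \<in> \<Q>" and max: "\<And>Q. Q \<in> \<Q> \<Longrightarrow> (\<Sum>x\<in>UNIV. s * ?h Q $ x) \<le> (\<Sum>x\<in>UNIV. s * ?h P $ x)"
    using continuous_attains_sup[OF cpt ne] by blast
  have opt: "s * (R *v ?h P) $ x \<le> - s" if R: "R \<in> \<Q>" and x: "x \<notin> A" for R x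
  proof (rule ccontr)
    assume neg: "\<not> s * (R *v ?h P) $ x \<le> - s"
    define R' where "R' = (\<chi> z. (if z = x then R else P) $ z)"
    have R': "R' \<in> \<Q>"
      using sep[unfolded separately_specified_rows_def, rule_format, of "\<lambda>z. if z = x then R else P"] R P
      by (simp add: R'_def)
    have row: "(R' *v v) $ z = ((if z = x then R else P) *v v) $ z" for v z
      by (simp add: mult_vec_nth R'_def)
    define d where "d = s *\<^sub>R (?h R' - ?h P)"
    have Rd: "(R' *v d) $ z = s * (R' *v ?h R') $ z - s * (R' *v ?h P) $ z" for z
      by (simp add: d_def matrix_vector_mult_diff_distrib matrix_vector_mult_scaleR algebra_simps)
    \<comment> \<open>Away from \<open>x\<close> the matrices \<open>R'\<close> and \<open>P\<close>
      share their rows, so the two hitting equations cancel. At \<open>x\<close> the assumed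
      violation remains, with the sign that the minimum principle asks for.\<close>
    have dz: "(R' *v d) $ z = (if z = x then - s - s * (R *v ?h P) $ x else 0)" if "z \<notin> A" for z
      using that x Q R' P by (simp add: Rd min_hitting_solution_eqs(2) row[of "?h P"])
    have nn: "0 \<le> d $ z" for z
    proof (rule minimum_principle[OF Q[OF R']])
      show "z \<in> A \<Longrightarrow> 0 \<le> d $ z" for z
        using Q R' P by (simp add: d_def min_hitting_solution_eqs(1))
      show "z \<notin> A \<Longrightarrow> (R' *v d) $ z \<le> 0" for z
        using dz[of z] neg by auto
    qed
    \<comment> \<open>Maximality of \<open>P\<close> bounds the sum of the non-negative entries of
      \<open>d\<close>, so \<open>d\<close> vanishes, which the strict inequality at
      \<open>x\<close> forbids.\<close>
    have "(\<Sum>z\<in>UNIV. d $ z) \<le> 0"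
      using max[OF R'] by (simp add: d_def right_diff_distrib sum_subtractf)
    then have "(\<Sum>z\<in>UNIV. d $ z) = 0" using nn by (simp add: order.antisym sum_nonneg)
    then have "d = 0" using nn sum_nonneg_eq_0_iff[of UNIV "\<lambda>z. d $ z"] by (simp add: vec_eq_iff)
    then show False using dz[OF x] neg by simp
  qed
  then have "\<forall>R\<in>\<Q>. \<forall>x. x \<notin> A \<longrightarrow> s * (R *v ?h P) $ x \<le> - s" by blast
  with P show ?thesis by (rule that)
qed

section \<open>Coordinate algebras, outer derivatives and Dini estimates\<close>

lemma at_state_subset: "at_state t x \<subseteq> paths"
  by (auto simp: at_state_def)

lemma space_coord_algebra [simp]: "space (coord_algebra T) = paths"
  unfolding coord_algebra_def by (rule space_measure_of) (use at_state_subset in blast)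

lemma sets_coord_algebra: "sets (coord_algebra T) = sigma_sets paths {at_state t x | t x. t \<in> T}"
  unfolding coord_algebra_def by (rule sets_measure_of) (use at_state_subset in blast)

lemma at_state_in_coord_algebra: "t \<in> T \<Longrightarrow> at_state t x \<in> sets (coord_algebra T)"
  unfolding sets_coord_algebra by (rule sigma_sets.Basic) auto

lemma infnorm_indv: "infnorm (indv {y :: 'x::finite}) = 1"
proof (rule order.antisym)
  show "infnorm (indv {y}) \<le> 1" by (rule infnorm_le_cartI) (simp add: indv_def indicator_def)
  show "1 \<le> infnorm (indv {y})"
    using component_le_infnorm_cart[of "indv {y}" y] by (simp add: indv_def)
qed

lemma entry_le_opnorm:
  fixes M :: "real ^ 'x ^ 'x::finite"
  shows "ennreal \<bar>M $ x $ y\<bar> \<le> opnorm ((*v) M)"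
proof -
  have "(M *v indv {y}) $ x = (\<Sum>z\<in>UNIV. if z = y then M $ x $ z else 0)"
    unfolding mult_vec_nth by (intro sum.cong) (auto simp: indv_def indicator_def)
  then have "M $ x $ y = (M *v indv {y}) $ x" by simp
  then have "ennreal \<bar>M $ x $ y\<bar> \<le> ennreal (infnorm (M *v indv {y}))"
    using component_le_infnorm_cart[of "M *v indv {y}" x] by (simp add: ennreal_leI)
  also have "\<dots> \<le> opnorm ((*v) M)"
    unfolding opnorm_def by (rule SUP_upper) (simp add: infnorm_indv)
  finally show ?thesis .
qed

lemma outer_derivatives_bounded:
  assumes "outer_derivatives_in D \<Q>"
  obtains C where "0 \<le> C" "\<forall>\<^sub>F \<Delta> in at_right 0. \<forall>x y. \<bar>D \<Delta> $ x $ y\<bar> \<le> C"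
proof -
  have "Limsup (at_right 0) (\<lambda>\<Delta>. opnorm ((*v) (D \<Delta>))) < \<infinity>"
    using assms by (simp add: outer_derivatives_in_def)
  then obtain c where c: "Limsup (at_right 0) (\<lambda>\<Delta>. opnorm ((*v) (D \<Delta>))) < c" "c < \<infinity>"
    using dense by blast
  then obtain C where C: "c = ennreal C" "0 \<le> C" by (cases c) auto
  have "\<forall>\<^sub>F \<Delta> in at_right 0. \<forall>x y. \<bar>D \<Delta> $ x $ y\<bar> \<le> C"
    using Limsup_lessD[OF c(1)]
  proof eventually_elim
    case (elim \<Delta>)
    have "ennreal \<bar>D \<Delta> $ x $ y\<bar> \<le> ennreal C" for x y
      using entry_le_opnorm[of "D \<Delta>" x y] elim C by (meson less_imp_le order_trans)
    then show ?case using C by (simp add: ennreal_le_iff)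
  qed
  then show ?thesis using that C by blast
qed

text \<open>Compactness turns the condition on limit points into an inequality for all small
  increments: offending increments tending to zero would have bounded quotients, hence a convergent
  subsequence, whose limit lies in \<open>\<Q>\<close> and violates the bound by
  \<open>e\<close>.\<close>

lemma outer_derivatives_le:
  fixes f :: "real ^ 'x::finite"
  assumes D: "outer_derivatives_in D \<Q>" and Q: "\<And>Q. Q \<in> \<Q> \<Longrightarrow> (Q *v f) $ w \<le> c" and e: "0 < e"
  shows "\<forall>\<^sub>F \<Delta> in at_right 0. (D \<Delta> *v f) $ w \<le> c + e"
proof (rule ccontr)
  assume bad: "\<not> (\<forall>\<^sub>F \<Delta> in at_right 0. (D \<Delta> *v f) $ w \<le> c + e)"
  obtain C where "0 \<le> C" and C: "\<forall>\<^sub>F \<Delta> in at_right 0. \<forall>x y. \<bar>D \<Delta> $ x $ y\<bar> \<le> C"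
    using outer_derivatives_bounded[OF D] .
  have "\<exists>d>0. d < 1 / real (Suc n) \<and> (\<forall>x y. \<bar>D d $ x $ y\<bar> \<le> C) \<and> c + e < (D d *v f) $ w" for n
  proof (rule ccontr)
    assume none: "\<not> ?thesis"
    have "\<forall>\<^sub>F d in at_right (0::real). 0 < d \<and> d < 1 / real (Suc n)"
      unfolding eventually_at_right_field by (intro exI[of _ "1 / real (Suc n)"]) auto
    with C have "\<forall>\<^sub>F d in at_right 0. (D d *v f) $ w \<le> c + e"
      by eventually_elim (use none in \<open>metis not_less\<close>)
    with bad show False ..
  qed
  then obtain d where d: "\<And>n. 0 < d n" "\<And>n. d n < 1 / real (Suc n)"
    and dC: "\<And>n x y. \<bar>D (d n) $ x $ y\<bar> \<le> C" and dbad: "\<And>n. c + e < (D (d n) *v f) $ w"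
    by metis
  have "norm (D (d n)) \<le> real CARD('x) * (real CARD('x) * C)" for n
  proof -
    have "norm (D (d n)) \<le> (\<Sum>x\<in>UNIV. norm (D (d n) $ x))"
      unfolding norm_vec_def by (rule L2_set_le_sum) auto
    also have "\<dots> \<le> (\<Sum>x\<in>(UNIV :: 'x set). real CARD('x) * C)"
    proof (rule sum_mono)
      fix x
      have "norm (D (d n) $ x) \<le> (\<Sum>y\<in>UNIV. \<bar>D (d n) $ x $ y\<bar>)" by (rule norm_le_l1_cart)
      also have "\<dots> \<le> (\<Sum>y\<in>(UNIV :: 'x set). C)" by (intro sum_mono dC)
      finally show "norm (D (d n) $ x) \<le> real CARD('x) * C" by simp
    qed
    finally show ?thesis by simp
  qed
  then have "bounded (range (\<lambda>n. D (d n)))" unfolding bounded_iff by blast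
  then obtain L r where r: "strict_mono (r :: nat \<Rightarrow> nat)" and L: "((\<lambda>n. D (d n)) \<circ> r) \<longlonglongrightarrow> L"
    using bounded_imp_convergent_subsequence by blast
  have "(\<lambda>n. 1 / real (Suc n)) \<longlonglongrightarrow> 0" using LIMSEQ_inverse_real_of_nat by (simp add: inverse_eq_divide)
  then have "d \<longlonglongrightarrow> 0"
    by (rule tendsto_sandwich[rotated 3]) (auto intro!: always_eventually less_imp_le d simp del: of_nat_Suc)
  then have d0: "filterlim d (at_right 0) sequentially"
    using d(1) by (simp add: filterlim_at less_imp_neq[symmetric])
  then have "filterlim (\<lambda>n. d (r n)) (at_right 0) sequentially"
    using filterlim_compose filterlim_subseq[OF r] by blast
  then have "L \<in> \<Q>"
    using D L unfolding outer_derivatives_in_def o_def by blast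
  then have "(L *v f) $ w \<le> c" by (rule Q)
  moreover have "(\<lambda>n. (D (d (r n)) *v f) $ w) \<longlonglongrightarrow> (L *v f) $ w"
    using L unfolding mult_vec_nth o_def by (intro tendsto_intros)
  then have "c + e \<le> (L *v f) $ w"
    by (rule LIMSEQ_le_const) (use dbad in \<open>auto intro: less_imp_le\<close>)
  ultimately show False using e by simp
qed

text \<open>The hypothesis says that the upper right Dini derivative of \<open>F\<close> is
  non-positive. The last point satisfying \<open>F t - e * (t - a) \<le> F a\<close> exists by
  continuity and cannot lie before \<open>b\<close>, because the Dini estimate with tolerance
  \<open>e\<close> would provide a later one.\<close>

lemma nonincreasing_if_dini_le:
  fixes F :: "real \<Rightarrow> real"
  assumes ab: "a \<le> b" and cont: "continuous_on {a..b} F"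
    and dini: "\<And>t e. a \<le> t \<Longrightarrow> t < b \<Longrightarrow> 0 < e \<Longrightarrow> \<forall>\<^sub>F \<Delta> in at_right 0. F (t + \<Delta>) \<le> F t + e * \<Delta>"
  shows "F b \<le> F a"
proof -
  have "F b - e * (b - a) \<le> F a" if e: "0 < e" for e
  proof -
    define S where "S = {t\<in>{a..b}. F t - e * (t - a) \<le> F a}"
    define m where "m = Sup S"
    have "closed S"
      unfolding S_def by (intro continuous_on_closed_Collect_le continuous_intros cont)
    moreover have "a \<in> S" using ab by (simp add: S_def)
    moreover have bdd: "bdd_above S" by (rule bdd_aboveI[of _ b]) (simp add: S_def)
    ultimately have m: "m \<in> S" unfolding m_def by (intro closed_contains_Sup) auto
    have "m = b"
    proof (rule ccontr)
      assume "m \<noteq> b"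
      with m have mb: "a \<le> m" "m < b" by (auto simp: S_def)
      have "\<forall>\<^sub>F \<Delta> in at_right 0. 0 < \<Delta> \<and> \<Delta> < b - m"
        using eventually_at_right_real[of 0 "b - m"] mb by simp
      with dini[OF mb e] have "\<forall>\<^sub>F \<Delta> in at_right 0. 0 < \<Delta> \<and> m + \<Delta> \<in> S"
        by eventually_elim (use m in \<open>auto simp: S_def algebra_simps\<close>)
      then obtain \<Delta> where "0 < \<Delta>" "m + \<Delta> \<in> S"
        using eventually_happens'[OF trivial_limit_at_right_real] by blast
      then show False using cSup_upper[OF _ bdd, of "m + \<Delta>"] by (simp add: m_def)
    qed
    then show ?thesis using m by (simp add: S_def)
  qed
  note * = this
  show ?thesis
  proof (rule field_le_epsilon)
    fix e :: real assume e: "0 < e"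
    \<comment> \<open>The summand 1 keeps the denominator positive when
      \<open>a = b\<close>.\<close>
    have "F b - e / (b - a + 1) * (b - a) \<le> F a" using *[of "e / (b - a + 1)"] ab e by simp
    moreover have "e / (b - a + 1) * (b - a) \<le> e"
      using ab e by (simp add: field_simps)
    ultimately show "F b \<le> F a + e" by linarith
  qed
qed

text \<open>Just after \<open>t\<close> the integrand stays above \<open>g t - e\<close>. This
  first-order estimate allows an integral to be subtracted inside a Dini argument.\<close>

lemma integral_right_increment_ge:
  fixes g :: "real \<Rightarrow> real"
  assumes g: "continuous_on {a..b} g" and t: "a \<le> t" "t < b" and e: "0 < e"
  shows "\<forall>\<^sub>F \<Delta> in at_right 0. integral {a..t} g + (g t - e) * \<Delta> \<le> integral {a..t + \<Delta>} g"
proof -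
  obtain d where d: "0 < d" "\<And>r. r \<in> {a..b} \<Longrightarrow> dist r t < d \<Longrightarrow> dist (g r) (g t) < e"
    using g t e unfolding continuous_on_iff by (metis atLeastAtMost_iff less_imp_le)
  have "\<forall>\<^sub>F \<Delta> in at_right 0. 0 < \<Delta> \<and> \<Delta> < min d (b - t)"
    using eventually_at_right_real[of 0 "min d (b - t)"] d t by simp
  then show ?thesis
  proof eventually_elim
    case (elim \<Delta>)
    have int: "g integrable_on {a..t + \<Delta>}" "g integrable_on {t..t + \<Delta>}"
      using elim t by (auto intro!: integrable_continuous_interval continuous_on_subset[OF g])
    have "(g t - e) * \<Delta> = integral {t..t + \<Delta>} (\<lambda>_. g t - e)"
      using elim by simp
    also have "\<dots> \<le> integral {t..t + \<Delta>} g"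
    proof (rule integral_le)
      fix r assume "r \<in> {t..t + \<Delta>}"
      then have "dist (g r) (g t) < e" using elim t by (intro d(2)) (auto simp: dist_real_def)
      then show "g t - e \<le> g r" by (simp add: dist_real_def abs_less_iff)
    qed (use int in auto)
    also have "integral {a..t} g + integral {t..t + \<Delta>} g = integral {a..t + \<Delta>} g"
      using elim t int by (intro Henstock_Kurzweil_Integration.integral_combine) auto
    finally show ?case by simp
  qed
qed

section \<open>Processes consistent with a set of rate matrices\<close>

locale process =
  fixes P :: "'x::finite process"
  assumes process: "stochastic_process P"
begin

lemma prob_space_history: "history h \<Longrightarrow> prob_space (P h)"
  and sets_history: "history h \<Longrightarrow> sets (P h) = sets (coord_algebra {0..})"
  and measure_history_event: "history h \<Longrightarrow> measure (P h) (history_event h) = 1"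
  using process by (auto simp: stochastic_process_def)

lemma chain_rule:
  assumes "history h" "0 \<le> s" "\<And>t. t \<in> dom h \<Longrightarrow> t < s" "B \<in> sets (coord_algebra {s..})"
  shows "measure (P h) (B \<inter> at_state s y) = measure (P (h(s \<mapsto> y))) B * measure (P h) (at_state s y)"
  using process assms by (auto simp: stochastic_process_def)

lemma space_history: "history h \<Longrightarrow> space (P h) = paths"
  using sets_eq_imp_space_eq[OF sets_history] by simp

lemma at_state_sets: "history h \<Longrightarrow> 0 \<le> t \<Longrightarrow> at_state t y \<in> sets (P h)"
  by (simp add: sets_history at_state_in_coord_algebra)

lemma history_update: "history h \<Longrightarrow> 0 \<le> t \<Longrightarrow> history (h(t \<mapsto> x))"
  by (auto simp: history_def)

lemma total_probability:
  assumes h: "history h" and t: "0 \<le> t" and B: "B \<in> sets (P h)"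
  shows "measure (P h) B = (\<Sum>y\<in>UNIV. measure (P h) (B \<inter> at_state t y))"
proof -
  interpret prob_space "P h" by (rule prob_space_history[OF h])
  have "B \<subseteq> paths" using sets.sets_into_space[OF B] by (simp add: space_history[OF h])
  then have "B = (\<Union>y\<in>UNIV. B \<inter> at_state t y)" by (auto simp: at_state_def)
  then have "measure (P h) B = measure (P h) (\<Union>y\<in>UNIV. B \<inter> at_state t y)" by simp
  also have "\<dots> = (\<Sum>y\<in>UNIV. measure (P h) (B \<inter> at_state t y))"
    using B at_state_sets[OF h t]
    by (intro finite_measure_finite_Union) (auto simp: disjoint_family_on_def at_state_def)
  finally show ?thesis .
qed

lemma sum_at_state:
  assumes h: "history h" and t: "0 \<le> t"
  shows "(\<Sum>y\<in>UNIV. measure (P h) (at_state t y)) = 1"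
proof -
  interpret prob_space "P h" by (rule prob_space_history[OF h])
  have "(\<Sum>y\<in>UNIV. measure (P h) (at_state t y)) = (\<Sum>y\<in>UNIV. measure (P h) (space (P h) \<inter> at_state t y))"
    using at_state_subset by (intro sum.cong refl arg_cong[where f = "measure (P h)"]) (auto simp: space_history[OF h])
  also have "\<dots> = 1" using total_probability[OF h t, of "space (P h)"] prob_space by simp
  finally show ?thesis .
qed

text \<open>The history event of \<open>h(t \<mapsto> x)\<close> lies inside
  \<open>at_state t x\<close> and has probability one, which leaves no mass for the other
  states.\<close>

lemma measure_at_state_update:
  assumes h: "history h" and t: "0 \<le> t"
  shows "measure (P (h(t \<mapsto> x))) (at_state t y) = (if y = x then 1 else 0)"
proof -
  let ?h = "h(t \<mapsto> x)"
  have h': "history ?h" by (rule history_update[OF h t])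
  interpret prob_space "P ?h" by (rule prob_space_history[OF h'])
  have "measure (P ?h) (history_event ?h) \<le> measure (P ?h) (at_state t x)"
    by (rule finite_measure_mono) (auto simp: history_event_def at_state_def at_state_sets[OF h' t, unfolded at_state_def])
  then have x: "measure (P ?h) (at_state t x) = 1"
    using prob_le_1[of "at_state t x"] measure_history_event[OF h'] by simp
  show ?thesis
  proof (cases "y = x")
    case False
    have "1 + measure (P ?h) (at_state t y) = (\<Sum>z\<in>{x, y}. measure (P ?h) (at_state t z))"
      using False x by simp
    also have "\<dots> \<le> (\<Sum>z\<in>UNIV. measure (P ?h) (at_state t z))" by (rule sum_mono2) auto
    finally have "measure (P ?h) (at_state t y) \<le> 0" using sum_at_state[OF h' t] by simp
    then show ?thesis using False by (simp add: measure_le_0_iff)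
  qed (simp add: x)
qed

text \<open>A Chapman-Kolmogorov equation without the Markov property: the intermediate state is
  appended to the history and does not replace it.\<close>

lemma measure_at_state_chain:
  assumes h: "history h" and s: "0 \<le> s" "\<And>t. t \<in> dom h \<Longrightarrow> t < s" and r: "s \<le> r"
  shows "measure (P h) (at_state r y) =
    (\<Sum>z\<in>UNIV. measure (P h) (at_state s z) * measure (P (h(s \<mapsto> z))) (at_state r y))"
proof -
  have "measure (P h) (at_state r y) = (\<Sum>z\<in>UNIV. measure (P h) (at_state r y \<inter> at_state s z))"
    using s r by (intro total_probability h at_state_sets) auto
  also have "\<dots> = (\<Sum>z\<in>UNIV. measure (P h) (at_state s z) * measure (P (h(s \<mapsto> z))) (at_state r y))"
    using r by (intro sum.cong refl) (simp add: chain_rule[OF h s] at_state_in_coord_algebra)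
  finally show ?thesis .
qed

text \<open>The history to condition on in order to describe the evolution of the process given
  \<open>h(t0 \<mapsto> x)\<close> after time \<open>t\<close>.\<close>

definition before :: "(real \<rightharpoonup> 'x) \<Rightarrow> real \<Rightarrow> 'x \<Rightarrow> real \<Rightarrow> real \<rightharpoonup> 'x" where
  "before h t0 x t = (if t = t0 then h else h(t0 \<mapsto> x))"

definition state_prob :: "(real \<rightharpoonup> 'x) \<Rightarrow> real \<Rightarrow> 'x \<Rightarrow> real \<Rightarrow> 'x \<Rightarrow> real" where
  "state_prob h t0 x t y = measure (P (h(t0 \<mapsto> x))) (at_state t y)"

definition state_mean :: "(real \<rightharpoonup> 'x) \<Rightarrow> real \<Rightarrow> 'x \<Rightarrow> real \<Rightarrow> real ^ 'x \<Rightarrow> real" where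
  "state_mean h t0 x t f = (\<Sum>y\<in>UNIV. state_prob h t0 x t y * f $ y)"

end

locale started_process = process P for P :: "'x::finite process" +
  fixes h :: "real \<rightharpoonup> 'x" and t0 :: real and x :: 'x
  assumes h: "history h" and t0: "0 \<le> t0" and h_before: "\<And>t. t \<in> dom h \<Longrightarrow> t < t0"
begin

abbreviation "prb \<equiv> state_prob h t0 x"
abbreviation "mean \<equiv> state_mean h t0 x"
abbreviation "past \<equiv> before h t0 x"

lemma past:
  assumes "t0 \<le> t"
  shows "history (past t)" and "\<And>r. r \<in> dom (past t) \<Longrightarrow> r < t"
proof -
  show "history (past t)" using h history_update[OF h t0] by (simp add: before_def)
  show "r < t" if "r \<in> dom (past t)" for r
    using that assms h_before[of r] by (cases "r = t0") (auto simp: before_def split: if_splits)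
qed

lemma prb_nonneg [simp]: "0 \<le> prb t y"
  by (simp add: state_prob_def)

lemma sum_prb: "t0 \<le> t \<Longrightarrow> (\<Sum>y\<in>UNIV. prb t y) = 1"
  using sum_at_state[OF history_update[OF h t0], of t] t0 by (simp add: state_prob_def)

lemma prb_start: "prb t0 y = (if y = x then 1 else 0)"
  unfolding state_prob_def by (rule measure_at_state_update[OF h t0])

text \<open>At \<open>t = t0\<close> the matrix conditions on \<open>h\<close> extended by each
  possible state at \<open>t0\<close>, and the weights \<open>prb t0\<close> single out row
  \<open>x\<close>. Later, \<open>h(t0 \<mapsto> x)\<close> itself is the history to be extended,
  and the chain rule applies because \<open>t0 < t\<close>.\<close>

lemma prb_step:
  assumes t: "t0 \<le> t" and s: "t \<le> s"
  shows "prb s y = (\<Sum>z\<in>UNIV. prb t z * transition P (past t) t s $ z $ y)"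
proof (cases "t = t0")
  case True
  then have "(\<Sum>z\<in>UNIV. prb t z * transition P (past t) t s $ z $ y) =
      (\<Sum>z\<in>UNIV. if z = x then prb s y else 0)"
    by (intro sum.cong) (simp_all add: prb_start before_def transition_def, simp add: state_prob_def)
  then show ?thesis by simp
next
  case False
  then show ?thesis
    using measure_at_state_chain[OF history_update[OF h t0], of t x s y] t s t0 h_before
    by (fastforce simp: state_prob_def before_def transition_def)
qed

lemma mean_step:
  assumes t: "t0 \<le> t" and s: "t \<le> s"
  shows "mean s f = (\<Sum>z\<in>UNIV. prb t z * (transition P (past t) t s *v f) $ z)"
proof -
  have "mean s f = (\<Sum>y\<in>UNIV. \<Sum>z\<in>UNIV. prb t z * transition P (past t) t s $ z $ y * f $ y)"
    by (simp add: state_mean_def prb_step[OF assms] sum_distrib_right)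
  also have "\<dots> = (\<Sum>z\<in>UNIV. \<Sum>y\<in>UNIV. prb t z * transition P (past t) t s $ z $ y * f $ y)"
    by (rule sum.swap)
  finally show ?thesis by (simp add: mult_vec_nth sum_distrib_left mult.assoc)
qed

lemma mean_increment:
  assumes t: "t0 \<le> t" and d: "0 < d"
  shows "mean (t + d) f - mean t f =
    d * (\<Sum>z\<in>UNIV. prb t z * (((1 / d) *\<^sub>R (transition P (past t) t (t + d) - mat 1)) *v f) $ z)"
proof -
  have "(((1 / d) *\<^sub>R (transition P (past t) t (t + d) - mat 1)) *v f) $ z =
      (1 / d) * ((transition P (past t) t (t + d) *v f) $ z - f $ z)" for z
    by (simp add: scaleR_matrix_vector_assoc[symmetric] matrix_vector_mult_diff_rdistrib)
  then show ?thesis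
    using mean_step[of t "t + d" f] t d
    by (simp add: state_mean_def sum_distrib_left right_diff_distrib sum_subtractf)
qed

lemma prb_eq_mean: "prb t y = mean t (indv {y})"
proof -
  have "mean t (indv {y}) = (\<Sum>z\<in>UNIV. if z = y then prb t z else 0)"
    unfolding state_mean_def by (intro sum.cong) (auto simp: indv_def)
  then show ?thesis by simp
qed

end

locale started_consistent_process = started_process P h t0 x
  for P :: "'x::finite process" and h t0 x +
  fixes \<Q> :: "(real ^ 'x ^ 'x) set"
  assumes consistent: "consistent_with P \<Q>"
begin

definition right_quotient :: "real \<Rightarrow> real \<Rightarrow> real ^ 'x ^ 'x" where
  "right_quotient t d = (1 / d) *\<^sub>R (transition P (past t) t (t + d) - mat 1)"

text \<open>The history stays fixed at \<open>h(t0 \<mapsto> x)\<close> while \<open>d\<close>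
  varies, as consistency demands; it precedes \<open>t - d\<close> once
  \<open>d < t - t0\<close>.\<close>

definition left_quotient :: "real \<Rightarrow> real \<Rightarrow> real ^ 'x ^ 'x" where
  "left_quotient t d = (1 / d) *\<^sub>R (transition P (h(t0 \<mapsto> x)) (t - d) t - mat 1)"

lemma outer_right: "t0 \<le> t \<Longrightarrow> outer_derivatives_in (right_quotient t) \<Q>"
  using consistent past[of t] t0 unfolding consistent_with_def right_quotient_def by auto

lemma outer_left:
  assumes t: "t0 < t"
  shows "outer_derivatives_in (left_quotient t) \<Q>"
proof -
  have "outer_derivatives_in (\<lambda>\<Delta>. (1 / \<Delta>) *\<^sub>R (transition P (past t) (t - \<Delta>) t - mat 1)) \<Q>"
    using consistent past[of t] t t0 unfolding consistent_with_def by auto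
  then show ?thesis using t unfolding left_quotient_def by (simp add: before_def)
qed

lemma abs_sum_prb_le:
  assumes t: "t0 \<le> t" and v: "\<And>z. \<bar>v z\<bar> \<le> K"
  shows "\<bar>\<Sum>z\<in>UNIV. prb t z * v z\<bar> \<le> K"
proof -
  have "\<bar>\<Sum>z\<in>UNIV. prb t z * v z\<bar> \<le> (\<Sum>z\<in>UNIV. \<bar>prb t z * v z\<bar>)" by (rule sum_abs)
  also have "\<dots> \<le> (\<Sum>z\<in>UNIV. prb t z * K)"
    using v by (intro sum_mono) (simp add: abs_mult mult_left_mono)
  also have "\<dots> = K" using sum_prb[OF t] by (simp add: sum_distrib_right[symmetric])
  finally show ?thesis .
qed

lemma quotient_mult_bounded:
  assumes "outer_derivatives_in D \<Q>"
  obtains K where "\<forall>\<^sub>F d in at_right 0. \<forall>z. \<bar>(D d *v f) $ z\<bar> \<le> K"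
proof -
  obtain C where C: "0 \<le> C" "\<forall>\<^sub>F d in at_right 0. \<forall>x y. \<bar>D d $ x $ y\<bar> \<le> C"
    using outer_derivatives_bounded[OF assms] .
  have "\<forall>\<^sub>F d in at_right 0. \<forall>z. \<bar>(D d *v f) $ z\<bar> \<le> (\<Sum>y\<in>UNIV. C * \<bar>f $ y\<bar>)"
    using C(2)
  proof eventually_elim
    case (elim d)
    show ?case
    proof
      fix z
      have "\<bar>(D d *v f) $ z\<bar> \<le> (\<Sum>y\<in>UNIV. \<bar>D d $ z $ y * f $ y\<bar>)" unfolding mult_vec_nth by (rule sum_abs)
      also have "\<dots> \<le> (\<Sum>y\<in>UNIV. C * \<bar>f $ y\<bar>)"
        using elim by (intro sum_mono) (simp add: abs_mult mult_right_mono)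
      finally show "\<bar>(D d *v f) $ z\<bar> \<le> (\<Sum>y\<in>UNIV. C * \<bar>f $ y\<bar>)" .
    qed
  qed
  then show ?thesis by (rule that)
qed

lemma mean_increment_right:
  assumes "t0 \<le> t" "0 < d"
  shows "mean (t + d) f - mean t f = d * (\<Sum>z\<in>UNIV. prb t z * (right_quotient t d *v f) $ z)"
  using mean_increment[OF assms, of f] by (simp add: right_quotient_def)

lemma mean_increment_left:
  assumes "0 < d" "d < t - t0"
  shows "mean t f - mean (t - d) f = d * (\<Sum>z\<in>UNIV. prb (t - d) z * (left_quotient t d *v f) $ z)"
  using mean_increment[of "t - d" d f] assms by (simp add: left_quotient_def before_def)

lemma tendsto_mean_right:
  assumes t: "t0 \<le> t"
  shows "((\<lambda>s. mean s f) \<longlongrightarrow> mean t f) (at_right t)"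
proof -
  obtain K where K: "\<forall>\<^sub>F d in at_right 0. \<forall>z. \<bar>(right_quotient t d *v f) $ z\<bar> \<le> K"
    using quotient_mult_bounded[OF outer_right[OF t]] .
  have "\<forall>\<^sub>F d in at_right 0. norm (mean (d + t) f - mean t f) \<le> d * K"
    using K eventually_at_right_less[of "0::real"]
  proof eventually_elim
    case (elim d)
    then show ?case
      using mean_increment_right[OF t, of d f] abs_sum_prb_le[OF t, of "\<lambda>z. (right_quotient t d *v f) $ z" K]
      by (simp add: add.commute abs_mult mult_left_mono)
  qed
  moreover have "((\<lambda>d. d * K) \<longlongrightarrow> 0 * K) (at_right 0)" by (intro tendsto_intros)
  ultimately have "((\<lambda>d. mean (d + t) f - mean t f) \<longlongrightarrow> 0) (at_right 0)"
    by (subst (asm) mult_zero_left) (rule Lim_null_comparison)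
  then show ?thesis unfolding filterlim_at_right_to_0[of _ _ t] by (simp add: LIM_zero_iff)
qed

text \<open>Right quotients taken at \<open>t - d\<close> would not help, since their bounds may
  depend on the moving base point. The left quotients at \<open>t\<close> are bounded for all small
  \<open>d\<close>, and the weights \<open>prb (t - d)\<close> still sum to one.\<close>

lemma tendsto_mean_left:
  assumes t: "t0 < t"
  shows "((\<lambda>s. mean s f) \<longlongrightarrow> mean t f) (at_left t)"
proof -
  obtain K where K: "\<forall>\<^sub>F d in at_right 0. \<forall>z. \<bar>(left_quotient t d *v f) $ z\<bar> \<le> K"
    using quotient_mult_bounded[OF outer_left[OF t]] .
  have "\<forall>\<^sub>F d in at_right 0. 0 < d \<and> d < t - t0"
    using eventually_at_right_real[of 0 "t - t0"] t by simp
  with K have "\<forall>\<^sub>F d in at_right 0. norm (mean (- (d + - t)) f - mean t f) \<le> d * K"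
  proof eventually_elim
    case (elim d)
    then have "\<bar>mean t f - mean (t - d) f\<bar> \<le> d * K"
      using mean_increment_left[of d t f] abs_sum_prb_le[of "t - d" "\<lambda>z. (left_quotient t d *v f) $ z" K]
      by (simp add: abs_mult mult_left_mono)
    then show ?case by (simp add: abs_minus_commute)
  qed
  moreover have "((\<lambda>d. d * K) \<longlongrightarrow> 0 * K) (at_right 0)" by (intro tendsto_intros)
  ultimately have "((\<lambda>d. mean (- (d + - t)) f - mean t f) \<longlongrightarrow> 0) (at_right 0)"
    by (subst (asm) mult_zero_left) (rule Lim_null_comparison)
  then show ?thesis
    unfolding filterlim_at_left_to_right[of _ _ t] filterlim_at_right_to_0[of _ _ "- t"] by (simp add: LIM_zero_iff)
qed

lemma continuous_on_mean: "continuous_on {t0..} (\<lambda>t. mean t f)"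
  unfolding continuous_on_def
proof
  fix t assume "t \<in> {t0..}"
  then consider "t = t0" | "t0 < t" by fastforce
  then show "((\<lambda>s. mean s f) \<longlongrightarrow> mean t f) (at t within {t0..})"
  proof cases
    case 1
    then show ?thesis using tendsto_mean_right[of t f] by (simp add: at_within_Ici_at_right)
  next
    case 2
    then show ?thesis
      by (intro tendsto_within_subset[OF filterlim_split_at[OF tendsto_mean_left[OF 2] tendsto_mean_right] subset_UNIV])
        simp
  qed
qed

text \<open>Dynkin's formula as an inequality, for a process that need not be Markov. The mean minus
  the integral has non-positive upper right Dini derivative: the bound by \<open>c\<close> holds for
  every matrix in \<open>\<Q>\<close>, hence for every limit point of the quotients given any
  past.\<close>

lemma mean_le:
  assumes Q: "\<And>Q w. Q \<in> \<Q> \<Longrightarrow> (Q *v f) $ w \<le> c $ w" and t: "t0 \<le> t"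
  shows "mean t f \<le> f $ x + integral {t0..t} (\<lambda>r. mean r c)"
proof -
  define F where "F s = mean s f - integral {t0..s} (\<lambda>r. mean r c)" for s
  have cont: "continuous_on {t0..t} (\<lambda>r. mean r g)" for g
    using continuous_on_mean by (rule continuous_on_subset) auto
  have "F t \<le> F t0"
  proof (rule nonincreasing_if_dini_le[OF t])
    show "continuous_on {t0..t} F"
      unfolding F_def
      by (intro continuous_intros cont indefinite_integral_continuous_1 integrable_continuous_interval)
  next
    fix s e :: real assume s: "t0 \<le> s" "s < t" and e: "0 < e"
    \<comment> \<open>Half of the tolerance is spent on the difference quotient, the other half on
      the integral.\<close>
    have e2: "0 < e / 2" using e by simp
    have "\<forall>\<^sub>F d in at_right 0. \<forall>w. (right_quotient s d *v f) $ w \<le> c $ w + e / 2"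
      by (intro eventually_all_finite allI outer_derivatives_le[OF outer_right[OF s(1)] Q e2])
    then show "\<forall>\<^sub>F d in at_right 0. F (s + d) \<le> F s + e * d"
      using eventually_at_right_less[of "0::real"] integral_right_increment_ge[OF cont[of c] s e2]
    proof eventually_elim
      case (elim d)
      have "(\<Sum>z\<in>UNIV. prb s z * (right_quotient s d *v f) $ z) \<le> (\<Sum>z\<in>UNIV. prb s z * (c $ z + e / 2))"
        using elim by (intro sum_mono mult_left_mono) auto
      also have "\<dots> = mean s c + (\<Sum>z\<in>UNIV. prb s z) * (e / 2)"
        by (simp add: state_mean_def distrib_left sum.distrib sum_distrib_right)
      finally have "d * (\<Sum>z\<in>UNIV. prb s z * (right_quotient s d *v f) $ z) \<le> d * (mean s c + e / 2)"
        using elim sum_prb[OF s(1)] by (intro mult_left_mono) auto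
      then have "mean (s + d) f \<le> mean s f + d * (mean s c + e / 2)"
        using mean_increment_right[OF s(1), of d f] elim by linarith
      then show ?case using elim by (simp add: F_def algebra_simps)
    qed
  qed
  moreover have "mean t0 f = f $ x"
  proof -
    have "mean t0 f = (\<Sum>y\<in>UNIV. if y = x then f $ y else 0)"
      unfolding state_mean_def by (intro sum.cong) (auto simp: prb_start)
    then show ?thesis by simp
  qed
  ultimately show ?thesis by (simp add: F_def)
qed

text \<open>\<open>mean_le\<close> is applied to \<open>- indv {x}\<close> with bound 0:
  \<open>Q\<close> maps this function to minus column \<open>x\<close> of \<open>Q\<close>, whose
  entries are non-negative off the diagonal and zero on it. So the probability of being in
  \<open>x\<close> never drops below 1.\<close>

lemma absorbed:
  assumes Q: "\<And>Q. Q \<in> \<Q> \<Longrightarrow> rate_matrix Q" "\<And>Q. Q \<in> \<Q> \<Longrightarrow> Q $ x $ x = 0"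
    and t: "t0 \<le> t" and y: "y \<noteq> x"
  shows "prb t y = 0"
proof -
  have "mean t (- indv {x}) \<le> (- indv {x}) $ x + integral {t0..t} (\<lambda>r. mean r 0)"
  proof (rule mean_le[OF _ t])
    fix Q w assume R: "Q \<in> \<Q>"
    have "(Q *v - indv {x}) $ w = (\<Sum>z\<in>UNIV. if z = x then - Q $ w $ z else 0)"
      unfolding mult_vec_nth by (intro sum.cong) (auto simp: indv_def)
    also have "\<dots> \<le> 0"
      using Q[OF R] by (cases "w = x") (auto simp: rate_matrix_def)
    finally show "(Q *v - indv {x}) $ w \<le> 0 $ w" by simp
  qed
  moreover have "mean t (- indv {x}) = - prb t x"
    unfolding prb_eq_mean by (simp add: state_mean_def sum_negf)
  ultimately have "1 \<le> prb t x" by (simp add: indv_def state_mean_def)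
  moreover have "prb t x + prb t y \<le> (\<Sum>z\<in>UNIV. prb t z)"
    using sum_mono2[of UNIV "{x, y}" "prb t"] y by simp
  ultimately show ?thesis using sum_prb[OF t] prb_nonneg[of t y] by linarith
qed

end

section \<open>Hitting times of absorbing sets\<close>

lemma limitin_discrete_iff:
  "limitin (discrete_topology UNIV) f l F \<longleftrightarrow> (\<forall>\<^sub>F x in F. f x = l)"
proof
  assume "limitin (discrete_topology UNIV) f l F"
  then have "\<forall>\<^sub>F x in F. f x \<in> {l}" by (auto simp: limitin_def)
  then show "\<forall>\<^sub>F x in F. f x = l" by simp
next
  assume "\<forall>\<^sub>F x in F. f x = l"
  then show "limitin (discrete_topology UNIV) f l F"
    unfolding limitin_def by (auto elim: eventually_mono)
qed

lemma paths_iff: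
  "\<omega> \<in> paths \<longleftrightarrow> \<omega> \<in> extensional {0..} \<and> (\<forall>t\<ge>0. \<forall>\<^sub>F s in at_right t. \<omega> s = \<omega> t) \<and>
    (\<forall>t>0. \<exists>y. \<forall>\<^sub>F s in at_left t. \<omega> s = y)"
  by (simp add: paths_def limitin_discrete_iff)

lemma path_rational:
  assumes "\<omega> \<in> paths" "0 \<le> s" "s < t"
  obtains q where "q \<in> \<rat>" "s < q" "q < t" "\<omega> q = \<omega> s"
proof -
  have "\<forall>\<^sub>F r in at_right s. \<omega> r = \<omega> s" using assms by (simp add: paths_iff)
  then obtain b where b: "s < b" "\<And>r. s < r \<Longrightarrow> r < b \<Longrightarrow> \<omega> r = \<omega> s"
    unfolding eventually_at_right_field by blast
  obtain q where "q \<in> \<rat>" "s < q" "q < min b t" using Rats_dense_in_real[of s "min b t"] b assms by auto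
  then show ?thesis using b that by auto
qed

text \<open>By right-continuity a visit to \<open>A\<close> at time \<open>s\<close> persists at
  rational times just after \<open>s\<close>. The countable infimum is what makes the hitting time
  measurable.\<close>

lemma hitting_time_rational:
  assumes w: "\<omega> \<in> paths"
  shows "hitting_time A \<omega> = (INF q\<in>\<rat> \<inter> {0..}. if \<omega> q \<in> A then ennreal q else \<infinity>)"
proof (rule order.antisym)
  show "hitting_time A \<omega> \<le> (INF q\<in>\<rat> \<inter> {0..}. if \<omega> q \<in> A then ennreal q else \<infinity>)"
    unfolding hitting_time_def by (intro INF_greatest) (auto intro: INF_lower)
  show "(INF q\<in>\<rat> \<inter> {0..}. if \<omega> q \<in> A then ennreal q else \<infinity>) \<le> hitting_time A \<omega>"
    unfolding hitting_time_def
  proof (rule INF_greatest)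
    fix s assume s: "s \<in> {t. 0 \<le> t \<and> \<omega> t \<in> A}"
    show "(INF q\<in>\<rat> \<inter> {0..}. if \<omega> q \<in> A then ennreal q else \<infinity>) \<le> ennreal s"
    proof (rule ennreal_le_epsilon)
      fix e :: real assume e: "0 < e"
      obtain q where q: "q \<in> \<rat>" "s < q" "q < s + e" "\<omega> q = \<omega> s"
        using path_rational[OF w, of s "s + e"] s e by auto
      have "(INF q\<in>\<rat> \<inter> {0..}. if \<omega> q \<in> A then ennreal q else \<infinity>) \<le> (if \<omega> q \<in> A then ennreal q else \<infinity>)"
        using q s by (intro INF_lower) auto
      also have "\<dots> \<le> ennreal (s + e)" using q s by (simp add: ennreal_leI del: ennreal_plus)
      finally show "(INF q\<in>\<rat> \<inter> {0..}. if \<omega> q \<in> A then ennreal q else \<infinity>) \<le> ennreal s + ennreal e"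
        using s e by (simp add: ennreal_plus)
    qed
  qed
qed

lemma at_state_pred:
  assumes M: "sets M = sets (coord_algebra {0..})" and t: "0 \<le> t"
  shows "{\<omega> \<in> space M. \<omega> t \<in> B} \<in> sets M"
proof -
  have "space M = paths" using sets_eq_imp_space_eq[OF M] by simp
  then have "{\<omega> \<in> space M. \<omega> t \<in> B} = (\<Union>y\<in>B. at_state t y)" by (auto simp: at_state_def)
  moreover have "at_state t y \<in> sets M" for y using t by (simp add: M at_state_in_coord_algebra)
  ultimately show ?thesis by (simp add: sets.finite_UN)
qed

lemma borel_measurable_hitting_time:
  assumes M: "sets M = sets (coord_algebra {0..})"
  shows "hitting_time A \<in> borel_measurable M"
proof -
  have sp: "space M = paths" using sets_eq_imp_space_eq[OF M] by simp
  have "(\<lambda>\<omega>. INF q\<in>\<rat> \<inter> {0..}. if \<omega> q \<in> A then ennreal q else \<infinity>) \<in> borel_measurable M"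
  proof (rule borel_measurable_INF)
    show "countable (\<rat> \<inter> {0..} :: real set)" by (intro countable_Int1 countable_rat)
    fix q :: real assume "q \<in> \<rat> \<inter> {0..}"
    then show "(\<lambda>\<omega>. if \<omega> q \<in> A then ennreal q else \<infinity>) \<in> borel_measurable M"
      using at_state_pred[OF M, of q A] by (intro measurable_If) auto
  qed
  then show ?thesis
    by (rule measurable_cong[THEN iffD1, rotated]) (simp add: hitting_time_rational sp)
qed

text \<open>The layer-cake identity for a single value, which may be infinite. Both the strict and
  the non-strict form are used, one for each direction of the comparison with
  \<open>out\<close>.\<close>

lemma emeasure_below_ennreal:
  fixes T :: ennreal
  shows "emeasure lborel {t. 0 \<le> t \<and> ennreal t < T} = T"
    and "emeasure lborel {t. 0 \<le> t \<and> ennreal t \<le> T} = T"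
proof -
  have "emeasure lborel {t. 0 \<le> t \<and> ennreal t < T} = T \<and> emeasure lborel {t. 0 \<le> t \<and> ennreal t \<le> T} = T"
  proof (cases T)
    case (real r)
    then have "{t. 0 \<le> t \<and> ennreal t < T} = {0..<r}" "{t. 0 \<le> t \<and> ennreal t \<le> T} = {0..r}"
      by (auto simp: ennreal_less_iff)
    then show ?thesis using real by simp
  next
    case top
    have "emeasure lborel {0::real..} = \<infinity>"
    proof (rule ccontr)
      assume "emeasure lborel {0::real..} \<noteq> \<infinity>"
      then obtain r where r: "0 \<le> r" "emeasure lborel {0::real..} = ennreal r"
        by (cases "emeasure lborel {0::real..}") auto
      have "emeasure lborel {0..r + 1} \<le> emeasure lborel {0::real..}" by (rule emeasure_mono) auto
      then have "ennreal (r + 1) \<le> ennreal r" using r by simp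
      then show False using r by (simp add: ennreal_le_iff)
    qed
    moreover have "{t. 0 \<le> t \<and> ennreal t < T} = {0..}" "{t. 0 \<le> t \<and> ennreal t \<le> T} = {0..}"
      using top by auto
    ultimately show ?thesis using top by simp
  qed
  then show "emeasure lborel {t. 0 \<le> t \<and> ennreal t < T} = T" "emeasure lborel {t. 0 \<le> t \<and> ennreal t \<le> T} = T"
    by auto
qed

locale absorbing_process = process P for P :: "'x::finite process" +
  fixes \<Q> :: "(real ^ 'x ^ 'x) set" and A :: "'x set" and x :: 'x
  assumes consistent: "consistent_with P \<Q>"
    and rate: "\<And>Q. Q \<in> \<Q> \<Longrightarrow> rate_matrix Q"
    and absorbing: "\<And>Q a. Q \<in> \<Q> \<Longrightarrow> a \<in> A \<Longrightarrow> Q $ a $ a = 0"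
begin

sublocale started_consistent_process P Map.empty 0 x \<Q>
  by unfold_locales (auto simp: history_def consistent)

definition out :: "real \<Rightarrow> real" where
  "out t = measure (P [0 \<mapsto> x]) {\<omega> \<in> paths. \<omega> t \<notin> A}"

sublocale M: prob_space "P [0 \<mapsto> x]"
  by (rule prob_space_history) (simp add: history_def)

lemma history_start: "history [0 \<mapsto> x]"
  by (simp add: history_def)

lemma sets_start: "sets (P [0 \<mapsto> x]) = sets (coord_algebra {0..})"
  by (rule sets_history[OF history_start])

lemma space_start: "space (P [0 \<mapsto> x]) = paths"
  by (rule space_history[OF history_start])

lemma out_sets: "0 \<le> t \<Longrightarrow> {\<omega> \<in> paths. \<omega> t \<notin> A} \<in> sets (P [0 \<mapsto> x])"
  using at_state_pred[OF sets_start, of t "- A"] by (simp add: space_start)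

lemma out_eq_mean:
  assumes t: "0 \<le> t"
  shows "out t = mean t (indv (- A))"
proof -
  have "{\<omega> \<in> paths. \<omega> t \<notin> A} = (\<Union>y\<in>- A. at_state t y)" by (auto simp: at_state_def)
  then have "out t = measure (P [0 \<mapsto> x]) (\<Union>y\<in>- A. at_state t y)" by (simp add: out_def)
  also have "\<dots> = (\<Sum>y\<in>- A. prb t y)"
    unfolding state_prob_def using at_state_sets[OF history_start t]
    by (intro M.finite_measure_finite_Union) (auto simp: disjoint_family_on_def at_state_def)
  also have "\<dots> = (\<Sum>y\<in>UNIV. if y \<in> - A then prb t y else 0)"
    by (simp add: sum.If_cases Compl_eq)
  also have "\<dots> = mean t (indv (- A))"
    unfolding state_mean_def by (intro sum.cong) (auto simp: indv_def)
  finally show ?thesis .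
qed

text \<open>Given the history that adds \<open>q \<mapsto> z\<close> with \<open>z\<close> in
  \<open>A\<close>, the process is a consistent one started in an absorbing state. The case
  \<open>q = 0\<close> is separate because the chain rule appends only times later than those in the
  history: there \<open>z\<close> either is the initial state or carries no mass.\<close>

lemma no_return:
  assumes q: "0 \<le> q" "q < t"
  shows "AE \<omega> in P [0 \<mapsto> x]. \<omega> q \<in> A \<longrightarrow> \<omega> t \<in> A"
proof -
  have null: "measure (P [0 \<mapsto> x]) (at_state t y \<inter> at_state q z) = 0" if z: "z \<in> A" and y: "y \<notin> A" for y z
  proof (cases "q = 0")
    case True
    have "measure (P [0 \<mapsto> x]) (at_state t y \<inter> at_state q z) = 0" if "z \<noteq> x"
    proof -
      have "measure (P [0 \<mapsto> x]) (at_state t y \<inter> at_state q z) \<le> measure (P [0 \<mapsto> x]) (at_state q z)"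
        using at_state_sets[OF history_start q(1)] by (intro M.finite_measure_mono) auto
      then show ?thesis using prb_start[of z] that True by (simp add: state_prob_def measure_le_0_iff)
    qed
    moreover have "measure (P [0 \<mapsto> x]) (at_state t y \<inter> at_state q z) = 0" if "z = x"
    proof -
      have "measure (P [0 \<mapsto> x]) (at_state t y \<inter> at_state q z) \<le> measure (P [0 \<mapsto> x]) (at_state t y)"
        using at_state_sets[OF history_start, of t y] q by (intro M.finite_measure_mono) auto
      moreover have "prb t y = 0"
        using absorbed[of t y] rate absorbing z y that q by auto
      ultimately show ?thesis by (simp add: state_prob_def measure_le_0_iff)
    qed
    ultimately show ?thesis by blast
  next
    case False
    interpret later: started_consistent_process P "[0 \<mapsto> x]" q z \<Q>
      using False q by unfold_locales (auto simp: history_start consistent)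
    have "measure (P [0 \<mapsto> x]) (at_state t y \<inter> at_state q z) =
        measure (P (([0 \<mapsto> x])(q \<mapsto> z))) (at_state t y) * measure (P [0 \<mapsto> x]) (at_state q z)"
      using False q by (intro chain_rule history_start at_state_in_coord_algebra) auto
    moreover have "later.prb t y = 0"
      using later.absorbed[of t y] rate absorbing z y q by auto
    ultimately show ?thesis by (simp add: state_prob_def)
  qed
  have "AE \<omega> in P [0 \<mapsto> x]. \<omega> \<notin> at_state t y \<inter> at_state q z" if "z \<in> A" "y \<notin> A" for y z
    using null[OF that] at_state_sets[OF history_start, of t y] at_state_sets[OF history_start, of q z] q
    by (intro AE_not_in null_setsI) (auto simp: M.emeasure_eq_measure)
  then have "AE \<omega> in P [0 \<mapsto> x]. \<forall>z\<in>A. \<forall>y\<in>- A. \<omega> \<notin> at_state t y \<inter> at_state q z"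
    by (intro AE_finite_allI) auto
  then show ?thesis
    using AE_space by eventually_elim (auto simp: space_start at_state_def)
qed

lemma out_antimono:
  assumes "0 \<le> s" "s \<le> t"
  shows "out t \<le> out s"
proof (cases "s = t")
  case False
  then have "AE \<omega> in P [0 \<mapsto> x]. \<omega> \<in> {\<omega> \<in> paths. \<omega> t \<notin> A} \<longrightarrow> \<omega> \<in> {\<omega> \<in> paths. \<omega> s \<notin> A}"
    using no_return[of s t] assms by (auto elim: AE_mp)
  then show ?thesis
    unfolding out_def using assms by (intro M.finite_measure_mono_AE out_sets)
qed simp

text \<open>An earlier visit to \<open>A\<close> would persist at some rational time before
  \<open>t\<close> by right-continuity, so countably many applications of \<open>no_return\<close>
  exclude it almost surely. The bound is non-strict because only times before \<open>t\<close> are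
  examined.\<close>

lemma out_le_hitting:
  assumes t: "0 \<le> t"
  shows "ennreal (out t) \<le> emeasure (P [0 \<mapsto> x]) {\<omega> \<in> space (P [0 \<mapsto> x]). ennreal t \<le> hitting_time A \<omega>}"
proof -
  have [measurable]: "hitting_time A \<in> borel_measurable (P [0 \<mapsto> x])"
    by (rule borel_measurable_hitting_time[OF sets_start])
  have "AE \<omega> in P [0 \<mapsto> x]. \<forall>q\<in>\<rat> \<inter> {0..<t}. \<omega> q \<in> A \<longrightarrow> \<omega> t \<in> A"
    by (subst AE_ball_countable) (auto intro: countable_Int1 countable_rat no_return)
  then have "AE \<omega> in P [0 \<mapsto> x]. \<omega> \<in> {\<omega> \<in> paths. \<omega> t \<notin> A} \<longrightarrow>
      \<omega> \<in> {\<omega> \<in> space (P [0 \<mapsto> x]). ennreal t \<le> hitting_time A \<omega>}"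
  proof eventually_elim
    case (elim \<omega>)
    have "ennreal t \<le> hitting_time A \<omega>" if w: "\<omega> \<in> paths" and out: "\<omega> t \<notin> A"
      unfolding hitting_time_def
    proof (rule INF_greatest)
      fix s assume s: "s \<in> {t. 0 \<le> t \<and> \<omega> t \<in> A}"
      show "ennreal t \<le> ennreal s"
      proof (rule ccontr)
        assume "\<not> ennreal t \<le> ennreal s"
        then have "s < t" using ennreal_leI by (metis not_le)
        then obtain q where "q \<in> \<rat>" "s < q" "q < t" "\<omega> q = \<omega> s"
          using path_rational[OF w, of s t] s by auto
        then show False using bspec[OF elim, of q] out s by auto
      qed
    qed
    then show ?case by (simp add: space_start)
  qed
  then show ?thesis
    unfolding out_def M.emeasure_eq_measure[symmetric] by (intro emeasure_mono_AE) auto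
qed

lemma hitting_le_out:
  assumes t: "0 \<le> t"
  shows "emeasure (P [0 \<mapsto> x]) {\<omega> \<in> space (P [0 \<mapsto> x]). ennreal t < hitting_time A \<omega>} \<le> ennreal (out t)"
  unfolding out_def M.emeasure_eq_measure[symmetric]
proof (rule emeasure_mono)
  have "hitting_time A \<omega> \<le> ennreal t" if "\<omega> t \<in> A" for \<omega>
    unfolding hitting_time_def using that t by (intro INF_lower) auto
  then show "{\<omega> \<in> space (P [0 \<mapsto> x]). ennreal t < hitting_time A \<omega>} \<subseteq> {\<omega> \<in> paths. \<omega> t \<notin> A}"
    by (auto simp: space_start not_le[symmetric])
qed (rule out_sets[OF t])

text \<open>\<open>out t\<close> is sandwiched between the probabilities that the hitting time
  exceeds \<open>t\<close> strictly and non-strictly. Both survival functions integrate to the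
  expectation, so the layer-cake formula is proved for a relation \<open>R\<close> and used with
  \<open><\<close> and \<open>\<le>\<close>.\<close>

lemma expected_hitting_time_eq:
  "expected_hitting_time A P x = (\<integral>\<^sup>+t\<in>{0..}. ennreal (out t) \<partial>lborel)"
proof -
  let ?M = "P [0 \<mapsto> x]"
  have [measurable]: "hitting_time A \<in> borel_measurable ?M"
    by (rule borel_measurable_hitting_time[OF sets_start])
  interpret pair_sigma_finite ?M lborel
    by unfold_locales
  have layer: "(\<integral>\<^sup>+\<omega>. hitting_time A \<omega> \<partial>?M) = (\<integral>\<^sup>+t\<in>{0..}. emeasure ?M {\<omega> \<in> space ?M. R (ennreal t) (hitting_time A \<omega>)} \<partial>lborel)"
    if R[measurable]: "Measurable.pred (?M \<Otimes>\<^sub>M lborel) (\<lambda>(\<omega>, t). R (ennreal t) (hitting_time A \<omega>))"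
      and eq: "\<And>T. emeasure lborel {t. 0 \<le> t \<and> R (ennreal t) T} = T" for R
  proof -
    have Rs: "{t \<in> space lborel. R (ennreal t) (hitting_time A \<omega>)} \<in> sets lborel" if "\<omega> \<in> space ?M" for \<omega>
      using measurable_Pair_compose_split[OF R measurable_const[OF that] measurable_ident] by simp
    have "(\<integral>\<^sup>+\<omega>. hitting_time A \<omega> \<partial>?M) =
        (\<integral>\<^sup>+\<omega>. \<integral>\<^sup>+t. indicator {0..} t * indicator {t. R (ennreal t) (hitting_time A \<omega>)} t \<partial>lborel \<partial>?M)"
    proof (rule nn_integral_cong)
      fix \<omega> assume w: "\<omega> \<in> space ?M"
      have "hitting_time A \<omega> = emeasure lborel {t. 0 \<le> t \<and> R (ennreal t) (hitting_time A \<omega>)}" by (simp add: eq)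
      also have "\<dots> = (\<integral>\<^sup>+t. indicator {t. 0 \<le> t \<and> R (ennreal t) (hitting_time A \<omega>)} t \<partial>lborel)"
      proof (rule nn_integral_indicator[symmetric])
        have "{t. 0 \<le> t \<and> R (ennreal t) (hitting_time A \<omega>)} = {0..} \<inter> {t \<in> space lborel. R (ennreal t) (hitting_time A \<omega>)}" by auto
        also have "\<dots> \<in> sets lborel" using Rs[OF w] by (intro sets.Int) auto
        finally show "{t. 0 \<le> t \<and> R (ennreal t) (hitting_time A \<omega>)} \<in> sets lborel" .
      qed
      also have "\<dots> = (\<integral>\<^sup>+t. indicator {0..} t * indicator {t. R (ennreal t) (hitting_time A \<omega>)} t \<partial>lborel)"
        by (intro nn_integral_cong) (auto simp: indicator_def)
      finally show "hitting_time A \<omega> = \<dots>" .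
    qed
    also have "\<dots> = (\<integral>\<^sup>+t. \<integral>\<^sup>+\<omega>. indicator {0..} t * indicator {t. R (ennreal t) (hitting_time A \<omega>)} t \<partial>?M \<partial>lborel)"
    proof (rule Fubini'[symmetric])
      have "(\<lambda>p. indicator {0..} (snd p) * indicator {p \<in> space (?M \<Otimes>\<^sub>M lborel). case p of (\<omega>, t) \<Rightarrow> R (ennreal t) (hitting_time A \<omega>)} p :: ennreal)
          \<in> borel_measurable (?M \<Otimes>\<^sub>M lborel)"
        by measurable
      then show "(\<lambda>(\<omega>, t). indicator {0..} t * indicator {t. R (ennreal t) (hitting_time A \<omega>)} t :: ennreal)
          \<in> borel_measurable (?M \<Otimes>\<^sub>M lborel)"
        by (rule measurable_cong[THEN iffD1, rotated]) (auto simp: indicator_def space_pair_measure)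
    qed
    also have "\<dots> = (\<integral>\<^sup>+t\<in>{0..}. emeasure ?M {\<omega> \<in> space ?M. R (ennreal t) (hitting_time A \<omega>)} \<partial>lborel)"
    proof (rule nn_integral_cong)
      fix t :: real
      have "(\<integral>\<^sup>+\<omega>. indicator {t. R (ennreal t) (hitting_time A \<omega>)} t \<partial>?M) =
          (\<integral>\<^sup>+\<omega>. indicator {\<omega> \<in> space ?M. R (ennreal t) (hitting_time A \<omega>)} \<omega> \<partial>?M)"
        by (intro nn_integral_cong) (auto simp: indicator_def)
      also have "\<dots> = emeasure ?M {\<omega> \<in> space ?M. R (ennreal t) (hitting_time A \<omega>)}"
        by (rule nn_integral_indicator) (use measurable_Pair_compose_split[OF R measurable_ident measurable_const[of t lborel]] in simp)
      finally show "(\<integral>\<^sup>+\<omega>. indicator {0..} t * indicator {t. R (ennreal t) (hitting_time A \<omega>)} t \<partial>?M) =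
          emeasure ?M {\<omega> \<in> space ?M. R (ennreal t) (hitting_time A \<omega>)} * indicator {0..} t"
        by (auto simp: indicator_def)
    qed
    finally show ?thesis .
  qed
  show ?thesis
    unfolding expected_hitting_time_def
  proof (rule order.antisym)
    show "(\<integral>\<^sup>+\<omega>. hitting_time A \<omega> \<partial>?M) \<le> (\<integral>\<^sup>+t\<in>{0..}. ennreal (out t) \<partial>lborel)"
      by (subst layer[of "(<)"]) (auto simp: emeasure_below_ennreal hitting_le_out split: split_indicator intro!: nn_integral_mono)
    show "(\<integral>\<^sup>+t\<in>{0..}. ennreal (out t) \<partial>lborel) \<le> (\<integral>\<^sup>+\<omega>. hitting_time A \<omega> \<partial>?M)"
      by (subst layer[of "(\<le>)"]) (auto simp: emeasure_below_ennreal out_le_hitting split: split_indicator intro!: nn_integral_mono)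
  qed
qed

end

section \<open>Bounds on expected hitting times\<close>

context absorbing_process
begin

lemma continuous_on_out: "continuous_on {0..} out"
  using continuous_on_mean[of "indv (- A)"] by (rule continuous_on_eq) (simp add: out_eq_mean)

lemma out_nonneg [simp]: "0 \<le> out t"
  by (simp add: out_def)

lemma out_integrable: "out integrable_on {0..t}"
  by (intro integrable_continuous_interval continuous_on_subset[OF continuous_on_out]) auto

lemma integral_mean_out: "integral {0..t} (\<lambda>r. mean r (indv (- A))) = integral {0..t} out"
  by (intro integral_cong) (simp add: out_eq_mean)

lemma nn_integral_out: "(\<integral>\<^sup>+r\<in>{0..t}. ennreal (out r) \<partial>lborel) = ennreal (integral {0..t} out)"
  by (intro nn_integral_has_integral_lebesgue') (auto intro: integrable_integral out_integrable)

text \<open>Monotone convergence along the intervals \<open>{0..real n}\<close> passes from finite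
  horizons to the half-line.\<close>

lemma nn_integral_out_le:
  assumes "\<And>t. 0 \<le> t \<Longrightarrow> integral {0..t} out \<le> K"
  shows "(\<integral>\<^sup>+r\<in>{0..}. ennreal (out r) \<partial>lborel) \<le> ennreal K"
proof -
  have meas: "(\<lambda>r. ennreal (out r) * indicator {0..real n} r) \<in> borel_measurable lborel" for n
  proof -
    have "(\<lambda>r. indicator {0..real n} r *\<^sub>R out r) \<in> borel_measurable borel"
      by (intro borel_measurable_continuous_on_indicator continuous_on_subset[OF continuous_on_out]) auto
    then have "(\<lambda>r. ennreal (indicator {0..real n} r *\<^sub>R out r)) \<in> borel_measurable lborel" by measurable
    then show ?thesis
      by (rule measurable_cong[THEN iffD1, rotated]) (simp add: indicator_def)
  qed
  have inc: "incseq (\<lambda>n r. ennreal (out r) * indicator {0..real n} r)"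
    by (auto simp: incseq_def le_fun_def indicator_def)
  have sup: "(SUP n. ennreal (out r) * indicator {0..real n} r) = ennreal (out r) * indicator {0..} r" for r
  proof (rule order.antisym)
    show "(SUP n. ennreal (out r) * indicator {0..real n} r) \<le> ennreal (out r) * indicator {0..} r"
      by (intro SUP_least) (auto simp: indicator_def)
    obtain n :: nat where "r \<le> real n" using real_arch_simple by blast
    then have "ennreal (out r) * indicator {0..} r = ennreal (out r) * indicator {0..real n} r"
      by (auto simp: indicator_def)
    also have "\<dots> \<le> (SUP n. ennreal (out r) * indicator {0..real n} r)" by (rule SUP_upper) simp
    finally show "ennreal (out r) * indicator {0..} r \<le> (SUP n. ennreal (out r) * indicator {0..real n} r)" .
  qed
  have "(\<integral>\<^sup>+r\<in>{0..}. ennreal (out r) \<partial>lborel) = (SUP n. \<integral>\<^sup>+r\<in>{0..real n}. ennreal (out r) \<partial>lborel)"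
    unfolding sup[symmetric] by (rule nn_integral_monotone_convergence_SUP[OF inc meas])
  also have "\<dots> \<le> ennreal K"
    using assms by (intro SUP_least) (simp add: nn_integral_out ennreal_leI)
  finally show ?thesis .
qed

text \<open>\<open>mean_le\<close> with right-hand side \<open>- indv (- A)\<close>: on
  \<open>A\<close> the rows of every \<open>Q\<close> vanish, off \<open>A\<close> the hypothesis
  applies. Non-negativity of \<open>f\<close> allows the terminal mean to be dropped.\<close>

lemma integral_out_le:
  assumes f: "\<And>y. 0 \<le> f $ y" and fQ: "\<And>Q w. Q \<in> \<Q> \<Longrightarrow> w \<notin> A \<Longrightarrow> (Q *v f) $ w \<le> - 1" and t: "0 \<le> t"
  shows "integral {0..t} out \<le> f $ x"
proof -
  have "mean t f \<le> f $ x + integral {0..t} (\<lambda>r. mean r (- indv (- A)))"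
  proof (rule mean_le[OF _ t])
    fix Q w assume Q: "Q \<in> \<Q>"
    show "(Q *v f) $ w \<le> (- indv (- A)) $ w"
    proof (cases "w \<in> A")
      case True
      then have "(Q *v f) $ w = 0"
        using rate_matrix_row_absorbing[OF rate[OF Q] absorbing[OF Q]] by (simp add: mult_vec_nth)
      with True show ?thesis by (simp add: indv_def)
    qed (use fQ[OF Q] in \<open>simp add: indv_def\<close>)
  qed
  moreover have "mean r (- g) = - mean r g" for r g
    by (simp add: state_mean_def sum_negf)
  moreover have "0 \<le> mean t f"
    unfolding state_mean_def using f by (intro sum_nonneg) simp
  ultimately show ?thesis by (simp add: integral_mean_out)
qed

lemma expected_hitting_time_le:
  assumes "\<And>y. 0 \<le> f $ y" and "\<And>Q w. Q \<in> \<Q> \<Longrightarrow> w \<notin> A \<Longrightarrow> (Q *v f) $ w \<le> - 1"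
  shows "expected_hitting_time A P x \<le> ennreal (f $ x)"
  unfolding expected_hitting_time_eq
  by (intro nn_integral_out_le integral_out_le assms)

text \<open>The same estimate applied to \<open>- f\<close>; this time the terminal mean has the
  unfavourable sign and has to be kept.\<close>

lemma le_mean_plus_integral_out:
  assumes fQ: "\<And>Q w. Q \<in> \<Q> \<Longrightarrow> w \<notin> A \<Longrightarrow> - 1 \<le> (Q *v f) $ w" and t: "0 \<le> t"
  shows "f $ x \<le> mean t f + integral {0..t} out"
proof -
  have "mean t (- f) \<le> (- f) $ x + integral {0..t} (\<lambda>r. mean r (indv (- A)))"
  proof (rule mean_le[OF _ t])
    fix Q w assume Q: "Q \<in> \<Q>"
    have neg: "(Q *v - f) $ w = - (Q *v f) $ w" by (simp add: mult_vec_nth sum_negf)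
    show "(Q *v - f) $ w \<le> indv (- A) $ w"
    proof (cases "w \<in> A")
      case True
      then have "(Q *v f) $ w = 0"
        using rate_matrix_row_absorbing[OF rate[OF Q] absorbing[OF Q]] by (simp add: mult_vec_nth)
      with True show ?thesis unfolding neg by (simp add: indv_def)
    next
      case False
      then show ?thesis unfolding neg using fQ[OF Q False] by (simp add: indv_def)
    qed
  qed
  moreover have "mean t (- f) = - mean t f"
    by (simp add: state_mean_def sum_negf)
  ultimately show ?thesis by (simp add: integral_mean_out)
qed

text \<open>If the expected hitting time \<open>r\<close> is finite, then \<open>t * out t \<le> r\<close>, so that the final term
  \<open>mean t f\<close> vanishes as \<open>t\<close> grows.\<close>

lemma expected_hitting_time_ge:
  assumes fA: "\<And>y. y \<in> A \<Longrightarrow> f $ y = 0" and fQ: "\<And>Q w. Q \<in> \<Q> \<Longrightarrow> w \<notin> A \<Longrightarrow> - 1 \<le> (Q *v f) $ w"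
  shows "ennreal (f $ x) \<le> expected_hitting_time A P x"
proof (cases "expected_hitting_time A P x")
  case (real r)
  have int_le: "integral {0..t} out \<le> r" for t
  proof -
    have "ennreal (integral {0..t} out) \<le> expected_hitting_time A P x"
      unfolding expected_hitting_time_eq nn_integral_out[symmetric]
      by (intro nn_integral_mono) (auto simp: indicator_def)
    then show ?thesis using real by (simp add: ennreal_le_iff)
  qed
  define F where "F = (\<Sum>y\<in>UNIV. \<bar>f $ y\<bar>)"
  have F: "\<bar>f $ y\<bar> \<le> F" for y unfolding F_def by (rule member_le_sum) auto
  have "f $ x \<le> F * r / t + r" if t: "0 < t" for t
  proof -
    have "mean t f \<le> (\<Sum>y\<in>UNIV. prb t y * (F * indv (- A) $ y))"
      unfolding state_mean_def
    proof (intro sum_mono mult_left_mono)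
      show "f $ y \<le> F * indv (- A) $ y" for y
        using F[of y] fA[of y] by (cases "y \<in> A") (auto simp: indv_def)
    qed simp
    also have "\<dots> = F * out t"
      using out_eq_mean[of t] t by (simp add: state_mean_def sum_distrib_left mult.left_commute)
    also have "\<dots> \<le> F * (r / t)"
    proof (rule mult_left_mono)
      have "t * out t = integral {0..t} (\<lambda>_. out t)" using t by simp
      also have "\<dots> \<le> integral {0..t} out"
        by (intro integral_le out_integrable) (auto intro: out_antimono)
      finally show "out t \<le> r / t" using int_le[of t] t by (simp add: field_simps)
    qed (simp add: F_def sum_nonneg)
    finally show ?thesis using le_mean_plus_integral_out[OF fQ, of t] int_le[of t] t by simp
  qed
  moreover have "((\<lambda>t. F * r / t + r) \<longlongrightarrow> 0 + r) at_top"
    by (intro tendsto_intros tendsto_divide_0[OF tendsto_const filterlim_at_top_imp_at_infinity] filterlim_ident)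
  ultimately have "f $ x \<le> 0 + r"
    by (intro tendsto_lowerbound[where f = "\<lambda>t. F * r / t + r"])
      (auto intro: eventually_mono[OF eventually_gt_at_top[of 0]])
  then show ?thesis using real by (simp add: ennreal_leI)
qed simp

end

section \<open>Homogeneous Markov chains are consistent\<close>

lemma opnorm_le:
  fixes M :: "real ^ 'x ^ 'x::finite"
  assumes "\<And>x y. \<bar>M $ x $ y\<bar> \<le> K"
  shows "opnorm ((*v) M) \<le> ennreal (real CARD('x) * K)"
  unfolding opnorm_def
proof (rule SUP_least)
  fix f :: "real ^ 'x" assume "f \<in> {f. infnorm f = 1}"
  then have f: "\<bar>f $ y\<bar> \<le> 1" for y using component_le_infnorm_cart[of f y] by simp
  have "infnorm (M *v f) \<le> real CARD('x) * K"
  proof (rule infnorm_le_cartI)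
    fix x
    have "\<bar>(M *v f) $ x\<bar> \<le> (\<Sum>y\<in>UNIV. \<bar>M $ x $ y * f $ y\<bar>)" unfolding mult_vec_nth by (rule sum_abs)
    also have "\<dots> \<le> (\<Sum>y\<in>(UNIV :: 'x set). K)"
      unfolding abs_mult using assms f order_trans[OF abs_ge_zero assms]
      by (intro sum_mono) (metis abs_ge_zero mult.right_neutral mult_mono)
    finally show "\<bar>(M *v f) $ x\<bar> \<le> real CARD('x) * K" by simp
  qed
  then show "ennreal (infnorm (M *v f)) \<le> ennreal (real CARD('x) * K)" by (rule ennreal_leI)
qed

text \<open>A convergent quotient is eventually bounded and has just one limit point.\<close>

lemma outer_derivatives_in_tendsto:
  assumes lim: "(D \<longlongrightarrow> Q) (at_right 0)" and Q: "Q \<in> \<Q>"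
  shows "outer_derivatives_in D \<Q>"
  unfolding outer_derivatives_in_def
proof (intro conjI allI impI)
  have "\<forall>\<^sub>F d in at_right 0. norm (D d) < norm Q + 1"
    by (rule order_tendstoD[OF tendsto_norm[OF lim]]) simp
  then have "\<forall>\<^sub>F d in at_right 0. opnorm ((*v) (D d)) \<le> ennreal (real CARD('a) * (norm Q + 1))"
  proof eventually_elim
    case (elim d)
    show ?case
    proof (rule opnorm_le)
      show "\<bar>D d $ x $ y\<bar> \<le> norm Q + 1" for x y
        using component_le_norm_cart[of "D d $ x" y] Finite_Cartesian_Product.norm_nth_le[of "D d" x] elim by linarith
    qed
  qed
  then have "Limsup (at_right 0) (\<lambda>d. opnorm ((*v) (D d))) \<le> ennreal (real CARD('a) * (norm Q + 1))"
    by (rule Limsup_bounded)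
  then show "Limsup (at_right 0) (\<lambda>d. opnorm ((*v) (D d))) < \<infinity>"
    using ennreal_less_top order_le_less_trans infinity_ennreal_def by metis
next
  fix d :: "nat \<Rightarrow> real" and R
  assume "filterlim d (at_right 0) sequentially \<and> (\<lambda>i. D (d i)) \<longlonglongrightarrow> R"
  then have "(\<lambda>i. D (d i)) \<longlonglongrightarrow> Q" "(\<lambda>i. D (d i)) \<longlonglongrightarrow> R"
    using filterlim_compose[OF lim] by auto
  then have "R = Q" using LIMSEQ_unique by blast
  with Q show "R \<in> \<Q>" by simp
qed

definition exp_matrix :: "real ^ 'x ^ 'x::finite \<Rightarrow> real \<Rightarrow> real ^ 'x ^ 'x" where
  "exp_matrix Q t = (\<chi> x y. op_exp ((*v) Q) t (indv {y}) $ x)"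

text \<open>The Markov property discards the older history, homogeneity moves the start to time 0,
  and the rate matrix identifies what is left.\<close>

lemma homogeneous_transition:
  fixes P :: "'x::finite process"
  assumes P: "homogeneous_markov_chain P" "has_rate_matrix P Q"
    and h: "history h" "\<And>r. r \<in> dom h \<Longrightarrow> r < t" and t: "0 \<le> t" "t \<le> s"
  shows "transition P h t s = exp_matrix Q (s - t)"
proof -
  have "measure (P (h(t \<mapsto> x))) (at_state s y) = op_exp ((*v) Q) (s - t) (indv {y}) $ x" for x y
  proof -
    have "history (h(t \<mapsto> x))" using h t by (auto simp: history_def)
    moreover have "\<forall>r\<in>dom (h(t \<mapsto> x)). r \<le> t" using h(2) by (auto intro: less_imp_le)
    ultimately have "measure (P (h(t \<mapsto> x))) (at_state s y) = measure (P [t \<mapsto> x]) (at_state s y)"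
      using P(1) t(2) unfolding homogeneous_markov_chain_def markov_chain_def
      by (metis domI fun_upd_same)
    also have "\<dots> = measure (P [0 \<mapsto> x]) (at_state (s - t) y)"
      using P(1) t unfolding homogeneous_markov_chain_def by blast
    also have "\<dots> = op_exp ((*v) Q) (s - t) (indv {y}) $ x"
      using P(2) t unfolding has_rate_matrix_def by simp
    finally show ?thesis .
  qed
  then show ?thesis by (simp add: transition_def exp_matrix_def vec_eq_iff)
qed

lemma homogeneous_consistent:
  fixes P :: "'x::finite process"
  assumes P: "homogeneous_markov_chain P" "has_rate_matrix P Q" and Q: "Q \<in> \<Q>"
    and lim: "((\<lambda>d. (1 / d) *\<^sub>R (exp_matrix Q d - mat 1)) \<longlongrightarrow> Q) (at_right 0)"
  shows "consistent_with P \<Q>"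
  unfolding consistent_with_def
proof (intro allI impI)
  fix h :: "real \<rightharpoonup> 'x" and t :: real assume "history h \<and> 0 \<le> t \<and> (\<forall>r\<in>dom h. r < t)"
  then have h: "history h" "\<And>r. r \<in> dom h \<Longrightarrow> r < t" and t: "0 \<le> t" by auto
  have "((\<lambda>d. (1 / d) *\<^sub>R (transition P h t (t + d) - mat 1)) \<longlongrightarrow> Q) (at_right 0)"
  proof (rule Lim_transform_eventually[OF lim])
    show "\<forall>\<^sub>F d in at_right 0. (1 / d) *\<^sub>R (exp_matrix Q d - mat 1) = (1 / d) *\<^sub>R (transition P h t (t + d) - mat 1)"
      using eventually_at_right_less[of "0::real"]
      by eventually_elim (simp add: homogeneous_transition[OF P h t])
  qed
  \<comment> \<open>For the left quotient \<open>t - d\<close> must be non-negative and later than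
    the history, so \<open>d\<close> is taken smaller than the distance from \<open>t\<close> to 0
    and to every time in the domain of \<open>h\<close>.\<close>
  moreover have "((\<lambda>d. (1 / d) *\<^sub>R (transition P h (t - d) t - mat 1)) \<longlongrightarrow> Q) (at_right 0)" if t0: "0 < t"
  proof (rule Lim_transform_eventually[OF lim])
    have "\<forall>\<^sub>F d in at_right 0. \<forall>r\<in>insert 0 (dom h). d < t - r"
    proof (intro eventually_ball_finite ballI)
      show "finite (insert 0 (dom h))" using h(1) by (simp add: history_def)
      fix r assume "r \<in> insert 0 (dom h)"
      then have "0 < t - r" using h(2) t0 by auto
      then show "\<forall>\<^sub>F d in at_right 0. d < t - r"
        using eventually_at_right_real[of 0 "t - r"] by (auto elim: eventually_mono)
    qed
    then show "\<forall>\<^sub>F d in at_right 0. (1 / d) *\<^sub>R (exp_matrix Q d - mat 1) = (1 / d) *\<^sub>R (transition P h (t - d) t - mat 1)"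
      using eventually_at_right_less[of "0::real"]
    proof eventually_elim
      case (elim d)
      have "r < t - d" if "r \<in> dom h" for r
      proof -
        have "d < t - r" using elim that by blast
        then show ?thesis by linarith
      qed
      then show ?case using homogeneous_transition[OF P h(1), of "t - d" t] elim by simp
    qed
  qed
  ultimately show "outer_derivatives_in (\<lambda>\<Delta>. (1 / \<Delta>) *\<^sub>R (transition P h t (t + \<Delta>) - mat 1)) \<Q> \<and>
      (0 < t \<longrightarrow> outer_derivatives_in (\<lambda>\<Delta>. (1 / \<Delta>) *\<^sub>R (transition P h (t - \<Delta>) t - mat 1)) \<Q>)"
    using outer_derivatives_in_tendsto[OF _ Q] by blast
qed

section \<open>Jump paths\<close>

text \<open>A stream of marks \<open>(t\<^sub>n, F\<^sub>n)\<close> drives the chain: after a waiting time \<open>t\<^sub>n\<close>, the state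
  \<open>y\<close> is replaced by \<open>F\<^sub>n y\<close>.\<close>

type_synonym 'x marks = "(real \<times> ('x \<Rightarrow> 'x)) stream"

primrec jump_time :: "nat \<Rightarrow> 'x marks \<Rightarrow> real" where
  "jump_time 0 w = 0"
| "jump_time (Suc n) w = fst (shd w) + jump_time n (stl w)"

primrec jump_state :: "nat \<Rightarrow> 'x \<Rightarrow> 'x marks \<Rightarrow> 'x" where
  "jump_state 0 x w = x"
| "jump_state (Suc n) x w = jump_state n (snd (shd w) x) (stl w)"

text \<open>The bound \<open>m\<close> ranges over the naturals so that only countably many
  conditions occur, which serves measurability and almost-sure statements. Positive waiting times
  are included because they make the jump times strictly increasing.\<close>

definition nonexplosive :: "'x marks \<Rightarrow> bool" where
  "nonexplosive w \<longleftrightarrow> (\<forall>n. 0 < fst (w !! n)) \<and> (\<forall>m :: nat. \<exists>n. real m < jump_time (Suc n) w)"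

text \<open>On a nonexplosive stream, the number of jumps up to and including \<open>t\<close>: the
  strict inequality counts a jump that happens exactly at \<open>t\<close>, which makes paths
  right-continuous.\<close>

definition jump_index :: "real \<Rightarrow> 'x marks \<Rightarrow> nat" where
  "jump_index t w = (LEAST n. t < jump_time (Suc n) w)"

text \<open>On explosive streams, which will turn out to be a null set, the path is constantly
  \<open>x\<close>. Thus every stream yields a cadlag path that starts in \<open>x\<close>.\<close>

definition chain_path :: "'x \<Rightarrow> 'x marks \<Rightarrow> real \<Rightarrow> 'x" where
  "chain_path x w = (\<lambda>t\<in>{0..}. if nonexplosive w then jump_state (jump_index t w) x w else x)"

text \<open>The primitive recursion peels marks off the front, which suits renewal arguments;
  monotonicity in \<open>n\<close> needs the increment at the other end.\<close>

lemma jump_time_Suc: "jump_time (Suc n) w = jump_time n w + fst (w !! n)"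
proof (induction n arbitrary: w)
  case (Suc n)
  have "jump_time (Suc (Suc n)) w = fst (shd w) + jump_time (Suc n) (stl w)" by simp
  also have "\<dots> = fst (shd w) + (jump_time n (stl w) + fst (stl w !! n))" by (simp only: Suc.IH)
  finally show ?case by simp
qed simp

lemma nonexplosive_pos: "nonexplosive w \<Longrightarrow> 0 < fst (w !! n)"
  unfolding nonexplosive_def by (erule conjE, erule spec)

lemma jump_time_strict_mono:
  assumes "nonexplosive w"
  shows "jump_time n w < jump_time (Suc n) w"
  using nonexplosive_pos[OF assms, of n] unfolding jump_time_Suc by linarith

lemma jump_time_mono: "nonexplosive w \<Longrightarrow> m \<le> n \<Longrightarrow> jump_time m w \<le> jump_time n w"
  by (rule lift_Suc_mono_le[of "\<lambda>n. jump_time n w"]) (rule less_imp_le[OF jump_time_strict_mono])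

lemma nonexplosive_exceeds:
  assumes "nonexplosive w"
  shows "\<exists>n. t < jump_time (Suc n) w"
proof -
  obtain m :: nat where m: "t < real m" using reals_Archimedean2 by blast
  obtain n where "real m < jump_time (Suc n) w" using assms unfolding nonexplosive_def by metis
  with m have "t < jump_time (Suc n) w" by (rule less_trans)
  then show ?thesis ..
qed

lemma nonexplosive_Stream: "nonexplosive (a ## w) \<longleftrightarrow> 0 < fst a \<and> nonexplosive w"
proof
  assume a: "nonexplosive (a ## w)"
  have pos: "0 < fst ((a ## w) !! n)" for n by (rule nonexplosive_pos[OF a])
  have "0 < fst a" using pos[of 0] by simp
  moreover have pos': "0 < fst (w !! n)" for n using pos[of "Suc n"] by simp
  moreover have "\<exists>n. real m < jump_time (Suc n) w" for m
  proof -
    obtain n where "real m + fst a < jump_time (Suc n) (a ## w)" using nonexplosive_exceeds[OF a] by blast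
    then have "real m < jump_time n w" by simp
    also have "\<dots> < jump_time (Suc n) w" unfolding jump_time_Suc using pos' by simp
    finally show ?thesis by blast
  qed
  ultimately show "0 < fst a \<and> nonexplosive w" by (simp add: nonexplosive_def)
next
  assume a: "0 < fst a \<and> nonexplosive w"
  have "0 < fst ((a ## w) !! n)" for n using a nonexplosive_pos[of w] by (cases n) simp_all
  moreover have "\<exists>n. real m < jump_time (Suc n) (a ## w)" for m
  proof -
    obtain n where "real m - fst a < jump_time (Suc n) w" using nonexplosive_exceeds a by blast
    then have "real m < jump_time (Suc (Suc n)) (a ## w)" by simp
    then show ?thesis by blast
  qed
  ultimately show "nonexplosive (a ## w)" by (simp add: nonexplosive_def)
qed

lemma jump_index_eq:
  assumes w: "nonexplosive w" and t: "jump_time n w \<le> t" "t < jump_time (Suc n) w"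
  shows "jump_index t w = n"
  unfolding jump_index_def
proof (rule Least_equality)
  show "n \<le> m" if "t < jump_time (Suc m) w" for m
  proof (rule ccontr)
    assume "\<not> n \<le> m"
    then have "jump_time (Suc m) w \<le> jump_time n w" by (intro jump_time_mono[OF w]) simp
    then show False using t that by linarith
  qed
qed (rule t(2))

lemma jump_index_bounds:
  assumes w: "nonexplosive w" and t: "0 \<le> t"
  shows "jump_time (jump_index t w) w \<le> t" and "t < jump_time (Suc (jump_index t w)) w"
proof -
  show "t < jump_time (Suc (jump_index t w)) w"
    unfolding jump_index_def using nonexplosive_exceeds[OF w] by (rule LeastI_ex)
  show "jump_time (jump_index t w) w \<le> t"
  proof (cases "jump_index t w")
    case (Suc n)
    then have "\<not> t < jump_time (Suc n) w"
      unfolding jump_index_def by (intro not_less_Least) simp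
    then show ?thesis unfolding Suc by simp
  qed (use t in simp)
qed

lemma chain_path_in_paths: "chain_path x w \<in> paths"
proof (cases "nonexplosive w")
  case False
  have "\<forall>\<^sub>F s in at_right t. chain_path x w s = chain_path x w t" if "0 \<le> t" for t
    using eventually_at_right_less[of t] by eventually_elim (use that False in \<open>simp add: chain_path_def\<close>)
  moreover have "\<forall>\<^sub>F s in at_left t. chain_path x w s = x" if "0 < t" for t
    using eventually_at_left_real[OF that] by eventually_elim (use False in \<open>simp add: chain_path_def\<close>)
  moreover have "chain_path x w \<in> extensional {0..}" by (simp add: chain_path_def)
  ultimately show ?thesis unfolding paths_iff by blast
next
  case True
  have "\<forall>\<^sub>F s in at_right t. chain_path x w s = chain_path x w t" if t: "0 \<le> t" for t
    using eventually_at_right_real[OF jump_index_bounds(2)[OF True t]]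
  proof eventually_elim
    case (elim s)
    then have "jump_index s w = jump_index t w"
      using jump_index_bounds[OF True t] by (intro jump_index_eq[OF True]) auto
    then show ?case using elim t True by (simp add: chain_path_def)
  qed
  moreover have "\<exists>y. \<forall>\<^sub>F s in at_left t. chain_path x w s = y" if t: "0 < t" for t
  proof -
    \<comment> \<open>The state just before \<open>t\<close> is found by a non-strict comparison: in
      contrast to \<open>jump_index\<close>, a jump exactly at \<open>t\<close> must not be
      counted.\<close>
    define n where "n = (LEAST n. t \<le> jump_time (Suc n) w)"
    have upper: "t \<le> jump_time (Suc n) w"
      unfolding n_def by (rule LeastI_ex) (use nonexplosive_exceeds[OF True, of t] in \<open>metis less_imp_le\<close>)
    have lower: "jump_time n w < t"
    proof (cases n)
      case (Suc k)
      then have "\<not> t \<le> jump_time (Suc k) w" unfolding n_def by (intro not_less_Least) simp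
      then show ?thesis unfolding Suc by simp
    qed (use t in simp)
    have nonneg: "0 \<le> jump_time n w" using jump_time_mono[OF True, of 0 n] by simp
    have "\<forall>\<^sub>F s in at_left t. chain_path x w s = jump_state n x w"
      using eventually_at_left_real[OF lower]
    proof eventually_elim
      case (elim s)
      then have "jump_index s w = n" using upper by (intro jump_index_eq[OF True]) auto
      then show ?case using elim nonneg True by (simp add: chain_path_def)
    qed
    then show ?thesis by blast
  qed
  moreover have "chain_path x w \<in> extensional {0..}" by (simp add: chain_path_def)
  ultimately show ?thesis unfolding paths_iff by blast
qed

lemma chain_path_0: "chain_path x w 0 = x"
proof (cases "nonexplosive w")
  case True
  then have "0 < fst (w !! 0)" by (rule nonexplosive_pos)
  with True have "jump_index 0 w = 0" by (intro jump_index_eq) auto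
  with True show ?thesis by (simp add: chain_path_def)
qed (simp add: chain_path_def)

lemma chain_path_Stream:
  assumes a: "nonexplosive (a ## w)" and t: "0 \<le> t"
  shows "chain_path x (a ## w) t = (if t < fst a then x else chain_path (snd a x) w (t - fst a))"
proof -
  have w: "nonexplosive w" "0 < fst a" using a by (auto simp: nonexplosive_Stream)
  show ?thesis
  proof (cases "t < fst a")
    case True
    then have "jump_index t (a ## w) = 0" using t by (intro jump_index_eq[OF a]) auto
    with True a t show ?thesis by (simp add: chain_path_def)
  next
    case False
    then have "jump_index t (a ## w) = Suc (jump_index (t - fst a) w)"
      using jump_index_bounds[OF w(1), of "t - fst a"] by (intro jump_index_eq[OF a]) auto
    with False a w t show ?thesis by (simp add: chain_path_def)
  qed
qed

section \<open>Time shifts and events of the future\<close>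

definition time_shift :: "real \<Rightarrow> (real \<Rightarrow> 'x) \<Rightarrow> real \<Rightarrow> 'x" where
  "time_shift s \<omega> = (\<lambda>r\<in>{0..}. \<omega> (s + r))"

lemma time_shift_in_paths:
  assumes w: "\<omega> \<in> paths" and s: "0 \<le> s"
  shows "time_shift s \<omega> \<in> paths"
proof -
  have "\<forall>\<^sub>F r in at_right t. time_shift s \<omega> r = time_shift s \<omega> t" if t: "0 \<le> t" for t
  proof -
    have "\<forall>\<^sub>F r in at_right (s + t). \<omega> r = \<omega> (s + t)" using w s t by (simp add: paths_iff)
    then have "\<forall>\<^sub>F r in at_right t. \<omega> (s + r) = \<omega> (s + t)"
      unfolding eventually_at_right_to_0[of _ "s + t"] eventually_at_right_to_0[of _ t] by (simp add: ac_simps)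
    then show ?thesis
      using eventually_at_right_less[of t] by eventually_elim (use t in \<open>simp add: time_shift_def\<close>)
  qed
  moreover have "\<exists>y. \<forall>\<^sub>F r in at_left t. time_shift s \<omega> r = y" if t: "0 < t" for t
  proof -
    have "0 < s + t" using s t by simp
    then obtain y where "\<forall>\<^sub>F r in at_left (s + t). \<omega> r = y" using w by (auto simp: paths_iff)
    then obtain b where b: "b < s + t" "\<And>r. b < r \<Longrightarrow> r < s + t \<Longrightarrow> \<omega> r = y"
      unfolding eventually_at_left_field by blast
    have "\<forall>\<^sub>F r in at_left t. r \<in> {max 0 (b - s)<..<t}" using b t by (intro eventually_at_left_real) auto
    then have "\<forall>\<^sub>F r in at_left t. time_shift s \<omega> r = y"
      by eventually_elim (auto simp: time_shift_def intro!: b)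
    then show ?thesis by blast
  qed
  moreover have "time_shift s \<omega> \<in> extensional {0..}" by (simp add: time_shift_def)
  ultimately show ?thesis unfolding paths_iff by blast
qed

lemma measurable_into_coord_algebra:
  assumes "\<And>w. w \<in> space M \<Longrightarrow> f w \<in> paths"
    and "\<And>t y. t \<in> T \<Longrightarrow> {w \<in> space M. f w t = y} \<in> sets M"
  shows "f \<in> measurable M (coord_algebra T)"
  unfolding coord_algebra_def
proof (rule measurable_measure_of)
  show "{at_state t x |t x. t \<in> T} \<subseteq> Pow paths" using at_state_subset by blast
  show "f \<in> space M \<rightarrow> paths" using assms(1) by blast
  fix B :: "(real \<Rightarrow> 'b) set" assume "B \<in> {at_state t x |t x. t \<in> T}"
  then obtain t y where B: "B = at_state t y" "t \<in> T" by blast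
  have "f -` B \<inter> space M = {w \<in> space M. f w t = y}" using assms(1) by (auto simp: B at_state_def)
  then show "f -` B \<inter> space M \<in> sets M" using assms(2)[OF B(2)] by simp
qed

lemma at_state_coord: "t \<in> T \<Longrightarrow> {\<omega> \<in> space (coord_algebra T). \<omega> t = y} \<in> sets (coord_algebra T)"
  using at_state_in_coord_algebra[of t T y] by (simp add: at_state_def)

lemma measurable_time_shift:
  assumes "0 \<le> s"
  shows "time_shift s \<in> measurable (coord_algebra {s..}) (coord_algebra {0..})"
proof (rule measurable_into_coord_algebra)
  show "time_shift s w \<in> paths" if "w \<in> space (coord_algebra {s..})" for w
    using that assms by (simp add: time_shift_in_paths)
  fix t :: real and y :: 'a assume t: "t \<in> {0..}"
  then show "{w \<in> space (coord_algebra {s..}). time_shift s w t = y} \<in> sets (coord_algebra {s..})"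
    using at_state_coord[of "s + t" "{s..}" y] by (simp add: time_shift_def)
qed

lemma sets_coord_algebra_mono: "S \<subseteq> T \<Longrightarrow> sets (coord_algebra S) \<subseteq> sets (coord_algebra T)"
  unfolding sets_coord_algebra by (rule sigma_sets_mono') blast

lemma measurable_time_shift':
  assumes "0 \<le> s"
  shows "time_shift s \<in> measurable (coord_algebra {0..}) (coord_algebra {0..})"
  using measurable_time_shift[OF assms] sets_coord_algebra_mono[of "{s..}" "{0..}"] assms
  by (auto simp: measurable_def)

text \<open>Preimages under the shift form a \<sigma>-algebra, and it contains the generators
  because coordinate \<open>t\<close> of a path is coordinate \<open>t - s\<close> of its shift.
  Events of the future can thus be expressed through the shifted path alone.\<close>

lemma time_shift_preimage:
  assumes s: "0 \<le> s" and B: "B \<in> sets (coord_algebra {s..})"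
  obtains B' where "B' \<in> sets (coord_algebra {0..})" "B = {\<omega> \<in> paths. time_shift s \<omega> \<in> B'}"
proof -
  have "\<exists>B'\<in>sets (coord_algebra {0..}). B = {\<omega> \<in> paths. time_shift s \<omega> \<in> B'}"
    using B unfolding sets_coord_algebra[of "{s..}"]
  proof (induction B rule: sigma_sets.induct)
    case (Basic B)
    then obtain t y where B: "B = at_state t y" "s \<le> t" by auto
    have "B = {\<omega> \<in> paths. time_shift s \<omega> \<in> at_state (t - s) y}"
      using B s time_shift_in_paths[OF _ s] by (auto simp: at_state_def time_shift_def)
    moreover have "at_state (t - s) y \<in> sets (coord_algebra {0..})"
      using B by (intro at_state_in_coord_algebra) simp
    ultimately show ?case by blast
  next
    case Empty
    then show ?case by (intro bexI[of _ "{}"]) auto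
  next
    case (Compl B)
    then obtain B' where B': "B' \<in> sets (coord_algebra {0..})" "B = {\<omega> \<in> paths. time_shift s \<omega> \<in> B'}" by blast
    have "paths - B = {\<omega> \<in> paths. time_shift s \<omega> \<in> paths - B'}"
      using time_shift_in_paths[OF _ s] by (auto simp: B'(2))
    moreover have "paths - B' \<in> sets (coord_algebra {0..})"
      using sets.compl_sets[OF B'(1)] by simp
    ultimately show ?case by blast
  next
    case (Union B)
    then obtain B' where B': "\<And>i. B' i \<in> sets (coord_algebra {0..})" "\<And>i. B i = {\<omega> \<in> paths. time_shift s \<omega> \<in> B' i}"
      by metis
    have "(\<Union>i. B i) = {\<omega> \<in> paths. time_shift s \<omega> \<in> (\<Union>i. B' i)}" by (auto simp: B'(2))
    moreover have "(\<Union>i. B' i) \<in> sets (coord_algebra {0..})" using B'(1) by blast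
    ultimately show ?case by blast
  qed
  then show ?thesis using that by blast
qed

text \<open>In the second case only the first waiting time changes, from \<open>fst a\<close> to
  \<open>fst a - s\<close>; this is the form to which memorylessness of the exponential law
  applies.\<close>

lemma time_shift_chain_path:
  assumes a: "nonexplosive (a ## w)" and s: "0 \<le> s"
  shows "fst a \<le> s \<Longrightarrow> time_shift s (chain_path x (a ## w)) = time_shift (s - fst a) (chain_path (snd a x) w)"
    and "s < fst a \<Longrightarrow> time_shift s (chain_path x (a ## w)) = chain_path x ((fst a - s, snd a) ## w)"
proof -
  have w: "nonexplosive w" "0 < fst a" using a by (auto simp: nonexplosive_Stream)
  show "time_shift s (chain_path x (a ## w)) = time_shift (s - fst a) (chain_path (snd a x) w)" if "fst a \<le> s"
    unfolding time_shift_def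
    by (intro restrict_ext) (use s that in \<open>auto simp: chain_path_Stream[OF a] algebra_simps\<close>)
  show "time_shift s (chain_path x (a ## w)) = chain_path x ((fst a - s, snd a) ## w)" if l: "s < fst a"
  proof
    fix r
    have a': "nonexplosive ((fst a - s, snd a) ## w)" using w l by (simp add: nonexplosive_Stream)
    show "time_shift s (chain_path x (a ## w)) r = chain_path x ((fst a - s, snd a) ## w) r"
    proof (cases "0 \<le> r")
      case True
      then show ?thesis
        using s l by (simp add: time_shift_def chain_path_Stream[OF a] chain_path_Stream[OF a'] algebra_simps)
    qed (simp add: time_shift_def chain_path_def)
  qed
qed

section \<open>Uniformization\<close>

locale uniformization =
  fixes Q :: "real ^ 'x ^ 'x::finite" and l :: real
  assumes rate: "rate_matrix Q" and l: "0 < l" and l_bound: "\<And>x. - (Q $ x $ x) \<le> l"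
begin

text \<open>Row \<open>x\<close> of the stochastic matrix \<open>I + Q / l\<close>; the bound on
  \<open>- (Q $ x $ x)\<close> keeps its diagonal entry non-negative.\<close>

definition jump :: "'x \<Rightarrow> 'x pmf" where
  "jump x = embed_pmf (\<lambda>y. (if y = x then 1 else 0) + Q $ x $ y / l)"

lemma pmf_jump: "pmf (jump x) y = (if y = x then 1 else 0) + Q $ x $ y / l"
  unfolding jump_def
proof (rule pmf_embed_pmf)
  show nn: "0 \<le> (if y = x then 1 else 0) + Q $ x $ y / l" for y
    using rate l l_bound[of x] by (cases "y = x") (auto simp: rate_matrix_def field_simps)
  have "(\<Sum>y\<in>UNIV. (if y = x then 1 else 0) + Q $ x $ y / l) = 1"
    using rate by (simp add: sum.distrib sum_divide_distrib[symmetric] rate_matrix_def)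
  then show "(\<integral>\<^sup>+y. ennreal ((if y = x then 1 else 0) + Q $ x $ y / l) \<partial>count_space UNIV) = 1"
    using nn by (simp add: nn_integral_count_space_finite sum_ennreal)
qed

text \<open>A random map draws a successor for every state independently, although only the value at
  the current state is ever used. In this way the marks do not depend on the state and can form an
  i.i.d. stream.\<close>

definition steps :: "('x \<Rightarrow> 'x) pmf" where
  "steps = Pi_pmf UNIV undefined jump"

definition clock :: "real measure" where
  "clock = density lborel (exponential_density l)"

definition mark :: "(real \<times> ('x \<Rightarrow> 'x)) measure" where
  "mark = clock \<Otimes>\<^sub>M measure_pmf steps"

definition W :: "'x marks measure" where
  "W = stream_space mark"

lemma sets_clock [measurable_cong]: "sets clock = sets borel"
  by (simp add: clock_def)

lemma sets_mark [measurable_cong]: "sets mark = sets (borel \<Otimes>\<^sub>M count_space UNIV)"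
  unfolding mark_def by (intro sets_pair_measure_cong sets_clock) simp

lemma space_mark: "space mark = UNIV"
  using sets_eq_imp_space_eq[OF sets_mark] by (simp add: space_pair_measure)

lemma sets_W [measurable_cong]: "sets W = sets (stream_space mark)"
  by (simp add: W_def)

lemma space_W: "space W = UNIV"
  by (simp add: W_def space_stream_space space_mark)

sublocale clock: prob_space clock
  unfolding clock_def by (rule prob_space_exponential_density[OF l])

sublocale mark: prob_space mark
  unfolding mark_def by (intro prob_space_pair clock.prob_space_axioms measure_pmf.prob_space_axioms)

sublocale W: prob_space W
  unfolding W_def by (rule mark.prob_space_stream_space)

lemma measurable_fst_mark [measurable]: "fst \<in> borel_measurable mark"
  unfolding measurable_cong_sets[OF sets_mark refl] by measurable

lemma measurable_snd_mark [measurable]: "(\<lambda>a. snd a x) \<in> measurable mark (count_space UNIV)"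
  unfolding measurable_cong_sets[OF sets_mark refl]
  by (rule measurable_compose[OF measurable_snd, where g = "\<lambda>F. F x"]) simp

lemma measurable_jump_time [measurable]: "jump_time n \<in> borel_measurable W"
proof (induction n)
  case 0
  then show ?case unfolding jump_time.simps by measurable
next
  case (Suc n)
  then have [measurable]: "jump_time n \<in> borel_measurable (stream_space mark)" by (simp add: W_def)
  show ?case unfolding W_def jump_time.simps by measurable
qed

lemma measurable_jump_state [measurable]: "jump_state n x \<in> measurable W (count_space UNIV)"
proof (induction n arbitrary: x)
  case 0
  then show ?case unfolding jump_state.simps by measurable
next
  case (Suc n)
  then have [measurable]: "jump_state n y \<in> measurable (stream_space mark) (count_space UNIV)" for y
    by (simp add: W_def)
  have "(\<lambda>w. jump_state n (snd (shd w) x) (stl w)) \<in> measurable (stream_space mark) (count_space UNIV)"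
    by (rule measurable_compose_countable'[where f = "\<lambda>y w. jump_state n y (stl w)" and I = UNIV])
      (simp_all add: countable_finite)
  then show ?case unfolding W_def jump_state.simps .
qed

lemma measurable_nonexplosive [measurable]: "Measurable.pred W nonexplosive"
proof -
  have [measurable]: "jump_time n \<in> borel_measurable (stream_space mark)" for n
    using measurable_jump_time[of n] by (simp add: W_def)
  show ?thesis unfolding W_def nonexplosive_def[abs_def] by (measurable; simp)
qed

lemma measurable_chain_path: "chain_path x \<in> measurable W (coord_algebra {0..})"
proof (rule measurable_into_coord_algebra)
  show "chain_path x w \<in> paths" for w by (rule chain_path_in_paths)
  fix t :: real and y :: 'x assume t: "t \<in> {0..}"
  have [measurable]: "jump_index t \<in> measurable W (count_space UNIV)"
    unfolding jump_index_def by measurable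
  have [measurable]: "(\<lambda>w. jump_state (jump_index t w) x w) \<in> measurable W (count_space UNIV)"
    by (rule measurable_compose_countable[where f = "\<lambda>n. jump_state n x"]) measurable
  have "(\<lambda>w. if nonexplosive w then jump_state (jump_index t w) x w else x) \<in> measurable W (count_space UNIV)"
    by measurable
  then have "(\<lambda>w. chain_path x w t) \<in> measurable W (count_space UNIV)"
    using t by (simp add: chain_path_def)
  from measurable_sets[OF this, of "{y}"]
  show "{w \<in> space W. chain_path x w t = y} \<in> sets W" by (simp add: vimage_def Int_def conj_commute)
qed

lemma AE_mark_pos: "AE a in mark. 0 < fst a"
proof -
  interpret pair_sigma_finite clock "measure_pmf steps" by unfold_locales
  have "AE t in clock. 0 < t"
  proof -
    have "AE t in lborel. t \<noteq> (0::real)" by (rule AE_lborel_singleton)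
    then show ?thesis
      unfolding clock_def using l
      by (subst AE_density) (auto simp: exponential_density_def elim!: eventually_mono)
  qed
  then have "AE t in clock. AE F in measure_pmf steps. 0 < fst (t, F)" by simp
  moreover have "{a \<in> space mark. 0 < fst a} \<in> sets mark" by measurable
  ultimately show ?thesis unfolding mark_def by (intro AE_pair_measure)
qed

lemma nn_integral_mark:
  assumes "f \<in> borel_measurable mark"
  shows "(\<integral>\<^sup>+a. f a \<partial>mark) = (\<integral>\<^sup>+F. \<integral>\<^sup>+t. ennreal (exponential_density l t) * f (t, F) \<partial>lborel \<partial>measure_pmf steps)"
proof -
  interpret pair_sigma_finite clock "measure_pmf steps" by unfold_locales
  have f: "f \<in> borel_measurable (borel \<Otimes>\<^sub>M count_space UNIV)"
    using assms by (simp add: measurable_cong_sets[OF sets_mark refl])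
  have "(\<integral>\<^sup>+a. f a \<partial>mark) = (\<integral>\<^sup>+F. \<integral>\<^sup>+t. f (t, F) \<partial>clock \<partial>measure_pmf steps)"
    using assms unfolding mark_def by (intro nn_integral_snd[symmetric]) simp
  also have "\<dots> = (\<integral>\<^sup>+F. \<integral>\<^sup>+t. ennreal (exponential_density l t) * f (t, F) \<partial>lborel \<partial>measure_pmf steps)"
  proof (intro nn_integral_cong)
    fix F
    have "(\<lambda>t. f (t, F)) \<in> borel_measurable borel"
      by (rule measurable_compose[OF _ f]) simp
    then show "(\<integral>\<^sup>+t. f (t, F) \<partial>clock) = (\<integral>\<^sup>+t. ennreal (exponential_density l t) * f (t, F) \<partial>lborel)"
      unfolding clock_def by (intro nn_integral_density) auto
  qed
  finally show ?thesis .
qed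

lemma nn_integral_exponential:
  assumes "0 < c"
  shows "(\<integral>\<^sup>+t. ennreal (exponential_density c t) \<partial>lborel) = 1"
proof -
  interpret prob_space "density lborel (exponential_density c)" by (rule prob_space_exponential_density[OF assms])
  show ?thesis using emeasure_space_1 by (simp add: emeasure_density)
qed

text \<open>\<open>l / (l + 1)\<close> is the Laplace transform at 1 of the exponential law of rate
  \<open>l\<close>: the factor \<open>exp (- t)\<close> turns its density into \<open>r\<close>
  times the density of rate \<open>l + 1\<close>. Independent waiting times multiply these
  factors.\<close>

lemma discount:
  defines "r \<equiv> l / (l + 1)"
  shows "(\<integral>\<^sup>+w. ennreal (exp (- jump_time n w)) \<partial>W) = ennreal (r ^ n)"
proof (induction n)
  case 0
  then show ?case using W.emeasure_space_1 by (simp add: space_W)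
next
  case (Suc n)
  have r: "0 \<le> r" using l by (simp add: r_def)
  have [measurable]: "jump_time k \<in> borel_measurable (stream_space mark)" for k
    using measurable_jump_time[of k] by (simp add: W_def)
  have "(\<integral>\<^sup>+w. ennreal (exp (- jump_time (Suc n) w)) \<partial>W) =
      (\<integral>\<^sup>+a. \<integral>\<^sup>+w. ennreal (exp (- jump_time (Suc n) (a ## w))) \<partial>W \<partial>mark)"
    unfolding W_def by (rule mark.nn_integral_stream_space) measurable
  also have "\<dots> = (\<integral>\<^sup>+a. ennreal (exp (- fst a)) * (\<integral>\<^sup>+w. ennreal (exp (- jump_time n w)) \<partial>W) \<partial>mark)"
  proof (rule nn_integral_cong)
    fix a :: "real \<times> ('x \<Rightarrow> 'x)"
    have "(\<integral>\<^sup>+w. ennreal (exp (- jump_time (Suc n) (a ## w))) \<partial>W) =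
        (\<integral>\<^sup>+w. ennreal (exp (- fst a)) * ennreal (exp (- jump_time n w)) \<partial>W)"
      by (intro nn_integral_cong) (simp add: ennreal_mult[symmetric] exp_add[symmetric])
    also have "\<dots> = ennreal (exp (- fst a)) * (\<integral>\<^sup>+w. ennreal (exp (- jump_time n w)) \<partial>W)"
      by (rule nn_integral_cmult) measurable
    finally show "(\<integral>\<^sup>+w. ennreal (exp (- jump_time (Suc n) (a ## w))) \<partial>W) = \<dots>" .
  qed
  also have "\<dots> = (\<integral>\<^sup>+a. ennreal (exp (- fst a)) \<partial>mark) * ennreal (r ^ n)"
    unfolding Suc by (rule nn_integral_multc) measurable
  also have "(\<integral>\<^sup>+a. ennreal (exp (- fst a)) \<partial>mark) = ennreal r"
  proof -
    have "(\<integral>\<^sup>+a. ennreal (exp (- fst a)) \<partial>mark) =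
        (\<integral>\<^sup>+F. \<integral>\<^sup>+t. ennreal r * ennreal (exponential_density (l + 1) t) \<partial>lborel \<partial>measure_pmf steps)"
    proof (subst nn_integral_mark, measurable, intro nn_integral_cong)
      fix t :: real and F :: "'x \<Rightarrow> 'x"
      show "ennreal (exponential_density l t) * ennreal (exp (- fst (t, F))) = ennreal r * ennreal (exponential_density (l + 1) t)"
      proof (cases "t < 0")
        case False
        have "r * ((l + 1) * exp (- t * (l + 1))) = l * exp (- t * (l + 1))"
          using l by (simp add: r_def)
        also have "\<dots> = l * exp (- t * l) * exp (- t)"
          by (simp add: exp_add[symmetric] algebra_simps)
        finally show ?thesis
          using False l r by (simp add: exponential_density_def ennreal_mult[symmetric])
      qed (simp add: exponential_density_def)
    qed
    also have "\<dots> = ennreal r"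
      using l by (simp add: nn_integral_cmult nn_integral_exponential)
    finally show ?thesis .
  qed
  finally show ?case using r by (simp add: ennreal_mult[symmetric])
qed

text \<open>Markov's inequality for \<open>exp (m - jump_time (Suc n) w)\<close>, which is at least
  1 if that jump occurs by time \<open>m\<close>; by \<open>discount\<close> its mean decays
  geometrically in \<open>n\<close>.\<close>

lemma AE_exceeds: "AE w in W. \<exists>n. m < jump_time (Suc n) w"
proof -
  let ?N = "{w \<in> space W. \<forall>n. jump_time (Suc n) w \<le> m}"
  define r where "r = l / (l + 1)"
  have r: "0 \<le> r" "r < 1" using l by (auto simp: r_def)
  have N: "?N \<in> sets W" by measurable
  have "emeasure W ?N \<le> ennreal (exp m * r ^ Suc n)" for n
  proof -
    have "emeasure W ?N = (\<integral>\<^sup>+w. indicator ?N w \<partial>W)" using N by simp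
    also have "\<dots> \<le> (\<integral>\<^sup>+w. ennreal (exp m) * ennreal (exp (- jump_time (Suc n) w)) \<partial>W)"
    proof (rule nn_integral_mono)
      fix w
      have "1 \<le> exp (m - jump_time (Suc n) w)" if "w \<in> ?N"
      proof -
        have "jump_time (Suc n) w \<le> m" using that by blast
        then show ?thesis by (simp del: jump_time.simps)
      qed
      then show "indicator ?N w \<le> ennreal (exp m) * ennreal (exp (- jump_time (Suc n) w))"
        by (auto simp: indicator_def ennreal_mult[symmetric] exp_add[symmetric] simp del: jump_time.simps)
    qed
    also have "\<dots> = ennreal (exp m) * (\<integral>\<^sup>+w. ennreal (exp (- jump_time (Suc n) w)) \<partial>W)"
      by (rule nn_integral_cmult) measurable
    also have "\<dots> = ennreal (exp m * r ^ Suc n)"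
      unfolding discount r_def using l by (subst ennreal_mult[symmetric]) auto
    finally show ?thesis .
  qed
  moreover have "(\<lambda>n. ennreal (exp m * r ^ Suc n)) \<longlonglongrightarrow> ennreal (exp m * 0)"
    using r by (intro tendsto_ennrealI tendsto_mult tendsto_const LIMSEQ_Suc LIMSEQ_realpow_zero)
  ultimately have "emeasure W ?N \<le> ennreal (exp m * 0)"
    by (intro LIMSEQ_le_const) auto
  then have "?N \<in> null_sets W" using N by (simp add: null_sets_def)
  then have "AE w in W. w \<notin> ?N" by (rule AE_not_in)
  then show ?thesis by eventually_elim (auto simp: space_W not_le)
qed

lemma AE_nonexplosive: "AE w in W. nonexplosive w"
proof -
  have "AE w in W. stream_all (\<lambda>a. 0 < fst a) w"
    unfolding W_def by (rule mark.AE_stream_all[OF _ AE_mark_pos]) measurable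
  moreover have "AE w in W. \<forall>m :: nat. \<exists>n. real m < jump_time (Suc n) w"
    unfolding AE_all_countable using AE_exceeds by blast
  ultimately show ?thesis
    by eventually_elim (simp only: nonexplosive_def stream_all_def simp_thms)
qed

lemma memoryless:
  assumes H: "H \<in> borel_measurable mark" and s: "0 \<le> s"
  shows "(\<integral>\<^sup>+a. indicator {s<..} (fst a) * H (fst a - s, snd a) \<partial>mark) = ennreal (exp (- l * s)) * (\<integral>\<^sup>+a. H a \<partial>mark)"
proof -
  have H': "H \<in> borel_measurable (borel \<Otimes>\<^sub>M count_space UNIV)"
    using H by (simp add: measurable_cong_sets[OF sets_mark refl])
  have HF: "(\<lambda>t. H (t - s', F)) \<in> borel_measurable borel" for s' F
    by (rule measurable_compose[OF _ H']) simp
  have "(\<lambda>a. H (fst a - s, snd a)) \<in> borel_measurable (borel \<Otimes>\<^sub>M count_space UNIV)"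
    by (rule measurable_compose[OF _ H']) simp
  then have Hs: "(\<lambda>a. H (fst a - s, snd a)) \<in> borel_measurable mark"
    by (simp add: measurable_cong_sets[OF sets_mark refl])
  have shift: "(\<integral>\<^sup>+t. ennreal (exponential_density l t) * (indicator {s<..} t * H (t - s, F)) \<partial>lborel) =
      ennreal (exp (- l * s)) * (\<integral>\<^sup>+t. ennreal (exponential_density l t) * H (t, F) \<partial>lborel)" for F
  proof -
    have "(\<integral>\<^sup>+t. ennreal (exponential_density l t) * (indicator {s<..} t * H (t - s, F)) \<partial>lborel) =
        (\<integral>\<^sup>+t. ennreal (exponential_density l (s + t)) * (indicator {s<..} (s + t) * H (t, F)) \<partial>lborel)"
      using nn_integral_real_affine[of "\<lambda>t. ennreal (exponential_density l t) * (indicator {s<..} t * H (t - s, F))" 1 s] HF[of s F]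
      by simp
    also have "\<dots> = (\<integral>\<^sup>+t. ennreal (exp (- l * s)) * (ennreal (exponential_density l t) * H (t, F)) \<partial>lborel)"
    proof (rule nn_integral_cong_AE)
      \<comment> \<open>The point \<open>t = 0\<close> has to be removed: there the strict indicator
        vanishes but the exponential density does not.\<close>
      have "AE t in lborel. t \<noteq> (0::real)" by (rule AE_lborel_singleton)
      then show "AE t in lborel. ennreal (exponential_density l (s + t)) * (indicator {s<..} (s + t) * H (t, F)) =
          ennreal (exp (- l * s)) * (ennreal (exponential_density l t) * H (t, F))"
      proof eventually_elim
        case (elim t)
        show ?case
        proof (cases "0 < t")
          case True
          have "exponential_density l (s + t) = exp (- l * s) * exponential_density l t"
            using True s by (simp add: exponential_density_def exp_add[symmetric] algebra_simps)
          then show ?thesis using True l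
            by (simp add: ennreal_mult exponential_density_nonneg mult.assoc)
        next
          case False
          then show ?thesis using elim by (simp add: exponential_density_def indicator_def)
        qed
      qed
    qed
    also have "\<dots> = ennreal (exp (- l * s)) * (\<integral>\<^sup>+t. ennreal (exponential_density l t) * H (t, F) \<partial>lborel)"
      using HF[of 0 F] by (intro nn_integral_cmult) simp
    finally show ?thesis .
  qed
  have "(\<integral>\<^sup>+a. indicator {s<..} (fst a) * H (fst a - s, snd a) \<partial>mark) =
      (\<integral>\<^sup>+F. \<integral>\<^sup>+t. ennreal (exponential_density l t) * (indicator {s<..} t * H (t - s, F)) \<partial>lborel \<partial>measure_pmf steps)"
    using Hs by (subst nn_integral_mark) simp_all
  also have "\<dots> = ennreal (exp (- l * s)) * (\<integral>\<^sup>+a. H a \<partial>mark)"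
    unfolding shift nn_integral_mark[OF H] by (rule nn_integral_cmult) simp
  finally show ?thesis .
qed

end

section \<open>The Markov property of the chain at a fixed time\<close>

context uniformization
begin

definition law_event :: "real \<Rightarrow> 'x \<Rightarrow> (real \<Rightarrow> 'x) set \<Rightarrow> 'x \<Rightarrow> 'x marks set" where
  "law_event s y B x = {w \<in> space W. chain_path x w s = y \<and> time_shift s (chain_path x w) \<in> B}"

definition start_prob :: "'x \<Rightarrow> (real \<Rightarrow> 'x) set \<Rightarrow> ennreal" where
  "start_prob x B = emeasure W {w \<in> space W. chain_path x w \<in> B}"

definition trans_prob :: "real \<Rightarrow> 'x \<Rightarrow> 'x \<Rightarrow> real" where
  "trans_prob s x y = measure W {w \<in> space W. chain_path x w s = y}"

lemma sets_start_event: "B \<in> sets (coord_algebra {0..}) \<Longrightarrow> {w \<in> space W. chain_path x w \<in> B} \<in> sets W"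
  using measurable_sets[OF measurable_chain_path, of B x] by (simp add: vimage_def Int_def conj_commute)

lemma sets_law_event [measurable]:
  assumes s: "0 \<le> s" and B: "B \<in> sets (coord_algebra {0..})"
  shows "law_event s y B x \<in> sets W"
proof -
  have "at_state s y \<inter> (time_shift s -` B \<inter> space (coord_algebra {0..})) \<in> sets (coord_algebra {0..})"
    using s B by (intro sets.Int at_state_in_coord_algebra measurable_sets[OF measurable_time_shift']) auto
  from sets_start_event[OF this, of x] show ?thesis
    by (rule back_subst[where P = "\<lambda>S. S \<in> sets W"])
      (auto simp: law_event_def at_state_def chain_path_in_paths)
qed

lemma law_event_paths:
  assumes "0 \<le> s"
  shows "law_event s y paths x = {w \<in> space W. chain_path x w s = y}"
  using assms by (auto simp: law_event_def time_shift_in_paths chain_path_in_paths)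

lemma paths_sets: "paths \<in> sets (coord_algebra T)"
  using sets.top[of "coord_algebra T"] by simp

lemma sets_state_event: "0 \<le> s \<Longrightarrow> {w \<in> space W. chain_path x w s = y} \<in> sets W"
  using sets_law_event[OF _ paths_sets, of s y x] by (simp add: law_event_paths)

lemma start_prob_paths: "start_prob x paths = 1"
  using W.emeasure_space_1 by (simp add: start_prob_def chain_path_in_paths)

text \<open>The renewal equation \<open>V s x = c s x + E[V (s - T) (F x); T \<le> s]\<close> for a
  first mark \<open>(T, F)\<close>. Joint measurability of \<open>V\<close> is not at hand, so the
  integrand is represented by a measurable \<open>J\<close> that equals it almost
  everywhere.\<close>

definition renewal_solution :: "(real \<Rightarrow> 'x \<Rightarrow> ennreal) \<Rightarrow> (real \<Rightarrow> 'x \<Rightarrow> ennreal) \<Rightarrow> bool" where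
  "renewal_solution V c \<longleftrightarrow> (\<forall>s\<ge>0. \<forall>x. \<exists>J\<in>borel_measurable mark.
     (AE a in mark. J a = (if fst a \<le> s then V (s - fst a) (snd a x) else 0)) \<and>
     V s x = c s x + (\<integral>\<^sup>+a. J a \<partial>mark))"

lemma nn_integral_clock_gt: "0 \<le> s \<Longrightarrow> (\<integral>\<^sup>+a. indicator {s<..} (fst a) \<partial>mark) = ennreal (exp (- l * s))"
  using memoryless[of "\<lambda>_. 1" s] mark.emeasure_space_1 by simp

lemma nn_integral_clock_le:
  assumes "0 \<le> s"
  shows "(\<integral>\<^sup>+a. indicator {..s} (fst a) \<partial>mark) = ennreal (1 - exp (- l * s))"
proof -
  have "(\<integral>\<^sup>+a. indicator {..s} (fst a) \<partial>mark) + (\<integral>\<^sup>+a. indicator {s<..} (fst a) \<partial>mark) =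
      (\<integral>\<^sup>+a. indicator {..s} (fst a) + indicator {s<..} (fst a) \<partial>mark)"
    by (rule nn_integral_add[symmetric]) measurable
  also have "\<dots> = (\<integral>\<^sup>+a. 1 \<partial>mark)"
    by (intro nn_integral_cong) (auto simp: indicator_def)
  also have "\<dots> = 1" using mark.emeasure_space_1 by simp
  finally have "(\<integral>\<^sup>+a. indicator {..s} (fst a) \<partial>mark) + ennreal (exp (- l * s)) = 1"
    using nn_integral_clock_gt[OF assms] by simp
  then have "(\<integral>\<^sup>+a. indicator {..s} (fst a) \<partial>mark) = 1 - ennreal (exp (- l * s))"
    by (metis ennreal_add_diff_cancel_right ennreal_neq_top)
  then show ?thesis using l assms by (simp add: ennreal_minus[symmetric] ennreal_1[symmetric] del: ennreal_1)
qed

text \<open>On \<open>[0, T]\<close> the renewal operator is a contraction with factor \<open>1 - exp (- l T)\<close>.\<close>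

lemma renewal_solution_le:
  assumes V1: "renewal_solution V1 c" and V2: "renewal_solution V2 c"
    and le1: "\<And>s x. 0 \<le> s \<Longrightarrow> V1 s x \<le> 1" and s: "0 \<le> s"
  shows "V1 s x \<le> V2 s x"
proof -
  define T where "T = s"
  define q where "q = 1 - exp (- l * T)"
  have q: "0 \<le> q" "q < 1" using s l by (auto simp: q_def T_def)
  \<comment> \<open>The error is a summand on the right because subtraction in
    \<open>ennreal\<close> is truncated; the start \<open>n = 0\<close> uses that \<open>V1\<close>
    is at most 1.\<close>
  have bound: "V1 s x \<le> V2 s x + ennreal (q ^ n)" if "0 \<le> s" "s \<le> T" for n s x
    using that
  proof (induction n arbitrary: s x)
    case 0
    have "V1 s x \<le> 1" using le1 0 by simp
    also have "\<dots> \<le> V2 s x + 1" by simp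
    finally show ?case by simp
  next
    case (Suc n)
    obtain J1 where J1[measurable]: "J1 \<in> borel_measurable mark"
      and J1_eq: "AE a in mark. J1 a = (if fst a \<le> s then V1 (s - fst a) (snd a x) else 0)"
      and V1_eq: "V1 s x = c s x + (\<integral>\<^sup>+a. J1 a \<partial>mark)"
      using V1 Suc.prems(1) unfolding renewal_solution_def by meson
    obtain J2 where J2[measurable]: "J2 \<in> borel_measurable mark"
      and J2_eq: "AE a in mark. J2 a = (if fst a \<le> s then V2 (s - fst a) (snd a x) else 0)"
      and V2_eq: "V2 s x = c s x + (\<integral>\<^sup>+a. J2 a \<partial>mark)"
      using V2 Suc.prems(1) unfolding renewal_solution_def by meson
    have "(\<integral>\<^sup>+a. J1 a \<partial>mark) \<le> (\<integral>\<^sup>+a. J2 a + ennreal (q ^ n) * indicator {..T} (fst a) \<partial>mark)"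
    proof (rule nn_integral_mono_AE)
      show "AE a in mark. J1 a \<le> J2 a + ennreal (q ^ n) * indicator {..T} (fst a)"
        using J1_eq J2_eq AE_mark_pos
      proof eventually_elim
        case (elim a)
        show ?case
        proof (cases "fst a \<le> s")
          case True
          then have "V1 (s - fst a) (snd a x) \<le> V2 (s - fst a) (snd a x) + ennreal (q ^ n)"
            using elim(3) Suc.prems by (intro Suc.IH) auto
          then show ?thesis using True elim Suc.prems by simp
        qed (use elim in simp)
      qed
    qed
    also have "\<dots> = (\<integral>\<^sup>+a. J2 a \<partial>mark) + ennreal (q ^ n) * (\<integral>\<^sup>+a. indicator {..T} (fst a) \<partial>mark)"
      by (subst nn_integral_add) (auto intro: nn_integral_cmult)
    also have "ennreal (q ^ n) * (\<integral>\<^sup>+a. indicator {..T} (fst a) \<partial>mark) = ennreal (q ^ Suc n)"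
    proof -
      have "(\<integral>\<^sup>+a. indicator {..T} (fst a) \<partial>mark) = ennreal q"
        unfolding q_def using Suc.prems by (intro nn_integral_clock_le) simp
      then show ?thesis using q by (simp add: ennreal_mult[symmetric] mult.commute)
    qed
    finally show ?case unfolding V1_eq V2_eq by (simp add: add.assoc add_left_mono)
  qed
  have "(\<lambda>n. V2 s x + ennreal (q ^ n)) \<longlonglongrightarrow> V2 s x + ennreal 0"
    using q by (intro tendsto_add tendsto_const tendsto_ennrealI LIMSEQ_realpow_zero)
  then have "V1 s x \<le> V2 s x + ennreal 0"
    by (rule LIMSEQ_le_const) (use bound[OF s] in \<open>auto simp: T_def\<close>)
  then show ?thesis by simp
qed

text \<open>Conditioning on the first mark. A jump by time \<open>s\<close> leaves the same problem
  for the remaining stream, with time \<open>s - fst a\<close> and state \<open>snd a x\<close>.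
  Otherwise the state is still \<open>x\<close>, and the future is driven by the stream with a
  shortened first wait, whose law is the original one by memorylessness.\<close>

lemma law_renewal:
  assumes B: "B \<in> sets (coord_algebra {0..})"
  shows "renewal_solution (\<lambda>s x. emeasure W (law_event s y B x))
    (\<lambda>s x. ennreal (exp (- l * s)) * (if x = y then start_prob x B else 0))"
  unfolding renewal_solution_def
proof (intro allI impI)
  fix s :: real and x assume s: "0 \<le> s"
  define E where "E = law_event s y B x"
  define F where "F = {w \<in> space W. chain_path x w \<in> B}"
  have [measurable]: "E \<in> sets (stream_space mark)"
    using sets_law_event[OF s B, of y x] by (simp add: E_def W_def)
  have [measurable]: "F \<in> sets (stream_space mark)"
    using sets_start_event[OF B, of x] by (simp add: F_def W_def)
  interpret S: sigma_finite_measure "stream_space mark"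
    using W.sigma_finite_measure_axioms by (simp add: W_def)
  define K where "K a = (\<integral>\<^sup>+w. indicator E (a ## w) \<partial>W)" for a
  define H where "H a = (\<integral>\<^sup>+w. indicator F (a ## w) \<partial>W)" for a
  have K[measurable]: "K \<in> borel_measurable mark" unfolding K_def[abs_def] W_def by measurable
  have H[measurable]: "H \<in> borel_measurable mark" unfolding H_def[abs_def] W_def by measurable
  have VK: "emeasure W (law_event s y B x) = (\<integral>\<^sup>+a. K a \<partial>mark)"
    using mark.nn_integral_stream_space[of "indicator E"] unfolding K_def W_def E_def[symmetric] by simp
  have FH: "start_prob x B = (\<integral>\<^sup>+a. H a \<partial>mark)"
    using mark.nn_integral_stream_space[of "indicator F"] unfolding H_def W_def start_prob_def F_def[symmetric, unfolded W_def] by simp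
  define J where "J a = indicator {..s} (fst a) * K a" for a
  have J[measurable]: "J \<in> borel_measurable mark" unfolding J_def[abs_def] by measurable
  have early: "AE a in mark. J a = (if fst a \<le> s then emeasure W (law_event (s - fst a) y B (snd a x)) else 0)"
    using AE_mark_pos
  proof eventually_elim
    case (elim a)
    show ?case
    proof (cases "fst a \<le> s")
      case True
      have "K a = (\<integral>\<^sup>+w. indicator (law_event (s - fst a) y B (snd a x)) w \<partial>W)"
        unfolding K_def
      proof (rule nn_integral_cong_AE)
        show "AE w in W. indicator E (a ## w) = (indicator (law_event (s - fst a) y B (snd a x)) w :: ennreal)"
          using AE_nonexplosive
        proof eventually_elim
          case (elim w)
          then have a: "nonexplosive (a ## w)" using \<open>0 < fst a\<close> by (simp add: nonexplosive_Stream)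
          show ?case
            using True s chain_path_Stream[OF a s, of x] time_shift_chain_path(1)[OF a s True, of x]
            by (simp add: E_def law_event_def space_W indicator_def)
        qed
      qed
      also have "\<dots> = emeasure W (law_event (s - fst a) y B (snd a x))"
        using True B by (intro nn_integral_indicator sets_law_event) auto
      finally show ?thesis using True by (simp add: J_def)
    qed (simp add: J_def)
  qed
  have late: "AE a in mark. indicator {s<..} (fst a) * K a =
      (if x = y then 1 else 0) * (indicator {s<..} (fst a) * H (fst a - s, snd a))"
    using AE_mark_pos
  proof eventually_elim
    case (elim a)
    show ?case
    proof (cases "s < fst a")
      case True
      have "K a = (\<integral>\<^sup>+w. (if x = y then 1 else 0) * indicator F ((fst a - s, snd a) ## w) \<partial>W)"
        unfolding K_def
      proof (rule nn_integral_cong_AE)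
        show "AE w in W. indicator E (a ## w) = (if x = y then 1 else 0) * (indicator F ((fst a - s, snd a) ## w) :: ennreal)"
          using AE_nonexplosive
        proof eventually_elim
          case (elim w)
          then have a: "nonexplosive (a ## w)" using \<open>0 < fst a\<close> by (simp add: nonexplosive_Stream)
          show ?case
            using True s chain_path_Stream[OF a s, of x] time_shift_chain_path(2)[OF a s True, of x]
            by (simp add: E_def F_def law_event_def space_W indicator_def)
        qed
      qed
      then show ?thesis by (cases "x = y") (simp_all add: H_def)
    qed simp
  qed
  have "(\<integral>\<^sup>+a. K a \<partial>mark) = (\<integral>\<^sup>+a. indicator {s<..} (fst a) * K a + J a \<partial>mark)"
    by (intro nn_integral_cong) (auto simp: J_def indicator_def)
  also have "\<dots> = (\<integral>\<^sup>+a. indicator {s<..} (fst a) * K a \<partial>mark) + (\<integral>\<^sup>+a. J a \<partial>mark)"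
    by (rule nn_integral_add) measurable
  also have "(\<integral>\<^sup>+a. indicator {s<..} (fst a) * K a \<partial>mark) =
      (\<integral>\<^sup>+a. (if x = y then 1 else 0) * (indicator {s<..} (fst a) * H (fst a - s, snd a)) \<partial>mark)"
    by (rule nn_integral_cong_AE) (rule late)
  also have "\<dots> = ennreal (exp (- l * s)) * (if x = y then start_prob x B else 0)"
    using memoryless[OF H s] by (cases "x = y") (simp_all add: FH[symmetric])
  finally show "\<exists>J\<in>borel_measurable mark.
      (AE a in mark. J a = (if fst a \<le> s then emeasure W (law_event (s - fst a) y B (snd a x)) else 0)) \<and>
      emeasure W (law_event s y B x) =
        ennreal (exp (- l * s)) * (if x = y then start_prob x B else 0) + (\<integral>\<^sup>+a. J a \<partial>mark)"
    using J early VK by (intro bexI[of _ J]) auto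
qed

lemma emeasure_state_event: "emeasure W {w \<in> space W. chain_path x w s = y} = ennreal (trans_prob s x y)"
  by (simp add: trans_prob_def W.emeasure_eq_measure)

text \<open>The Markov property at time \<open>s\<close>. For fixed \<open>y\<close> and
  \<open>B\<close> both sides solve the same renewal equation, the right one being the solution for
  \<open>B = paths\<close> multiplied by the constant \<open>start_prob y B\<close>; uniqueness
  concludes.\<close>

lemma law_event_prob:
  assumes B: "B \<in> sets (coord_algebra {0..})" and s: "0 \<le> s"
  shows "emeasure W (law_event s y B x) = ennreal (trans_prob s x y) * start_prob y B"
proof -
  let ?V1 = "\<lambda>s x. emeasure W (law_event s y B x)"
  let ?V2 = "\<lambda>s x. emeasure W (law_event s y paths x) * start_prob y B"
  let ?c = "\<lambda>s x. ennreal (exp (- l * s)) * (if x = y then start_prob x B else 0)"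
  have V1: "renewal_solution ?V1 ?c" by (rule law_renewal[OF B])
  have V2: "renewal_solution ?V2 ?c"
    unfolding renewal_solution_def
  proof (intro allI impI)
    fix s :: real and x assume s: "0 \<le> s"
    obtain J where J[measurable]: "J \<in> borel_measurable mark"
      and eq: "AE a in mark. J a = (if fst a \<le> s then emeasure W (law_event (s - fst a) y paths (snd a x)) else 0)"
      and V: "emeasure W (law_event s y paths x) = ennreal (exp (- l * s)) * (if x = y then start_prob x paths else 0) + (\<integral>\<^sup>+a. J a \<partial>mark)"
      using law_renewal[OF paths_sets, of y] s unfolding renewal_solution_def by meson
    show "\<exists>J\<in>borel_measurable mark.
      (AE a in mark. J a = (if fst a \<le> s then emeasure W (law_event (s - fst a) y paths (snd a x)) * start_prob y B else 0)) \<and>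
      emeasure W (law_event s y paths x) * start_prob y B = ?c s x + (\<integral>\<^sup>+a. J a \<partial>mark)"
    proof (intro bexI[of _ "\<lambda>a. J a * start_prob y B"] conjI)
      show "AE a in mark. J a * start_prob y B = (if fst a \<le> s then emeasure W (law_event (s - fst a) y paths (snd a x)) * start_prob y B else 0)"
        using eq by eventually_elim simp
      show "emeasure W (law_event s y paths x) * start_prob y B = ?c s x + (\<integral>\<^sup>+a. J a * start_prob y B \<partial>mark)"
        unfolding V nn_integral_multc[OF J] by (simp add: distrib_right start_prob_paths)
    qed measurable
  qed
  have b1: "?V1 s x \<le> 1" for s x by (rule W.emeasure_le_1)
  have b2: "?V2 s x \<le> 1" for s x
    using mult_mono[OF W.emeasure_le_1 W.emeasure_le_1] by (simp add: start_prob_def)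
  have "?V1 s x = ?V2 s x"
    by (intro order.antisym renewal_solution_le[OF V1 V2 b1 s] renewal_solution_le[OF V2 V1 b2 s])
  then show ?thesis using s by (simp add: law_event_paths emeasure_state_event)
qed

lemma trans_prob_nonneg [simp]: "0 \<le> trans_prob s x y"
  by (simp add: trans_prob_def)

lemma sum_trans_prob:
  assumes "0 \<le> s"
  shows "(\<Sum>y\<in>UNIV. trans_prob s x y) = 1"
proof -
  have "(\<Sum>y\<in>UNIV. trans_prob s x y) = measure W (\<Union>y\<in>UNIV. {w \<in> space W. chain_path x w s = y})"
    unfolding trans_prob_def using sets_state_event[OF assms]
    by (intro W.finite_measure_finite_Union[symmetric]) (auto simp: disjoint_family_on_def)
  also have "(\<Union>y\<in>UNIV. {w \<in> space W. chain_path x w s = y}) = space W" by auto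
  finally show ?thesis by (simp add: W.prob_space)
qed

lemma trans_prob_0: "trans_prob 0 x y = (if y = x then 1 else 0)"
  using W.prob_space by (auto simp: trans_prob_def chain_path_0)

text \<open>\<open>law_event_prob\<close> for the event that the shifted path is in \<open>z\<close>
  at time \<open>t\<close>, summed over the state at time \<open>s\<close>.\<close>

lemma trans_prob_add:
  assumes s: "0 \<le> s" and t: "0 \<le> t"
  shows "trans_prob (s + t) x z = (\<Sum>y\<in>UNIV. trans_prob s x y * trans_prob t y z)"
proof -
  have B: "at_state t z \<in> sets (coord_algebra {0..})" using t by (simp add: at_state_in_coord_algebra)
  have *: "measure W (law_event s y (at_state t z) x) = trans_prob s x y * trans_prob t y z" for y
  proof -
    have "start_prob y (at_state t z) = ennreal (trans_prob t y z)"
      unfolding start_prob_def emeasure_state_event[symmetric]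
      by (rule arg_cong[where f = "emeasure W"]) (auto simp: at_state_def chain_path_in_paths)
    then show ?thesis
      using law_event_prob[OF B s, of y x] by (simp add: measure_def ennreal_mult[symmetric])
  qed
  have "time_shift s (chain_path x w) \<in> at_state t z \<longleftrightarrow> chain_path x w (s + t) = z" for w
  proof -
    have "time_shift s (chain_path x w) \<in> paths" by (intro time_shift_in_paths chain_path_in_paths s)
    then show ?thesis using t by (simp add: at_state_def) (simp add: time_shift_def)
  qed
  then have "{w \<in> space W. chain_path x w (s + t) = z} = (\<Union>y\<in>UNIV. law_event s y (at_state t z) x)"
    by (auto simp: law_event_def)
  then have "trans_prob (s + t) x z = measure W (\<Union>y\<in>UNIV. law_event s y (at_state t z) x)"
    by (simp add: trans_prob_def)
  also have "\<dots> = (\<Sum>y\<in>UNIV. measure W (law_event s y (at_state t z) x))"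
    using sets_law_event[OF s B] by (intro W.finite_measure_finite_Union) (auto simp: disjoint_family_on_def law_event_def)
  finally show ?thesis by (simp add: *)
qed

lemma trans_prob_renewal_equation:
  assumes s: "0 \<le> s"
  obtains J where "J \<in> borel_measurable mark"
    and "AE a in mark. J a = (if fst a \<le> s then ennreal (trans_prob (s - fst a) (snd a x) y) else 0)"
    and "ennreal (trans_prob s x y) = ennreal (exp (- l * s)) * (if x = y then 1 else 0) + (\<integral>\<^sup>+a. J a \<partial>mark)"
proof -
  obtain J where J: "J \<in> borel_measurable mark"
    and eq: "AE a in mark. J a = (if fst a \<le> s then emeasure W (law_event (s - fst a) y paths (snd a x)) else 0)"
    and V: "emeasure W (law_event s y paths x) = ennreal (exp (- l * s)) * (if x = y then start_prob x paths else 0) + (\<integral>\<^sup>+a. J a \<partial>mark)"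
    using law_renewal[OF paths_sets, of y] s unfolding renewal_solution_def by meson
  show ?thesis
  proof (rule that[OF J])
    show "AE a in mark. J a = (if fst a \<le> s then ennreal (trans_prob (s - fst a) (snd a x) y) else 0)"
      using eq by eventually_elim (simp add: law_event_paths emeasure_state_event)
    show "ennreal (trans_prob s x y) = ennreal (exp (- l * s)) * (if x = y then 1 else 0) + (\<integral>\<^sup>+a. J a \<partial>mark)"
      using V s by (simp add: law_event_paths emeasure_state_event start_prob_paths)
  qed
qed

text \<open>The first term of the renewal equation, which stands for no jump by time
  \<open>s\<close>, is already this large.\<close>

lemma trans_prob_diag_ge:
  assumes s: "0 \<le> s"
  shows "exp (- l * s) \<le> trans_prob s x x"
proof -
  obtain J where "J \<in> borel_measurable mark"
      "AE a in mark. J a = (if fst a \<le> s then ennreal (trans_prob (s - fst a) (snd a x) x) else 0)"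
      "ennreal (trans_prob s x x) = ennreal (exp (- l * s)) * (if x = x then 1 else 0) + (\<integral>\<^sup>+a. J a \<partial>mark)"
    using trans_prob_renewal_equation[OF s, of x x] .
  then have "ennreal (exp (- l * s)) \<le> ennreal (trans_prob s x x)" by simp
  then show ?thesis by (simp add: ennreal_le_iff)
qed

lemma trans_prob_off_diag_le:
  assumes s: "0 \<le> s" and "y \<noteq> x"
  shows "trans_prob s x y \<le> 1 - exp (- l * s)"
proof -
  have "trans_prob s x x + trans_prob s x y \<le> (\<Sum>z\<in>UNIV. trans_prob s x z)"
    using sum_mono2[of UNIV "{x, y}" "trans_prob s x"] \<open>y \<noteq> x\<close> by simp
  then show ?thesis using sum_trans_prob[OF s, of x] trans_prob_diag_ge[OF s, of x] by linarith
qed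

text \<open>Waiting time and map are independent components of a mark, and the map evaluated at
  \<open>x\<close> is distributed as \<open>jump x\<close>.\<close>

lemma first_jump_prob:
  assumes d: "0 \<le> d"
  shows "(\<integral>\<^sup>+a. indicator {..d} (fst a) * indicator {y} (snd a x) \<partial>mark) =
    ennreal ((1 - exp (- l * d)) * pmf (jump x) y)"
proof -
  have "(\<integral>\<^sup>+a. indicator {..d} (fst a) * indicator {y} (snd a x) \<partial>mark) =
      (\<integral>\<^sup>+a. indicator ({..d} \<times> {F. F x = y}) a \<partial>mark)"
  proof (rule nn_integral_cong)
    show "indicator {..d} (fst a) * indicator {y} (snd a x) = (indicator ({..d} \<times> {F. F x = y}) a :: ennreal)" for a
      by (cases a) (simp add: indicator_def)
  qed
  also have "\<dots> = emeasure mark ({..d} \<times> {F. F x = y})"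
    by (rule nn_integral_indicator) (unfold sets_mark, rule pair_measureI, simp_all)
  also have "\<dots> = emeasure clock {..d} * emeasure (measure_pmf steps) {F. F x = y}"
    unfolding mark_def by (rule measure_pmf.emeasure_pair_measure_Times) (simp_all add: sets_clock)
  also have "emeasure clock {..d} = ennreal (1 - exp (- l * d))"
  proof -
    have "ennreal (1 - exp (- l * d)) = (\<integral>\<^sup>+a. indicator ({..d} \<times> UNIV) a \<partial>mark)"
      unfolding nn_integral_clock_le[OF d, symmetric]
    proof (rule nn_integral_cong)
      show "indicator {..d} (fst a) = (indicator ({..d} \<times> UNIV) a :: ennreal)" for a :: "real \<times> ('x \<Rightarrow> 'x)"
        by (cases a) (simp add: indicator_def)
    qed
    also have "\<dots> = emeasure mark ({..d} \<times> UNIV)"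
      by (rule nn_integral_indicator) (unfold sets_mark, rule pair_measureI, simp_all)
    also have "\<dots> = emeasure clock {..d} * emeasure (measure_pmf steps) UNIV"
      unfolding mark_def by (rule measure_pmf.emeasure_pair_measure_Times) (simp_all add: sets_clock)
    finally show ?thesis using measure_pmf.emeasure_space_1[of steps] by simp
  qed
  also have "emeasure (measure_pmf steps) {F. F x = y} = ennreal (pmf (jump x) y)"
  proof -
    have "pmf (jump x) y = pmf (map_pmf (\<lambda>F. F x) steps) y"
      unfolding steps_def by (simp add: Pi_pmf_component)
    also have "\<dots> = measure (measure_pmf steps) {F. F x = y}" by (simp add: pmf_map vimage_def)
    finally show ?thesis by (simp add: measure_pmf.emeasure_eq_measure)
  qed
  also have "ennreal (1 - exp (- l * d)) * ennreal (pmf (jump x) y) = ennreal ((1 - exp (- l * d)) * pmf (jump x) y)"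
    using l d by (intro ennreal_mult[symmetric]) simp_all
  finally show ?thesis .
qed

text \<open>Up to the probability of two jumps, the first jump determines the transition.\<close>

lemma trans_prob_first_order:
  assumes d: "0 \<le> d"
  defines "\<theta> \<equiv> 1 - exp (- l * d)"
  shows "\<bar>trans_prob d x y - ((1 - \<theta>) * (if x = y then 1 else 0) + \<theta> * pmf (jump x) y)\<bar> \<le> \<theta>\<^sup>2"
proof -
  have th: "0 \<le> \<theta>" "\<theta> \<le> 1" using l d by (auto simp: \<theta>_def)
  obtain J where J[measurable]: "J \<in> borel_measurable mark"
    and J_eq: "AE a in mark. J a = (if fst a \<le> d then ennreal (trans_prob (d - fst a) (snd a x) y) else 0)"
    and eq: "ennreal (trans_prob d x y) = ennreal (exp (- l * d)) * (if x = y then 1 else 0) + (\<integral>\<^sup>+a. J a \<partial>mark)"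
    using trans_prob_renewal_equation[OF d, of x y] .
  define one where "one a = (indicator {..d} (fst a) * indicator {y} (snd a x) :: ennreal)" for a :: "real \<times> ('x \<Rightarrow> 'x)"
  have one[measurable]: "one \<in> borel_measurable mark" unfolding one_def[abs_def] by measurable
  have int_one: "(\<integral>\<^sup>+a. one a \<partial>mark) = ennreal (\<theta> * pmf (jump x) y)"
    unfolding one_def \<theta>_def by (rule first_jump_prob[OF d])
  have int_err: "(\<integral>\<^sup>+a. ennreal \<theta> * indicator {..d} (fst a) \<partial>mark) = ennreal (\<theta>\<^sup>2)"
  proof -
    have "(\<integral>\<^sup>+a. indicator {..d} (fst a) \<partial>mark) = ennreal \<theta>"
      unfolding \<theta>_def by (rule nn_integral_clock_le[OF d])
    then show ?thesis
      using th by (subst nn_integral_cmult) (auto simp: ennreal_mult[symmetric] power2_eq_square)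
  qed
  \<comment> \<open>After a first jump by time \<open>d\<close> the remaining time \<open>r\<close>
    is at most \<open>d\<close>, and a further jump has probability at most \<open>\<theta>\<close>.
    Integrating this over the event of a first jump, itself of probability \<open>\<theta>\<close>,
    produces the error \<open>\<theta>\<^sup>2\<close>.\<close>
  have close: "trans_prob r z y \<le> indicator {y} z + \<theta>" "indicator {y} z \<le> trans_prob r z y + \<theta>"
    if r: "0 \<le> r" "r \<le> d" for r z
  proof -
    have er: "1 - exp (- l * r) \<le> \<theta>" using r l by (simp add: \<theta>_def)
    have "trans_prob r z z \<le> 1" by (simp add: trans_prob_def)
    then show "trans_prob r z y \<le> indicator {y} z + \<theta>"
      using trans_prob_off_diag_le[OF r(1), of y z] er th by (cases "y = z") auto
    show "indicator {y} z \<le> trans_prob r z y + \<theta>"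
      using trans_prob_diag_ge[OF r(1), of z] er th by (cases "y = z") auto
  qed
  have "(\<integral>\<^sup>+a. J a \<partial>mark) \<le> (\<integral>\<^sup>+a. one a + ennreal \<theta> * indicator {..d} (fst a) \<partial>mark)"
  proof (rule nn_integral_mono_AE)
    show "AE a in mark. J a \<le> one a + ennreal \<theta> * indicator {..d} (fst a)"
      using J_eq AE_mark_pos
    proof eventually_elim
      case (elim a)
      show ?case
      proof (cases "fst a \<le> d")
        case True
        have "ennreal (trans_prob (d - fst a) (snd a x) y) \<le> ennreal (indicator {y} (snd a x) + \<theta>)"
          using close(1)[of "d - fst a" "snd a x"] True elim(2) by (intro ennreal_leI) auto
        also have "\<dots> = one a + ennreal \<theta> * indicator {..d} (fst a)"
          using True th by (simp add: one_def ennreal_plus ennreal_indicator)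
        finally show ?thesis using True elim(1) by simp
      qed (use elim in simp)
    qed
  qed
  then have J_le: "(\<integral>\<^sup>+a. J a \<partial>mark) \<le> ennreal (\<theta> * pmf (jump x) y) + ennreal (\<theta>\<^sup>2)"
    using int_one int_err by (subst (asm) nn_integral_add) auto
  have "(\<integral>\<^sup>+a. one a \<partial>mark) \<le> (\<integral>\<^sup>+a. J a + ennreal \<theta> * indicator {..d} (fst a) \<partial>mark)"
  proof (rule nn_integral_mono_AE)
    show "AE a in mark. one a \<le> J a + ennreal \<theta> * indicator {..d} (fst a)"
      using J_eq AE_mark_pos
    proof eventually_elim
      case (elim a)
      show ?case
      proof (cases "fst a \<le> d")
        case True
        have "one a = ennreal (indicator {y} (snd a x))" using True by (simp add: one_def ennreal_indicator)
        also have "\<dots> \<le> ennreal (trans_prob (d - fst a) (snd a x) y + \<theta>)"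
          using close(2)[of "d - fst a" "snd a x"] True elim(2) by (intro ennreal_leI) auto
        also have "\<dots> = J a + ennreal \<theta> * indicator {..d} (fst a)"
          using True th elim(1) by (simp add: ennreal_plus)
        finally show ?thesis .
      qed (simp add: one_def)
    qed
  qed
  then have J_ge: "ennreal (\<theta> * pmf (jump x) y) \<le> (\<integral>\<^sup>+a. J a \<partial>mark) + ennreal (\<theta>\<^sup>2)"
    using int_one int_err by (subst (asm) nn_integral_add) auto
  define \<delta> :: real where "\<delta> = (1 - \<theta>) * (if x = y then 1 else 0)"
  have \<delta>: "0 \<le> \<delta>" using th by (simp add: \<delta>_def)
  have "ennreal (exp (- l * d)) * (if x = y then 1 else 0) = ennreal \<delta>" by (simp add: \<delta>_def \<theta>_def)
  then have eq': "ennreal (trans_prob d x y) = ennreal \<delta> + (\<integral>\<^sup>+a. J a \<partial>mark)" using eq by simp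
  have thp: "0 \<le> \<theta> * pmf (jump x) y" using th by simp
  have "ennreal (trans_prob d x y) \<le> ennreal (\<delta> + (\<theta> * pmf (jump x) y + \<theta>\<^sup>2))"
    unfolding eq' using J_le \<delta> thp by (simp add: ennreal_plus add_left_mono)
  then have "trans_prob d x y \<le> \<delta> + (\<theta> * pmf (jump x) y + \<theta>\<^sup>2)"
    using \<delta> thp by (subst (asm) ennreal_le_iff) auto
  moreover have "ennreal (\<delta> + \<theta> * pmf (jump x) y) \<le> ennreal (trans_prob d x y + \<theta>\<^sup>2)"
    using J_ge \<delta> thp eq' by (simp add: ennreal_plus add.assoc add_left_mono)
  then have "\<delta> + \<theta> * pmf (jump x) y \<le> trans_prob d x y + \<theta>\<^sup>2"
    by (subst (asm) ennreal_le_iff) auto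
  ultimately show ?thesis unfolding \<delta>_def[symmetric] by linarith
qed

end

section \<open>The transition semigroup as a matrix exponential\<close>

lemma entry_bound:
  fixes Q :: "real ^ 'x ^ 'x::finite"
  obtains b where "0 < b" "\<forall>x y. \<bar>Q $ x $ y\<bar> \<le> b"
proof (rule rate_matrix_bounded[OF compact_sing[of Q]])
  fix b :: real assume b: "0 < b" "\<And>R x y. R \<in> {Q} \<Longrightarrow> \<bar>R $ x $ y\<bar> \<le> b"
  show thesis by (rule that[of b]) (simp_all add: b)
qed

lemma infnorm_matrix_mult_le:
  fixes M :: "real ^ 'x ^ 'x::finite"
  shows "infnorm (M *v g) \<le> real CARD('x) * norm M * infnorm g"
proof (rule infnorm_le_cartI)
  fix x
  have "\<bar>(M *v g) $ x\<bar> \<le> (\<Sum>y\<in>UNIV. \<bar>M $ x $ y * g $ y\<bar>)" unfolding mult_vec_nth by (rule sum_abs)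
  also have "\<dots> \<le> (\<Sum>y\<in>(UNIV :: 'x set). norm M * infnorm g)"
  proof (rule sum_mono)
    fix y
    have "\<bar>M $ x $ y\<bar> \<le> norm M"
      using component_le_norm_cart[of "M $ x" y] Finite_Cartesian_Product.norm_nth_le[of M x] by linarith
    then show "\<bar>M $ x $ y * g $ y\<bar> \<le> norm M * infnorm g"
      using component_le_infnorm_cart[of g y] unfolding abs_mult by (intro mult_mono) auto
  qed
  finally show "\<bar>(M *v g) $ x\<bar> \<le> real CARD('x) * norm M * infnorm g" by simp
qed

context uniformization
begin

definition trans_matrix :: "real \<Rightarrow> real ^ 'x ^ 'x" where
  "trans_matrix t = (\<chi> x y. trans_prob t x y)"

text \<open>To first order \<open>trans_matrix d - mat 1\<close> is \<open>\<theta> d\<close> times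
  \<open>Q / l\<close>, and \<open>\<theta> d / d\<close> tends to \<open>l\<close>, which cancels
  the denominator. The remainder \<open>(\<theta> d)\<^sup>2\<close> disappears after division by
  \<open>d\<close>.\<close>

lemma trans_matrix_derivative: "((\<lambda>d. (1 / d) *\<^sub>R (trans_matrix d - mat 1)) \<longlongrightarrow> Q) (at_right 0)"
proof (intro vec_tendstoI)
  fix x y
  define \<theta> where "\<theta> d = 1 - exp (- l * d)" for d
  have "(\<theta> has_field_derivative l) (at 0)"
    unfolding \<theta>_def[abs_def] by (auto intro!: derivative_eq_intros)
  then have "((\<lambda>d. \<theta> d / d) \<longlongrightarrow> l) (at 0)"
    by (simp add: DERIV_def \<theta>_def)
  then have rate_lim: "((\<lambda>d. \<theta> d / d) \<longlongrightarrow> l) (at_right 0)"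
    by (rule tendsto_mono[rotated]) (simp add: at_le)
  have "(\<theta> \<longlongrightarrow> 1 - exp (- l * 0)) (at_right 0)"
    unfolding \<theta>_def[abs_def] by (intro tendsto_intros)
  then have "((\<lambda>d. \<theta> d / d * \<theta> d) \<longlongrightarrow> l * 0) (at_right 0)"
    by (intro tendsto_mult rate_lim) simp
  then have err: "((\<lambda>d. \<theta> d / d * \<theta> d) \<longlongrightarrow> 0) (at_right 0)" by simp
  have "((\<lambda>d. ((1 / d) *\<^sub>R (trans_matrix d - mat 1)) $ x $ y - \<theta> d / d * (Q $ x $ y / l)) \<longlongrightarrow> 0) (at_right 0)"
  proof (rule Lim_null_comparison[OF _ err])
    show "\<forall>\<^sub>F d in at_right 0. norm (((1 / d) *\<^sub>R (trans_matrix d - mat 1)) $ x $ y - \<theta> d / d * (Q $ x $ y / l)) \<le> \<theta> d / d * \<theta> d"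
      using eventually_at_right_less[of "0::real"]
    proof eventually_elim
      case (elim d)
      have "\<bar>trans_prob d x y - ((1 - \<theta> d) * (if x = y then 1 else 0) + \<theta> d * pmf (jump x) y)\<bar> \<le> (\<theta> d)\<^sup>2"
        unfolding \<theta>_def using elim by (intro trans_prob_first_order) simp
      moreover have "(1 - \<theta> d) * (if x = y then 1 else 0) + \<theta> d * pmf (jump x) y =
          (if x = y then 1 else 0) + \<theta> d * (Q $ x $ y / l)"
        by (auto simp: pmf_jump algebra_simps)
      ultimately have "\<bar>trans_prob d x y - (if x = y then 1 else 0) - \<theta> d * (Q $ x $ y / l)\<bar> / d \<le> (\<theta> d)\<^sup>2 / d"
        using elim by (intro divide_right_mono) (auto simp: algebra_simps)
      also have "\<bar>trans_prob d x y - (if x = y then 1 else 0) - \<theta> d * (Q $ x $ y / l)\<bar> / d =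
          \<bar>(trans_prob d x y - (if x = y then 1 else 0) - \<theta> d * (Q $ x $ y / l)) / d\<bar>"
        using elim by simp
      also have "(trans_prob d x y - (if x = y then 1 else 0) - \<theta> d * (Q $ x $ y / l)) / d =
          ((1 / d) *\<^sub>R (trans_matrix d - mat 1)) $ x $ y - \<theta> d / d * (Q $ x $ y / l)"
        by (simp add: trans_matrix_def mat_def diff_divide_distrib)
      finally show ?case by (simp add: power2_eq_square)
    qed
  qed
  moreover have "((\<lambda>d. \<theta> d / d * (Q $ x $ y / l)) \<longlongrightarrow> l * (Q $ x $ y / l)) (at_right 0)"
    by (intro tendsto_intros rate_lim)
  ultimately have "((\<lambda>d. (((1 / d) *\<^sub>R (trans_matrix d - mat 1)) $ x $ y - \<theta> d / d * (Q $ x $ y / l)) + \<theta> d / d * (Q $ x $ y / l))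
      \<longlongrightarrow> 0 + l * (Q $ x $ y / l)) (at_right 0)"
    by (rule tendsto_add)
  then show "((\<lambda>d. ((1 / d) *\<^sub>R (trans_matrix d - mat 1)) $ x $ y) \<longlongrightarrow> Q $ x $ y) (at_right 0)"
    using l by simp
qed

lemma trans_matrix_add:
  assumes "0 \<le> s" "0 \<le> t"
  shows "trans_matrix (s + t) *v f = trans_matrix s *v (trans_matrix t *v f)"
proof -
  have "trans_matrix (s + t) = trans_matrix s ** trans_matrix t"
    by (simp add: trans_matrix_def matrix_matrix_mult_def trans_prob_add[OF assms])
  then show ?thesis by (simp add: matrix_vector_mul_assoc)
qed

lemma trans_matrix_0: "trans_matrix 0 = mat 1"
  by (simp add: trans_matrix_def mat_def trans_prob_0 vec_eq_iff)

lemma trans_matrix_pow: "0 \<le> d \<Longrightarrow> ((*v) (trans_matrix d) ^^ n) f = trans_matrix (real n * d) *v f"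
proof (induction n)
  case (Suc n)
  then show ?case using trans_matrix_add[of d "real n * d" f] by (simp add: algebra_simps)
qed (simp add: trans_matrix_0)

lemma infnorm_trans_matrix:
  assumes "0 \<le> t"
  shows "infnorm (trans_matrix t *v f) \<le> infnorm f"
proof (rule infnorm_le_cartI)
  fix x
  have "\<bar>(trans_matrix t *v f) $ x\<bar> \<le> (\<Sum>y\<in>UNIV. \<bar>trans_prob t x y * f $ y\<bar>)"
    unfolding mult_vec_nth trans_matrix_def by (simp add: sum_abs)
  also have "\<dots> \<le> (\<Sum>y\<in>UNIV. trans_prob t x y * infnorm f)"
    unfolding abs_mult by (intro sum_mono) (simp add: component_le_infnorm_cart mult_left_mono)
  also have "\<dots> = infnorm f" using sum_trans_prob[OF assms] by (simp add: sum_distrib_right[symmetric])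
  finally show "\<bar>(trans_matrix t *v f) $ x\<bar> \<le> infnorm f" .
qed

text \<open>An Euler step and an exact step of the semigroup differ by \<open>d * \<eta> d\<close>,
  where \<open>\<eta>\<close> tends to zero by \<open>trans_matrix_derivative\<close>. As Euler
  steps are nonexpansive, \<open>n\<close> steps of length \<open>t / n\<close> accumulate at most
  \<open>t * \<eta> (t / n) * infnorm f\<close>. The case \<open>t = 0\<close> is separate because
  \<open>t / n\<close> has to approach 0 from the right.\<close>

lemma op_exp_eq_trans_matrix:
  assumes t: "0 \<le> t"
  shows "op_exp ((*v) Q) t f = trans_matrix t *v f"
proof -
  let ?E = "\<lambda>n. (euler_step ((*v) Q) (t / real n) ^^ n) f"
  have lim: "?E \<longlonglongrightarrow> op_exp ((*v) Q) t f"
    using op_exp_lower_rate_tendsto[of "{Q}" t f] rate t by (simp add: lower_rate_singleton)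
  show ?thesis
  proof (cases "t = 0")
    case True
    have "(euler_step ((*v) Q) 0 ^^ n) f = f" for n by (induction n) (auto simp: euler_step_def)
    then have "?E n = f" for n by (simp add: True)
    then have "?E \<longlonglongrightarrow> f" by (simp only: tendsto_const)
    from LIMSEQ_unique[OF lim this] show ?thesis by (simp add: True trans_matrix_0)
  next
    case False
    with t have t0: "0 < t" by simp
    obtain b where b: "0 < b" "\<forall>x y. \<bar>Q $ x $ y\<bar> \<le> b" using entry_bound[of Q] .
    interpret euler_scheme "lower_rate {Q}" "real CARD('x) * b" "1 / b"
      by (rule euler_scheme_lower_rate) (use rate b in auto)
    define \<eta> where "\<eta> d = real CARD('x) * norm ((1 / d) *\<^sub>R (trans_matrix d - mat 1) - Q)" for d
    have step: "infnorm (euler_step ((*v) Q) d g - trans_matrix d *v g) \<le> d * \<eta> d * infnorm g" if d: "0 < d" for d g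
    proof -
      define Y where "Y = ((1 / d) *\<^sub>R (trans_matrix d - mat 1) - Q) *v g"
      have "Y = (1 / d) *\<^sub>R (trans_matrix d *v g - g) - Q *v g"
        by (simp add: Y_def matrix_vector_mult_diff_rdistrib scaleR_matrix_vector_assoc[symmetric])
      then have eq: "- (euler_step ((*v) Q) d g - trans_matrix d *v g) = d *\<^sub>R Y"
        using d by (simp add: euler_step_def scaleR_diff_right)
      have "infnorm (euler_step ((*v) Q) d g - trans_matrix d *v g) =
          infnorm (- (euler_step ((*v) Q) d g - trans_matrix d *v g))"
        by (rule infnorm_neg[symmetric])
      also have "\<dots> = d * infnorm Y" unfolding eq infnorm_mul using d by simp
      also have "\<dots> \<le> d * (real CARD('x) * norm ((1 / d) *\<^sub>R (trans_matrix d - mat 1) - Q) * infnorm g)"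
        unfolding Y_def using d by (intro mult_left_mono infnorm_matrix_mult_le) auto
      finally show ?thesis by (simp add: \<eta>_def mult.assoc)
    qed
    have bound: "infnorm (?E n - trans_matrix t *v f) \<le> t * \<eta> (t / real n) * infnorm f" if n: "t * b \<le> real n" for n
    proof -
      have n0: "0 < real n" using n t0 b mult_pos_pos[OF t0 b(1)] by linarith
      define d where "d = t / real n"
      have d: "0 < d" "d \<le> 1 / b" using n n0 t0 b by (auto simp: d_def field_simps)
      have "infnorm ((euler_step ((*v) Q) d ^^ n) f - ((*v) (trans_matrix d) ^^ n) f) \<le> real n * (d * \<eta> d * infnorm f)"
      proof (rule telescoping)
        show "infnorm (euler_step ((*v) Q) d g - euler_step ((*v) Q) d h) \<le> infnorm (g - h)" for g h
          using nonexp[of d g h] d by (simp add: lower_rate_singleton)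
      next
        fix j
        have "infnorm (((*v) (trans_matrix d) ^^ j) f) \<le> infnorm f"
          using d by (simp add: trans_matrix_pow infnorm_trans_matrix)
        then have "d * \<eta> d * infnorm (((*v) (trans_matrix d) ^^ j) f) \<le> d * \<eta> d * infnorm f"
          using d by (intro mult_left_mono) (simp_all add: \<eta>_def)
        with step[OF d(1)] show "infnorm (euler_step ((*v) Q) d (((*v) (trans_matrix d) ^^ j) f) -
            trans_matrix d *v (((*v) (trans_matrix d) ^^ j) f)) \<le> d * \<eta> d * infnorm f"
          using order_trans by blast
      qed
      moreover have "real n * d = t" using n0 by (simp add: d_def)
      ultimately show ?thesis
        using d by (simp add: trans_matrix_pow d_def[symmetric] mult.assoc[symmetric])
    qed
    have "\<forall>\<^sub>F n in sequentially. t / real n \<in> {0<..} \<and> t / real n \<noteq> 0"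
      using eventually_gt_at_top[of "0::nat"] by eventually_elim (use t0 in simp)
    with lim_const_over_n[of t] have "filterlim (\<lambda>n. t / real n) (at_right 0) sequentially"
      by (simp only: filterlim_at conj_commute)
    then have "(\<lambda>n. (1 / (t / real n)) *\<^sub>R (trans_matrix (t / real n) - mat 1)) \<longlonglongrightarrow> Q"
      by (rule filterlim_compose[OF trans_matrix_derivative])
    then have "(\<lambda>n. real CARD('x) * norm ((1 / (t / real n)) *\<^sub>R (trans_matrix (t / real n) - mat 1) - Q)) \<longlonglongrightarrow> real CARD('x) * norm (Q - Q)"
      by (intro tendsto_intros)
    then have "(\<lambda>n. \<eta> (t / real n)) \<longlonglongrightarrow> 0" unfolding \<eta>_def by simp
    then have "(\<lambda>n. t * \<eta> (t / real n) * infnorm f) \<longlonglongrightarrow> t * 0 * infnorm f"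
      by (intro tendsto_mult tendsto_const)
    then have e0: "(\<lambda>n. t * \<eta> (t / real n) * infnorm f) \<longlonglongrightarrow> 0" by simp
    obtain N :: nat where N: "t * b \<le> real N" using real_arch_simple by blast
    have "(\<lambda>n. infnorm (?E n - trans_matrix t *v f)) \<longlonglongrightarrow> 0"
    proof (rule tendsto_sandwich[OF _ _ tendsto_const e0])
      show "\<forall>\<^sub>F n in sequentially. infnorm (?E n - trans_matrix t *v f) \<le> t * \<eta> (t / real n) * infnorm f"
        using eventually_ge_at_top[of N] by eventually_elim (rule bound, use N in linarith)
    qed (simp add: infnorm_pos_le)
    moreover have "(\<lambda>n. infnorm (?E n - trans_matrix t *v f)) \<longlonglongrightarrow> infnorm (op_exp ((*v) Q) t f - trans_matrix t *v f)"
      by (intro tendsto_infnorm tendsto_diff lim tendsto_const)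
    ultimately have "infnorm (op_exp ((*v) Q) t f - trans_matrix t *v f) = 0" using LIMSEQ_unique by blast
    then show ?thesis by (simp add: infnorm_eq_0)
  qed
qed

lemma op_exp_indv:
  assumes "0 \<le> t"
  shows "op_exp ((*v) Q) t (indv {y}) $ x = trans_prob t x y"
proof -
  have "(trans_matrix t *v indv {y}) $ x = (\<Sum>z\<in>UNIV. if z = y then trans_prob t x z else 0)"
    unfolding mult_vec_nth by (intro sum.cong) (auto simp: indv_def trans_matrix_def)
  then show ?thesis by (simp add: op_exp_eq_trans_matrix[OF assms])
qed

lemma exp_matrix_derivative: "((\<lambda>d. (1 / d) *\<^sub>R (exp_matrix Q d - mat 1)) \<longlongrightarrow> Q) (at_right 0)"
proof (rule Lim_transform_eventually[OF trans_matrix_derivative])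
  show "\<forall>\<^sub>F d in at_right 0. (1 / d) *\<^sub>R (trans_matrix d - mat 1) = (1 / d) *\<^sub>R (exp_matrix Q d - mat 1)"
    using eventually_at_right_less[of "0::real"]
    by eventually_elim (simp add: exp_matrix_def trans_matrix_def op_exp_indv)
qed

text \<open>The conditional measure given a history is the law of the path that interpolates the
  history up to its last time and then follows the chain.\<close>

definition history_path :: "(real \<rightharpoonup> 'x) \<Rightarrow> real \<Rightarrow> 'x" where
  "history_path h r = (let D = {t \<in> dom h. t \<le> r} in if D = {} then undefined else the (h (Max D)))"

definition start_time :: "(real \<rightharpoonup> 'x) \<Rightarrow> real" where
  "start_time h = (if dom h = {} then 0 else Max (dom h))"

text \<open>For the empty history this is an arbitrary fixed state. The unconditional law then
  starts from a point mass, which is admissible since initial distributions are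
  unconstrained.\<close>

definition start_state :: "(real \<rightharpoonup> 'x) \<Rightarrow> 'x" where
  "start_state h = (if dom h = {} then undefined else the (h (Max (dom h))))"

definition glue :: "(real \<rightharpoonup> 'x) \<Rightarrow> 'x marks \<Rightarrow> real \<Rightarrow> 'x" where
  "glue h w = (\<lambda>r\<in>{0..}. if r < start_time h then history_path h r
    else chain_path (start_state h) w (r - start_time h))"

definition chain :: "'x process" where
  "chain h = distr W (coord_algebra {0..}) (glue h)"

lemma start_time_nonneg:
  assumes h: "history h"
  shows "0 \<le> start_time h"
proof (cases "dom h = {}")
  case False
  then have "Max (dom h) \<in> dom h" using h by (intro Max_in) (simp_all add: history_def)
  also have "dom h \<subseteq> {0..}" using h by (simp add: history_def)
  finally show ?thesis using False by (simp add: start_time_def)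
qed (simp add: start_time_def)

lemma history_path_right:
  assumes "finite (dom h)"
  shows "\<forall>\<^sub>F s in at_right t. history_path h s = history_path h t"
proof -
  have "\<forall>\<^sub>F s in at_right t. \<forall>u\<in>dom h. u \<le> s \<longleftrightarrow> u \<le> t"
  proof (rule eventually_ball_finite[OF assms], rule ballI)
    fix u
    show "\<forall>\<^sub>F s in at_right t. u \<le> s \<longleftrightarrow> u \<le> t"
    proof (cases "u \<le> t")
      case True
      then show ?thesis using eventually_at_right_less[of t] by (auto elim: eventually_mono)
    next
      case False
      then show ?thesis using eventually_at_right_real[of t u] by (auto elim: eventually_mono)
    qed
  qed
  then show ?thesis
  proof eventually_elim
    case (elim s)
    then have "{u \<in> dom h. u \<le> s} = {u \<in> dom h. u \<le> t}" by auto
    then show ?case by (simp add: history_path_def)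
  qed
qed

lemma history_path_left:
  assumes "finite (dom h)"
  shows "\<exists>y. \<forall>\<^sub>F s in at_left t. history_path h s = y"
proof -
  define y where "y = (let D = {u \<in> dom h. u < t} in if D = {} then undefined else the (h (Max D)))"
  have "\<forall>\<^sub>F s in at_left t. \<forall>u\<in>dom h. u \<le> s \<longleftrightarrow> u < t"
  proof (rule eventually_ball_finite[OF assms], rule ballI)
    fix u
    show "\<forall>\<^sub>F s in at_left t. u \<le> s \<longleftrightarrow> u < t"
    proof (cases "u < t")
      case True
      then show ?thesis using eventually_at_left_real[of u t] by (auto elim: eventually_mono)
    next
      case False
      then show ?thesis using eventually_at_left_real[of "t - 1" t] by (auto elim: eventually_mono)
    qed
  qed
  then have "\<forall>\<^sub>F s in at_left t. history_path h s = y"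
  proof eventually_elim
    case (elim s)
    then have "{u \<in> dom h. u \<le> s} = {u \<in> dom h. u < t}" by auto
    then show ?case by (simp add: history_path_def y_def)
  qed
  then show ?thesis ..
qed

lemma glue_in_paths:
  assumes h: "history h"
  shows "glue h w \<in> paths"
proof -
  let ?s = "start_time h" and ?c = "chain_path (start_state h) w"
  have s: "0 \<le> ?s" by (rule start_time_nonneg[OF h])
  have fin: "finite (dom h)" using h by (simp add: history_def)
  have c: "?c \<in> paths" by (rule chain_path_in_paths)
  have "\<forall>\<^sub>F r in at_right t. glue h w r = glue h w t" if t: "0 \<le> t" for t
  proof (cases "t < ?s")
    case True
    show ?thesis
      using history_path_right[OF fin, of t] eventually_at_right_real[OF True]
      by eventually_elim (use t True in \<open>simp add: glue_def\<close>)
  next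
    case False
    then have "\<forall>\<^sub>F r in at_right (t - ?s). ?c r = ?c (t - ?s)" using c by (simp add: paths_iff)
    then have "\<forall>\<^sub>F r in at_right t. ?c (r - ?s) = ?c (t - ?s)"
      unfolding eventually_at_right_to_0[of _ "t - ?s"] eventually_at_right_to_0[of _ t] by (simp add: algebra_simps)
    then show ?thesis
      using eventually_at_right_less[of t] by eventually_elim (use t False in \<open>simp add: glue_def\<close>)
  qed
  moreover have "\<exists>y. \<forall>\<^sub>F r in at_left t. glue h w r = y" if t: "0 < t" for t
  proof (cases "t \<le> ?s")
    case True
    obtain y where "\<forall>\<^sub>F r in at_left t. history_path h r = y" using history_path_left[OF fin] by blast
    then have "\<forall>\<^sub>F r in at_left t. glue h w r = y"
      using eventually_at_left_real[OF t] by eventually_elim (use True in \<open>simp add: glue_def\<close>)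
    then show ?thesis ..
  next
    case False
    then have "0 < t - ?s" by simp
    then obtain y where "\<forall>\<^sub>F r in at_left (t - ?s). ?c r = y" using c unfolding paths_iff by metis
    then obtain b where b: "b < t - ?s" "\<And>r. b < r \<Longrightarrow> r < t - ?s \<Longrightarrow> ?c r = y"
      unfolding eventually_at_left_field by blast
    have "\<forall>\<^sub>F r in at_left t. r \<in> {max ?s (b + ?s)<..<t}" using b False by (intro eventually_at_left_real) auto
    then have "\<forall>\<^sub>F r in at_left t. glue h w r = y"
      by eventually_elim (use s in \<open>auto simp: glue_def intro!: b\<close>)
    then show ?thesis ..
  qed
  moreover have "glue h w \<in> extensional {0..}" by (simp add: glue_def)
  ultimately show ?thesis unfolding paths_iff by blast
qed

lemma measurable_glue:
  assumes h: "history h"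
  shows "glue h \<in> measurable W (coord_algebra {0..})"
proof (rule measurable_into_coord_algebra)
  show "glue h w \<in> paths" for w by (rule glue_in_paths[OF h])
  fix t :: real and y :: 'x assume t: "t \<in> {0..}"
  show "{w \<in> space W. glue h w t = y} \<in> sets W"
  proof (cases "t < start_time h")
    case True
    then show ?thesis using t by (simp add: glue_def)
  next
    case False
    then show ?thesis using t sets_state_event[of "t - start_time h" "start_state h" y] by (simp add: glue_def)
  qed
qed

lemma measure_chain:
  assumes h: "history h" and B: "B \<in> sets (coord_algebra {0..})"
  shows "measure (chain h) B = measure W {w \<in> space W. glue h w \<in> B}"
  unfolding chain_def measure_distr[OF measurable_glue[OF h] B]
  by (rule arg_cong[where f = "measure W"]) auto

lemma time_shift_glue:
  assumes "history h" "start_time h \<le> s"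
  shows "time_shift s (glue h w) = time_shift (s - start_time h) (chain_path (start_state h) w)"
  unfolding time_shift_def
  by (intro restrict_ext) (use assms start_time_nonneg[OF assms(1)] in \<open>simp add: glue_def algebra_simps\<close>)

lemma measure_chain_at_state:
  assumes h: "history h" and s: "start_time h \<le> s"
  shows "measure (chain h) (at_state s y) = trans_prob (s - start_time h) (start_state h) y"
proof -
  have s0: "0 \<le> s" using start_time_nonneg[OF h] s by simp
  have "{w \<in> space W. glue h w \<in> at_state s y} = {w \<in> space W. chain_path (start_state h) w (s - start_time h) = y}"
    using s s0 by (auto simp: at_state_def glue_in_paths[OF h]) (simp_all add: glue_def)
  then show ?thesis
    using measure_chain[OF h, of "at_state s y"] s0 by (simp add: at_state_in_coord_algebra trans_prob_def)
qed

text \<open>Earlier times of the history are reproduced by the step function, the last one by the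
  start of the chain path, which takes over at \<open>start_time h\<close> itself.\<close>

lemma glue_history:
  assumes h: "history h" and t: "t \<in> dom h"
  shows "h t = Some (glue h w t)"
proof -
  have fin: "finite (dom h)" and t0: "0 \<le> t" using h t by (auto simp: history_def)
  have st: "start_time h = Max (dom h)" "start_state h = the (h (Max (dom h)))"
    using t by (auto simp: start_time_def start_state_def)
  have "t \<le> Max (dom h)" using fin t by simp
  then have "glue h w t = the (h t)"
  proof (cases "t < Max (dom h)")
    case True
    have "Max {u \<in> dom h. u \<le> t} = t" using fin t by (intro Max_eqI) auto
    then have "history_path h t = the (h t)" using t by (auto simp: history_path_def Let_def)
    then show ?thesis using True t0 by (simp add: glue_def st)
  next
    case False
    with \<open>t \<le> Max (dom h)\<close> have "t = Max (dom h)" by simp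
    then show ?thesis using t0 by (simp add: glue_def st chain_path_0)
  qed
  then show ?thesis using t by auto
qed

lemma start_update:
  assumes h: "history h" and s: "\<And>t. t \<in> dom h \<Longrightarrow> t \<le> s"
  shows "start_time (h(s \<mapsto> y)) = s" "start_state (h(s \<mapsto> y)) = y"
proof -
  have "Max (insert s (dom h)) = s" using h s by (intro Max_eqI) (auto simp: history_def)
  then show "start_time (h(s \<mapsto> y)) = s" "start_state (h(s \<mapsto> y)) = y"
    by (simp_all add: start_time_def start_state_def)
qed

lemma stochastic_process_chain: "stochastic_process chain"
  unfolding stochastic_process_def
proof (intro conjI allI impI)
  fix h :: "real \<rightharpoonup> 'x" assume h: "history h"
  show prob: "prob_space (chain h)"
    unfolding chain_def by (rule W.prob_space_distr[OF measurable_glue[OF h]])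
  show sets: "sets (chain h) = sets (coord_algebra {0..})" by (simp add: chain_def)
  have "glue h w \<in> history_event h" for w
    using glue_history[OF h] glue_in_paths[OF h] by (simp add: history_event_def)
  moreover have "history_event h \<in> sets (coord_algebra {0..})"
  proof -
    have "history_event h = space (coord_algebra {0..}) \<inter> (\<Inter>t\<in>dom h. at_state t (the (h t)))"
    proof -
      have "h t = Some (\<omega> t) \<longleftrightarrow> \<omega> t = the (h t)" if "t \<in> dom h" for t \<omega>
        using that by auto
      then show ?thesis unfolding history_event_def at_state_def by auto
    qed
    also have "\<dots> \<in> sets (coord_algebra {0..})"
    proof (cases "dom h = {}")
      case False
      have "(\<Inter>t\<in>dom h. at_state t (the (h t))) \<in> sets (coord_algebra {0..})"
        using h False by (intro sets.finite_INT) (auto simp: history_def intro!: at_state_in_coord_algebra)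
      then show ?thesis by (intro sets.Int sets.top)
    qed (simp add: paths_sets)
    finally show ?thesis .
  qed
  ultimately show "measure (chain h) (history_event h) = 1"
    using measure_chain[OF h] W.prob_space by simp
next
  fix h :: "real \<rightharpoonup> 'x" and s and y :: 'x and B :: "(real \<Rightarrow> 'x) set"
  assume "history h \<and> 0 \<le> s \<and> (\<forall>t\<in>dom h. t < s) \<and> B \<in> sets (coord_algebra {s..})"
  then have h: "history h" and s: "0 \<le> s" "\<And>t. t \<in> dom h \<Longrightarrow> t < s" and B: "B \<in> sets (coord_algebra {s..})" by auto
  obtain B' where B': "B' \<in> sets (coord_algebra {0..})" "B = {\<omega> \<in> paths. time_shift s \<omega> \<in> B'}"
    using time_shift_preimage[OF s(1) B] .
  have B0: "B \<in> sets (coord_algebra {0..})" using B sets_coord_algebra_mono[of "{s..}" "{0..}"] s by auto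
  have at: "at_state s y \<in> sets (coord_algebra {0..})" using s by (simp add: at_state_in_coord_algebra)
  have start: "start_time h \<le> s"
    using h s by (auto simp: start_time_def history_def intro: less_imp_le)
  have h': "history (h(s \<mapsto> y))" using h s by (auto simp: history_def)
  let ?x = "start_state h" and ?r = "s - start_time h"
  \<comment> \<open>From the last history time on, the glued path is the chain path delayed by
    \<open>start_time h\<close>. The joint event is therefore a \<open>law_event\<close> for the
    elapsed time \<open>?r\<close>, to which the Markov property applies.\<close>
  have "{w \<in> space W. glue h w \<in> B \<inter> at_state s y} = law_event ?r y B' ?x"
    using start s(1) by (auto simp: B'(2) law_event_def glue_in_paths[OF h] time_shift_glue[OF h start] at_state_def)
      (simp_all add: glue_def)
  then have "measure (chain h) (B \<inter> at_state s y) = measure W (law_event ?r y B' ?x)"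
    using measure_chain[OF h sets.Int[OF B0 at]] by simp
  also have "\<dots> = trans_prob ?r ?x y * measure W {w \<in> space W. chain_path y w \<in> B'}"
    using law_event_prob[OF B'(1), of ?r y ?x] start
    by (simp add: measure_def start_prob_def enn2real_mult)
  \<comment> \<open>After \<open>s \<mapsto> y\<close> is appended, the gluing restarts at time
    \<open>s\<close> in \<open>y\<close>, so the shifted glued path is exactly
    \<open>chain_path y w\<close>. This is an identity of paths and holds also where
    \<open>y\<close> has probability zero.\<close>
  also have "{w \<in> space W. chain_path y w \<in> B'} = {w \<in> space W. glue (h(s \<mapsto> y)) w \<in> B}"
  proof -
    have st: "start_time (h(s \<mapsto> y)) = s" "start_state (h(s \<mapsto> y)) = y"
      using start_update[OF h, of s y] s by (auto intro: less_imp_le)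
    have "time_shift 0 (chain_path y w) = chain_path y w" for w
      by (auto simp: time_shift_def chain_path_def)
    then have "time_shift s (glue (h(s \<mapsto> y)) w) = chain_path y w" for w
      using time_shift_glue[OF h', of s w] st by simp
    then show ?thesis by (simp add: B'(2) glue_in_paths[OF h'])
  qed
  also have "measure W \<dots> = measure (chain (h(s \<mapsto> y))) B" by (rule measure_chain[OF h' B0, symmetric])
  finally show "measure (chain h) (B \<inter> at_state s y) = measure (chain (h(s \<mapsto> y))) B * measure (chain h) (at_state s y)"
    using measure_chain_at_state[OF h start, of y] by simp
qed

lemma measure_chain_singleton:
  assumes "0 \<le> t" "t \<le> s"
  shows "measure (chain [t \<mapsto> x]) (at_state s y) = trans_prob (s - t) x y"
  using measure_chain_at_state[of "[t \<mapsto> x]" s y] start_update[of Map.empty t x] assms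
  by (simp add: history_def)

text \<open>From the last history time on, state probabilities depend on the history only through
  its last state and on time only through the time elapsed; both properties are read off from
  this.\<close>

lemma homogeneous_chain: "homogeneous_markov_chain chain"
  unfolding homogeneous_markov_chain_def markov_chain_def
proof (intro conjI stochastic_process_chain allI impI)
  fix h :: "real \<rightharpoonup> 'x" and t x s y
  assume *: "history h \<and> t \<in> dom h \<and> (\<forall>r\<in>dom h. r \<le> t) \<and> h t = Some x \<and> t \<le> s"
  then have h: "history h" and t: "0 \<le> t" "t \<le> s" by (auto simp: history_def)
  have eq: "h(t \<mapsto> x) = h" using * by auto
  have "start_time h = t" "start_state h = x"
    using start_update[OF h, of t x, unfolded eq] * by blast+
  then show "measure (chain h) (at_state s y) = measure (chain [t \<mapsto> x]) (at_state s y)"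
    using measure_chain_at_state[OF h, of s y] measure_chain_singleton[OF t] t by simp
next
  fix t s :: real and x y :: 'x assume "0 \<le> t \<and> t \<le> s"
  then show "measure (chain [t \<mapsto> x]) (at_state s y) = measure (chain [0 \<mapsto> x]) (at_state (s - t) y)"
    by (simp add: measure_chain_singleton)
qed

lemma has_rate_matrix_chain: "has_rate_matrix chain Q"
  unfolding has_rate_matrix_def using rate by (simp add: measure_chain_singleton op_exp_indv)

end

lemma uniformization_exists:
  assumes "rate_matrix Q"
  obtains l where "uniformization Q l"
proof -
  obtain b where b: "0 < b" "\<forall>x y. \<bar>Q $ x $ y\<bar> \<le> b" using entry_bound[of Q] .
  have "uniformization Q b"
  proof
    show "- (Q $ x $ x) \<le> b" for x using b(2)[rule_format, of x x] by simp
  qed (use assms b in auto)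
  then show ?thesis by (rule that)
qed

section \<open>Expected hitting times of imprecise Markov chains\<close>

lemma exp_matrix_derivative_at_0:
  assumes "rate_matrix Q"
  shows "((\<lambda>d. (1 / d) *\<^sub>R (exp_matrix Q d - mat 1)) \<longlongrightarrow> Q) (at_right 0)"
proof -
  obtain l where "uniformization Q l" using uniformization_exists[OF assms] .
  then show ?thesis by (rule uniformization.exp_matrix_derivative)
qed

lemma homogeneous_chain_exists:
  assumes "rate_matrix Q"
  obtains P where "homogeneous_markov_chain P" "has_rate_matrix P Q"
proof -
  obtain l where l: "uniformization Q l" using uniformization_exists[OF assms] .
  show ?thesis
    using that[OF uniformization.homogeneous_chain[OF l] uniformization.has_rate_matrix_chain[OF l]] .
qed

lemma P_HM_subset_P_M:
  assumes "\<And>Q. Q \<in> \<Q> \<Longrightarrow> rate_matrix Q"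
  shows "P_HM \<Q> \<subseteq> P_M \<Q>"
proof
  fix P assume "P \<in> P_HM \<Q>"
  then obtain Q where P: "homogeneous_markov_chain P" "has_rate_matrix P Q" and Q: "Q \<in> \<Q>"
    unfolding P_HM_def by blast
  have "consistent_with P \<Q>"
    by (rule homogeneous_consistent[OF P Q exp_matrix_derivative_at_0[OF assms[OF Q]]])
  moreover have "markov_chain P" using P(1) unfolding homogeneous_markov_chain_def by blast
  ultimately show "P \<in> P_M \<Q>" unfolding P_M_def by blast
qed

lemma P_M_subset_P_I: "P_M \<Q> \<subseteq> P_I \<Q>"
  unfolding P_M_def P_I_def markov_chain_def by blast

lemma absorbing_processI:
  assumes "P \<in> P_I \<Q>" "\<And>Q. Q \<in> \<Q> \<Longrightarrow> rate_matrix Q" "\<And>Q a. Q \<in> \<Q> \<Longrightarrow> a \<in> A \<Longrightarrow> Q $ a $ a = 0"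
  shows "absorbing_process P \<Q> A"
  using assms by unfold_locales (auto simp: P_I_def)

lemma homogeneous_expected_hitting_time:
  assumes P: "homogeneous_markov_chain P" "has_rate_matrix P Q"
    and Q: "rate_matrix Q" "reaches A Q" "\<And>a. a \<in> A \<Longrightarrow> Q $ a $ a = 0"
  shows "expected_hitting_time A P x = ennreal (min_hitting_solution A Q $ x)"
proof -
  have "P \<in> P_HM {Q}" using P by (simp add: P_HM_def)
  then have "P \<in> P_I {Q}" using P_HM_subset_P_M[of "{Q}"] P_M_subset_P_I[of "{Q}"] Q(1) by blast
  then interpret absorbing_process P "{Q}" A x
    by (rule absorbing_processI) (use Q in auto)
  let ?h = "min_hitting_solution A Q"
  have h: "y \<in> A \<Longrightarrow> ?h $ y = 0" "0 \<le> ?h $ y" "w \<notin> A \<Longrightarrow> (Q *v ?h) $ w = - 1" for y w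
    using min_hitting_solution_eqs[OF Q(1,2)] min_hitting_solution_unique(2)[OF Q(1,2)] by blast+
  show ?thesis
    by (intro order.antisym expected_hitting_time_le expected_hitting_time_ge) (use h in auto)
qed

theorem theorem1:
  fixes \<Q> :: "(real ^ 'x ^ 'x::finite) set" and A :: "'x set"
  assumes "CARD('x) \<ge> 2"
    and "A \<noteq> {}" and "A \<noteq> UNIV"
    and "\<Q> \<noteq> {}" and "compact \<Q>" and "convex \<Q>"
    and "\<forall>Q\<in>\<Q>. rate_matrix Q"
    and "separately_specified_rows \<Q>"
    and "\<forall>Q\<in>\<Q>. \<forall>x\<in>A. Q $ x $ x = 0"
    and "\<forall>t>0. \<forall>x\<in>-A. op_exp (lower_rate \<Q>) t (indv A) $ x > 0"
  shows "lower_h A \<Q> = lower_expected_hitting_time A (P_HM \<Q>)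
       \<and> lower_expected_hitting_time A (P_HM \<Q>) = lower_expected_hitting_time A (P_M \<Q>)
       \<and> lower_expected_hitting_time A (P_M \<Q>) = lower_expected_hitting_time A (P_I \<Q>)
       \<and> upper_h A \<Q> = upper_expected_hitting_time A (P_HM \<Q>)
       \<and> upper_expected_hitting_time A (P_HM \<Q>) = upper_expected_hitting_time A (P_M \<Q>)
       \<and> upper_expected_hitting_time A (P_M \<Q>) = upper_expected_hitting_time A (P_I \<Q>)"
proof -
  have rate: "rate_matrix Q" if "Q \<in> \<Q>" for Q using assms(7) that by blast
  have absorbing: "Q $ a $ a = 0" if "Q \<in> \<Q>" "a \<in> A" for Q a using assms(9) that by blast
  have reach: "reaches A Q" if "Q \<in> \<Q>" for Q
    by (rule reaches_if_lower_reachable[OF assms(5,4) rate _ that]) (use assms(10) in auto)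
  let ?h = "min_hitting_solution A"
  have HM_ex: "\<exists>P\<in>P_HM \<Q>. expected_hitting_time A P x = ennreal (?h Q $ x)" if Q: "Q \<in> \<Q>" for Q x
  proof -
    obtain P where P: "homogeneous_markov_chain P" "has_rate_matrix P Q"
      using homogeneous_chain_exists[OF rate[OF Q]] .
    then have "P \<in> P_HM \<Q>" using Q unfolding P_HM_def by blast
    then show ?thesis
      using homogeneous_expected_hitting_time[OF P rate[OF Q] reach[OF Q] absorbing[OF Q]] by blast
  qed
  have sub: "P_HM \<Q> \<subseteq> P_M \<Q>" "P_M \<Q> \<subseteq> P_I \<Q>"
    using P_HM_subset_P_M[OF rate] P_M_subset_P_I by blast+
  have lower: "lower_h A \<Q> x = lower_expected_hitting_time A (P_HM \<Q>) x \<and>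
      lower_expected_hitting_time A (P_HM \<Q>) x = lower_expected_hitting_time A (P_M \<Q>) x \<and>
      lower_expected_hitting_time A (P_M \<Q>) x = lower_expected_hitting_time A (P_I \<Q>) x" for x
  proof -
    \<comment> \<open>The sign \<open>- 1\<close> selects the minimiser, and the optimality
      condition then reads \<open>- 1 \<le> (Q *v ?h R) $ w\<close>.\<close>
    obtain R where R: "R \<in> \<Q>" and Rh: "\<forall>Q\<in>\<Q>. \<forall>w. w \<notin> A \<longrightarrow> - 1 * (Q *v ?h R) $ w \<le> - (- 1)"
      by (rule optimal_rate_matrix[OF assms(5,4,8) rate reach, of "- 1"]) simp_all
    have "lower_expected_hitting_time A (P_HM \<Q>) x \<le> lower_h A \<Q> x"
      unfolding lower_h_def lower_expected_hitting_time_def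
    proof (rule INF_greatest)
      fix Q assume "Q \<in> \<Q>"
      then obtain P where "P \<in> P_HM \<Q>" "expected_hitting_time A P x = ennreal (?h Q $ x)" using HM_ex by blast
      then show "(INF P\<in>P_HM \<Q>. expected_hitting_time A P x) \<le> ennreal (?h Q $ x)" by (metis INF_lower)
    qed
    moreover have "lower_expected_hitting_time A (P_M \<Q>) x \<le> lower_expected_hitting_time A (P_HM \<Q>) x"
      "lower_expected_hitting_time A (P_I \<Q>) x \<le> lower_expected_hitting_time A (P_M \<Q>) x"
      unfolding lower_expected_hitting_time_def using sub by (auto intro: INF_superset_mono)
    moreover have "lower_h A \<Q> x \<le> lower_expected_hitting_time A (P_I \<Q>) x"
      unfolding lower_expected_hitting_time_def
    proof (rule INF_greatest)
      fix P assume "P \<in> P_I \<Q>"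
      then interpret absorbing_process P \<Q> A x by (rule absorbing_processI[OF _ rate absorbing])
      have "lower_h A \<Q> x \<le> ennreal (?h R $ x)" unfolding lower_h_def by (rule INF_lower[OF R])
      also have "\<dots> \<le> expected_hitting_time A P x"
      proof (rule expected_hitting_time_ge)
        show "y \<in> A \<Longrightarrow> ?h R $ y = 0" for y by (rule min_hitting_solution_eqs(1)[OF rate[OF R] reach[OF R]])
        show "Q \<in> \<Q> \<Longrightarrow> w \<notin> A \<Longrightarrow> - 1 \<le> (Q *v ?h R) $ w" for Q w using Rh by fastforce
      qed
      finally show "lower_h A \<Q> x \<le> expected_hitting_time A P x" .
    qed
    \<comment> \<open>The inequalities close a cycle through all four quantities, so these
      coincide.\<close>
    ultimately show ?thesis by (meson order.antisym order.trans)
  qed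
  have upper: "upper_h A \<Q> x = upper_expected_hitting_time A (P_HM \<Q>) x \<and>
      upper_expected_hitting_time A (P_HM \<Q>) x = upper_expected_hitting_time A (P_M \<Q>) x \<and>
      upper_expected_hitting_time A (P_M \<Q>) x = upper_expected_hitting_time A (P_I \<Q>) x" for x
  proof -
    obtain R where R: "R \<in> \<Q>" and Rh: "\<forall>Q\<in>\<Q>. \<forall>w. w \<notin> A \<longrightarrow> 1 * (Q *v ?h R) $ w \<le> - 1"
      by (rule optimal_rate_matrix[OF assms(5,4,8) rate reach, of 1]) simp_all
    have "upper_h A \<Q> x \<le> upper_expected_hitting_time A (P_HM \<Q>) x"
      unfolding upper_h_def upper_expected_hitting_time_def
    proof (rule SUP_least)
      fix Q assume "Q \<in> \<Q>"
      then obtain P where "P \<in> P_HM \<Q>" "expected_hitting_time A P x = ennreal (?h Q $ x)" using HM_ex by blast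
      then show "ennreal (?h Q $ x) \<le> (SUP P\<in>P_HM \<Q>. expected_hitting_time A P x)" by (metis SUP_upper)
    qed
    moreover have "upper_expected_hitting_time A (P_HM \<Q>) x \<le> upper_expected_hitting_time A (P_M \<Q>) x"
      "upper_expected_hitting_time A (P_M \<Q>) x \<le> upper_expected_hitting_time A (P_I \<Q>) x"
      unfolding upper_expected_hitting_time_def using sub by (auto intro: SUP_subset_mono)
    moreover have "upper_expected_hitting_time A (P_I \<Q>) x \<le> upper_h A \<Q> x"
      unfolding upper_expected_hitting_time_def
    proof (rule SUP_least)
      fix P assume "P \<in> P_I \<Q>"
      then interpret absorbing_process P \<Q> A x by (rule absorbing_processI[OF _ rate absorbing])
      have "expected_hitting_time A P x \<le> ennreal (?h R $ x)"
      proof (rule expected_hitting_time_le)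
        show "0 \<le> ?h R $ y" for y by (rule min_hitting_solution_unique(2)[OF rate[OF R] reach[OF R]])
        show "Q \<in> \<Q> \<Longrightarrow> w \<notin> A \<Longrightarrow> (Q *v ?h R) $ w \<le> - 1" for Q w using Rh by fastforce
      qed
      also have "\<dots> \<le> upper_h A \<Q> x" unfolding upper_h_def by (rule SUP_upper[OF R])
      finally show "expected_hitting_time A P x \<le> upper_h A \<Q> x" .
    qed
    ultimately show ?thesis by (meson order.antisym order.trans)
  qed
  show ?thesis using lower upper by (simp add: fun_eq_iff)
qed

end
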